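(* For a given $\ell\in\mathbb{Z}_+$, $\ell$-$\mathcal L$PF and $\mathcal L$PF are NP-hard on dually chordal graphs and on doubly chordal graphs. Consequently, GDF and GPF are also NP-hard on dually chordal graphs and on doubly chordal graphs.
   Context: Graphs are finite, simple, undirected; $N[v]$ is the closed neighborhood; $f(U)=\sum_{x\in U}f(x)$; $[0,\ell]=\{0,\dots,\ell\}$; $F$ is a symbol meaning "free". A vertex $u\in N[v]$ is a maximum neighbor of $v$ if $N[w]\subseteq N[u]$ for every $w\in N[v]$. For an ordering $(v_1,\dots,v_n)$ of $V(G)$, let $G_i=G[\{v_i,\dots,v_n\}]$; it is an order of maximum neighborhoods if for each $i$, $v_i$ has a maximum neighbor in $G_i$. A graph is dually chordal if it admits an order of maximum neighborhoods; it is chordal if every cycle of length at least 4 has a chord; it is doubly chordal if it is chordal and dually chordal. $\mathcal L$PF: given $G=(V,E)$, $\ell\in\mathbb{Z}_+$, $\mathbf k\in\mathbb{Z}_+^V$, $\mathbf t\in\{0,F\}^V$, compute the maximum of $f(V)$ over $f:V\to[0,\ell]$ with $f(N[v])\leq k(v)$ for all $v$ and $f(v)=0$ whenever $t(v)=0$; $\ell$-$\mathcal L$PF is its restriction to a fixed $\ell$. GDF (resp. GPF): given $G$ and $\mathbf k,\mathbf u\in\mathbb{Z}_+^V$, compute the minimum (resp. maximum) of $f(V)$ over $f:V\to\mathbb{Z}_+$ with $f(v)\leq u(v)$ and $f(N[v])\geq k(v)$ (resp. $f(N[v])\leq k(v)$) for all $v\in V$.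
   Formalization: The claim is stated for ℓ ≥ 1: for ℓ = 0 the only feasible function is f = 0, the maximum is always 0, and the problem is trivially solvable, so it is not NP-hard unless P = NP. *)

theory Defs
  imports
    "HOL-Library.Extended_Nat"
    "HOL-Computational_Algebra.Polynomial"
begin

subsection \<open>Turing machines, NP and polynomial-time reductions\<close>

text \<open>
  Multi-tape machines with two-way infinite tapes. States and symbols are initial segments of the
  naturals; state 0 is initial, state 1 is the only halting (accepting) state, symbol 0 is the
  blank, and the symbols 1 and 2 stand for the input bits False and True. A transition
  \<open>(q, rs, q', as)\<close> applies in state \<open>q\<close> when the heads read \<open>rs\<close>; it writes the symbols and
  performs the head moves given by \<open>as\<close>, one entry per tape.
\<close>

datatype move = MLeft | MStay | MRight

record tm =
  tm_tapes :: nat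
  tm_states :: nat
  tm_symbols :: nat
  tm_trans :: "(nat \<times> nat list \<times> nat \<times> (nat \<times> move) list) set"

definition turing_machine :: "tm \<Rightarrow> bool" where
  "turing_machine M \<longleftrightarrow>
     tm_tapes M \<ge> 1 \<and> tm_states M \<ge> 2 \<and> tm_symbols M \<ge> 3 \<and>
     (\<forall>(q, rs, q', as) \<in> tm_trans M.
        q < tm_states M \<and> q \<noteq> 1 \<and> q' < tm_states M \<and>
        length rs = tm_tapes M \<and> set rs \<subseteq> {..<tm_symbols M} \<and>
        length as = tm_tapes M \<and> fst ` set as \<subseteq> {..<tm_symbols M})"

definition deterministic :: "tm \<Rightarrow> bool" where
  "deterministic M \<longleftrightarrow>
     (\<forall>q rs a b. (q, rs, a) \<in> tm_trans M \<longrightarrow> (q, rs, b) \<in> tm_trans M \<longrightarrow> a = b)"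

text \<open>A tape is given by its cell contents and the position of its head.\<close>

type_synonym tape = "(int \<Rightarrow> nat) \<times> int"
type_synonym config = "nat \<times> tape list"

fun read_tape :: "tape \<Rightarrow> nat" where
  "read_tape (t, h) = t h"

fun move_head :: "move \<Rightarrow> int \<Rightarrow> int" where
  "move_head MLeft h = h - 1"
| "move_head MStay h = h"
| "move_head MRight h = h + 1"

fun act_tape :: "nat \<times> move \<Rightarrow> tape \<Rightarrow> tape" where
  "act_tape (s, m) (t, h) = (t(h := s), move_head m h)"

definition tm_step :: "tm \<Rightarrow> config \<Rightarrow> config \<Rightarrow> bool" where
  "tm_step M c c' \<longleftrightarrow>
     (\<exists>q' as. (fst c, map read_tape (snd c), q', as) \<in> tm_trans M \<and>
              c' = (q', map2 act_tape as (snd c)))"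

definition word_tape :: "bool list \<Rightarrow> int \<Rightarrow> nat" where
  "word_tape w i = (if 0 \<le> i \<and> i < int (length w) then (if w ! nat i then 2 else 1) else 0)"

definition tm_init :: "tm \<Rightarrow> bool list \<Rightarrow> config" where
  "tm_init M x = (0, (word_tape x, 0) # replicate (tm_tapes M - 1) (word_tape [], 0))"

definition accepts_within :: "tm \<Rightarrow> bool list \<Rightarrow> nat \<Rightarrow> bool" where
  "accepts_within M x T \<longleftrightarrow> (\<exists>n\<le>T. \<exists>ts. (tm_step M ^^ n) (tm_init M x) (1, ts))"

text \<open>The output is left on the first tape, which also held the input.\<close>

definition outputs_within :: "tm \<Rightarrow> bool list \<Rightarrow> bool list \<Rightarrow> nat \<Rightarrow> bool" where
  "outputs_within M x y T \<longleftrightarrow>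
     (\<exists>n\<le>T. \<exists>ts. (tm_step M ^^ n) (tm_init M x) (1, ts) \<and> fst (hd ts) = word_tape y)"

definition NP :: "bool list set set" where
  "NP = {L. \<exists>M (p :: nat poly). turing_machine M \<and>
              (\<forall>x. x \<in> L \<longleftrightarrow> accepts_within M x (poly p (length x)))}"

definition polytime_computable :: "(bool list \<Rightarrow> bool list) \<Rightarrow> bool" where
  "polytime_computable r \<longleftrightarrow>
     (\<exists>M (p :: nat poly). turing_machine M \<and> deterministic M \<and>
              (\<forall>x. outputs_within M x (r x) (poly p (length x))))"


subsection \<open>Graphs\<close>

record 'a graph =
  verts :: "'a set"
  edges :: "'a set set"

definition simple_graph :: "'a graph \<Rightarrow> bool" where
  "simple_graph G \<longleftrightarrow> finite (verts G) \<and>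
     (\<forall>e \<in> edges G. \<exists>u \<in> verts G. \<exists>v \<in> verts G. u \<noteq> v \<and> e = {u, v})"

definition induced :: "'a graph \<Rightarrow> 'a set \<Rightarrow> 'a graph" where
  "induced G U = \<lparr>verts = verts G \<inter> U, edges = {e \<in> edges G. e \<subseteq> U}\<rparr>"

definition closed_nbhd :: "'a graph \<Rightarrow> 'a \<Rightarrow> 'a set" where
  "closed_nbhd G v = {u \<in> verts G. u = v \<or> {u, v} \<in> edges G}"

definition maximum_neighbor :: "'a graph \<Rightarrow> 'a \<Rightarrow> 'a \<Rightarrow> bool" where
  "maximum_neighbor G v u \<longleftrightarrow>
     u \<in> closed_nbhd G v \<and> (\<forall>w \<in> closed_nbhd G v. closed_nbhd G w \<subseteq> closed_nbhd G u)"

definition maximum_neighborhood_order :: "'a graph \<Rightarrow> 'a list \<Rightarrow> bool" where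
  "maximum_neighborhood_order G vs \<longleftrightarrow> distinct vs \<and> set vs = verts G \<and>
     (\<forall>i < length vs. \<exists>u. maximum_neighbor (induced G (set (drop i vs))) (vs ! i) u)"

definition dually_chordal :: "'a graph \<Rightarrow> bool" where
  "dually_chordal G \<longleftrightarrow> (\<exists>vs. maximum_neighborhood_order G vs)"

definition is_cycle :: "'a graph \<Rightarrow> 'a list \<Rightarrow> bool" where
  "is_cycle G cs \<longleftrightarrow> length cs \<ge> 3 \<and> distinct cs \<and> set cs \<subseteq> verts G \<and>
     (\<forall>i < length cs. {cs ! i, cs ! (Suc i mod length cs)} \<in> edges G)"

definition has_chord :: "'a graph \<Rightarrow> 'a list \<Rightarrow> bool" where
  "has_chord G cs \<longleftrightarrow>
     (\<exists>i j. i < length cs \<and> j < length cs \<and> i \<noteq> j \<and>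
            j \<noteq> Suc i mod length cs \<and> i \<noteq> Suc j mod length cs \<and> {cs ! i, cs ! j} \<in> edges G)"

definition chordal :: "'a graph \<Rightarrow> bool" where
  "chordal G \<longleftrightarrow> (\<forall>cs. is_cycle G cs \<longrightarrow> length cs \<ge> 4 \<longrightarrow> has_chord G cs)"

definition doubly_chordal :: "'a graph \<Rightarrow> bool" where
  "doubly_chordal G \<longleftrightarrow> chordal G \<and> dually_chordal G"


subsection \<open>Encoding of numbers and graphs by bit strings\<close>

text \<open>Binary representation, least significant bit first, without leading zeros.\<close>

fun binary :: "nat \<Rightarrow> bool list" where
  "binary n = (if n = 0 then [] else odd n # binary (n div 2))"

declare binary.simps [simp del]

text \<open>Self-delimiting: every bit is preceded by True, and False ends the number.\<close>

definition encode_nat :: "nat \<Rightarrow> bool list" where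
  "encode_nat n = concat (map (\<lambda>b. [True, b]) (binary n)) @ [False]"

definition encode_nats :: "nat list \<Rightarrow> bool list" where
  "encode_nats ns = concat (map encode_nat ns)"

text \<open>The order of the graph followed by its adjacency matrix, row by row.\<close>

definition graph_code :: "nat graph \<Rightarrow> nat list" where
  "graph_code G = (let n = card (verts G) in
     n # concat (map (\<lambda>i. map (\<lambda>j. if {i, j} \<in> edges G then 1 else 0) [0..<n]) [0..<n]))"

definition vector_code :: "nat graph \<Rightarrow> (nat \<Rightarrow> nat) \<Rightarrow> nat list" where
  "vector_code G k = map k [0..<card (verts G)]"


subsection \<open>NP-hardness of optimization problems on graph classes\<close>

text \<open>
  An optimization problem is treated through its decision version: an instance \<open>i\<close> comes with a
  bound \<open>B\<close>, and \<open>meets i B\<close> says that the optimum of \<open>i\<close> is at least \<open>B\<close> (maximization) or at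
  most \<open>B\<close> (minimization). Input graphs have vertex set \<open>{0,...,n-1}\<close>.
\<close>

record 'i opt_problem =
  graph_of :: "'i \<Rightarrow> nat graph"
  code_of :: "'i \<Rightarrow> nat list"
  meets :: "'i \<Rightarrow> nat \<Rightarrow> bool"

definition instances :: "'i opt_problem \<Rightarrow> (nat graph \<Rightarrow> bool) \<Rightarrow> 'i set" where
  "instances P C = {i. simple_graph (graph_of P i) \<and>
     verts (graph_of P i) = {..<card (verts (graph_of P i))} \<and> C (graph_of P i)}"

definition instance_strings :: "'i opt_problem \<Rightarrow> (nat graph \<Rightarrow> bool) \<Rightarrow> bool list set" where
  "instance_strings P C = {encode_nats (code_of P i @ [B]) | i B. i \<in> instances P C}"

definition yes_strings :: "'i opt_problem \<Rightarrow> (nat graph \<Rightarrow> bool) \<Rightarrow> bool list set" where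
  "yes_strings P C = {encode_nats (code_of P i @ [B]) | i B. i \<in> instances P C \<and> meets P i B}"

text \<open>
  Every language in NP has a polynomial-time many-one reduction to the decision version, producing
  only instances whose graph belongs to the class \<open>C\<close>.
\<close>

definition NP_hard_on :: "'i opt_problem \<Rightarrow> (nat graph \<Rightarrow> bool) \<Rightarrow> bool" where
  "NP_hard_on P C \<longleftrightarrow>
     (\<forall>L \<in> NP. \<exists>r. polytime_computable r \<and>
        (\<forall>x. r x \<in> instance_strings P C \<and> (x \<in> L \<longleftrightarrow> r x \<in> yes_strings P C)))"


subsection \<open>The packing and domination problems\<close>

datatype label = Zero | Free

fun label_code :: "label \<Rightarrow> nat" where
  "label_code Zero = 0"
| "label_code Free = 1"

definition lpf_feasible ::
  "nat \<Rightarrow> 'a graph \<Rightarrow> ('a \<Rightarrow> nat) \<Rightarrow> ('a \<Rightarrow> label) \<Rightarrow> ('a \<Rightarrow> nat) \<Rightarrow> bool" where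
  "lpf_feasible l G k t f \<longleftrightarrow>
     (\<forall>v \<in> verts G. f v \<le> l \<and> sum f (closed_nbhd G v) \<le> k v \<and> (t v = Zero \<longrightarrow> f v = 0))"

definition lpf_max :: "nat \<Rightarrow> 'a graph \<Rightarrow> ('a \<Rightarrow> nat) \<Rightarrow> ('a \<Rightarrow> label) \<Rightarrow> nat" where
  "lpf_max l G k t = Max {sum f (verts G) | f. lpf_feasible l G k t f}"

definition gpf_feasible ::
  "'a graph \<Rightarrow> ('a \<Rightarrow> nat) \<Rightarrow> ('a \<Rightarrow> nat) \<Rightarrow> ('a \<Rightarrow> nat) \<Rightarrow> bool" where
  "gpf_feasible G k u f \<longleftrightarrow> (\<forall>v \<in> verts G. f v \<le> u v \<and> sum f (closed_nbhd G v) \<le> k v)"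

definition gpf_max :: "'a graph \<Rightarrow> ('a \<Rightarrow> nat) \<Rightarrow> ('a \<Rightarrow> nat) \<Rightarrow> nat" where
  "gpf_max G k u = Max {sum f (verts G) | f. gpf_feasible G k u f}"

definition gdf_feasible ::
  "'a graph \<Rightarrow> ('a \<Rightarrow> nat) \<Rightarrow> ('a \<Rightarrow> nat) \<Rightarrow> ('a \<Rightarrow> nat) \<Rightarrow> bool" where
  "gdf_feasible G k u f \<longleftrightarrow> (\<forall>v \<in> verts G. f v \<le> u v \<and> k v \<le> sum f (closed_nbhd G v))"

text \<open>The minimum is infinite when there is no feasible function.\<close>

definition gdf_min :: "'a graph \<Rightarrow> ('a \<Rightarrow> nat) \<Rightarrow> ('a \<Rightarrow> nat) \<Rightarrow> enat" where
  "gdf_min G k u = Inf {enat (sum f (verts G)) | f. gdf_feasible G k u f}"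

definition fixed_LPF :: "nat \<Rightarrow> (nat graph \<times> (nat \<Rightarrow> nat) \<times> (nat \<Rightarrow> label)) opt_problem" where
  "fixed_LPF l = \<lparr>
     graph_of = (\<lambda>(G, k, t). G),
     code_of = (\<lambda>(G, k, t). graph_code G @ vector_code G k @ vector_code G (label_code \<circ> t)),
     meets = (\<lambda>(G, k, t) B. B \<le> lpf_max l G k t)\<rparr>"

definition LPF :: "(nat graph \<times> nat \<times> (nat \<Rightarrow> nat) \<times> (nat \<Rightarrow> label)) opt_problem" where
  "LPF = \<lparr>
     graph_of = (\<lambda>(G, l, k, t). G),
     code_of = (\<lambda>(G, l, k, t).
       graph_code G @ [l] @ vector_code G k @ vector_code G (label_code \<circ> t)),
     meets = (\<lambda>(G, l, k, t) B. B \<le> lpf_max l G k t)\<rparr>"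

definition GDF :: "(nat graph \<times> (nat \<Rightarrow> nat) \<times> (nat \<Rightarrow> nat)) opt_problem" where
  "GDF = \<lparr>
     graph_of = (\<lambda>(G, k, u). G),
     code_of = (\<lambda>(G, k, u). graph_code G @ vector_code G k @ vector_code G u),
     meets = (\<lambda>(G, k, u) B. gdf_min G k u \<le> enat B)\<rparr>"

definition GPF :: "(nat graph \<times> (nat \<Rightarrow> nat) \<times> (nat \<Rightarrow> nat)) opt_problem" where
  "GPF = \<lparr>
     graph_of = (\<lambda>(G, k, u). G),
     code_of = (\<lambda>(G, k, u). graph_code G @ vector_code G k @ vector_code G u),
     meets = (\<lambda>(G, k, u) B. B \<le> gpf_max G k u)\<rparr>"

end

theory Submission imports Defs begin

text \<open>
  Everything takes place on split graphs with universal vertices, which are doubly chordal. In such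
  a graph the clique carries the weights, and every independent vertex imposes a bound on the sum of
  the weights over an arbitrary subset of the clique. This is enough to express a computation of a
  nondeterministic machine: the clique is divided into groups of mutually exclusive alternatives
  (the transition applied at a time, the symbol in a cell of the tableau), group vertices admit at
  most one alternative each while the bound on the total weight demands one in each, and a clause
  vertex forbids that all literals of a locally inconsistent set are chosen. For domination, a clause
  vertex sees instead the alternatives that contradict one of its literals and demands one of them.

  Measuring tape cells relative to the head makes the tableau so uniform that an entry of the
  adjacency matrix depends only on the kinds of the two vertices and on whether a few affine
  functions of their coordinates take values in -1, 0, 1. The machine that writes the matrix keeps
  the value of each such function as the position of a head, moved in step with the loop counters.
\<close>

section \<open>Structured programs on multi-tape machines\<close>

text \<open>\<open>NP_hard_on\<close> asks for a deterministic machine for every language in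
  \<open>NP\<close>. So the reduction starts from an arbitrary nondeterministic machine rather than
  from a known hard problem, and the machine producing its output has to be exhibited with a time
  bound; hence the small programming language, whose only arithmetic is counting.

  Clique and universal vertices see the whole weight, so their bounds cannot express anything local.
  They bound the total, by the threshold itself for packing and by 0 for domination, and every local
  condition has to sit on an independent vertex.

  In packing the group bounds hold each weight to 0 or 1, so a single family of graphs serves every
  cap \<open>l \<ge> 1\<close>, \<open>LPF\<close> and \<open>GPF\<close>. With \<open>l = 0\<close>
  only the zero function is feasible, which is why that cap is excluded. Domination can only demand
  weight, so it needs a second family of graphs, though on the same vertices and with the same
  threshold; the flag \<open>cov\<close> selects between the two.\<close>

type_synonym state = "nat \<Rightarrow> tape"

text \<open>States have infinitely many tapes so that programs compose without an arity; only
  \<open>wf_prog\<close> ties a program to \<open>K\<close> tapes and \<open>S\<close> symbols.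
  Control depends on the scanned symbols alone, so all that a machine must remember is the remaining
  program.\<close>

datatype prog =
    Skip
  | Act "(nat \<Rightarrow> nat) \<Rightarrow> nat \<Rightarrow> nat \<times> move"
  | Seq prog prog
  | Cond "(nat \<Rightarrow> nat) \<Rightarrow> bool" prog prog
  | While "(nat \<Rightarrow> nat) \<Rightarrow> bool" prog

definition idle :: "(nat \<Rightarrow> nat) \<Rightarrow> nat \<Rightarrow> nat \<times> move" where
  "idle r = (\<lambda>i. (r i, MStay))"

definition reads :: "state \<Rightarrow> nat \<Rightarrow> nat" where
  "reads s = (\<lambda>i. fst (s i) (snd (s i)))"

lemma read_tape_reads: "read_tape (s i) = reads s i"
  by (cases "s i") (simp add: reads_def)

definition apply_act :: "(nat \<Rightarrow> nat \<times> move) \<Rightarrow> state \<Rightarrow> state" where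
  "apply_act a s = (\<lambda>i. act_tape (a i) (s i))"

fun next_prog :: "prog \<Rightarrow> (nat \<Rightarrow> nat) \<Rightarrow> prog" where
  "next_prog Skip r = Skip"
| "next_prog (Act f) r = Skip"
| "next_prog (Seq p q) r = (if p = Skip then q else Seq (next_prog p r) q)"
| "next_prog (Cond b p q) r = (if b r then p else q)"
| "next_prog (While b p) r = (if b r then Seq p (While b p) else Skip)"

fun next_act :: "prog \<Rightarrow> (nat \<Rightarrow> nat) \<Rightarrow> nat \<Rightarrow> nat \<times> move" where
  "next_act (Act f) r = f r"
| "next_act (Seq p q) r = (if p = Skip then idle r else next_act p r)"
| "next_act _ r = idle r"

text \<open>The remaining programs that can occur during a run; they become the states of the
  compiled machine. The set is finite because a loop body is followed by the very loop it came
  from.\<close>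

fun residuals :: "prog \<Rightarrow> prog set" where
  "residuals Skip = {Skip}"
| "residuals (Act f) = {Act f, Skip}"
| "residuals (Seq p q) = (\<lambda>p'. Seq p' q) ` residuals p \<union> residuals q"
| "residuals (Cond b p q) = insert (Cond b p q) (residuals p \<union> residuals q)"
| "residuals (While b p) = insert Skip (insert (While b p) ((\<lambda>p'. Seq p' (While b p)) ` residuals p))"

lemma finite_residuals: "finite (residuals p)"
  by (induction p) auto

lemma self_in_residuals: "p \<in> residuals p"
  by (induction p) auto

lemma Skip_in_residuals: "Skip \<in> residuals p"
  by (induction p) auto

lemma next_prog_in_residuals: "q \<in> residuals p \<Longrightarrow> next_prog q r \<in> residuals p"
proof (induction p arbitrary: q)
  case (Seq p1 p2)
  then consider p' where "q = Seq p' p2" "p' \<in> residuals p1" | "q \<in> residuals p2" by auto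
  then show ?case by cases (use Seq.IH in \<open>auto simp: self_in_residuals\<close>)
next
  case (While b p)
  then consider p' where "q = Seq p' (While b p)" "p' \<in> residuals p" | "q = Skip" | "q = While b p"
    by auto
  then show ?case by cases (use While.IH in \<open>auto simp: self_in_residuals\<close>)
qed (auto simp: self_in_residuals)

text \<open>The compiled machine has no tapes from \<open>K\<close> on, so an action must leave them
  alone. Symbols need to stay below \<open>S\<close> only when all scanned symbols do, an invariant
  carried by \<open>compile_simulates\<close>.\<close>

definition wf_act :: "nat \<Rightarrow> nat \<Rightarrow> ((nat \<Rightarrow> nat) \<Rightarrow> nat \<Rightarrow> nat \<times> move) \<Rightarrow> bool" where
  "wf_act K S f \<longleftrightarrow>
     (\<forall>r i. (\<forall>j. r j < S) \<longrightarrow> fst (f r i) < S \<and> (i \<ge> K \<longrightarrow> f r i = (r i, MStay)))"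

fun wf_prog :: "nat \<Rightarrow> nat \<Rightarrow> prog \<Rightarrow> bool" where
  "wf_prog K S (Act f) \<longleftrightarrow> wf_act K S f"
| "wf_prog K S (Seq p q) \<longleftrightarrow> wf_prog K S p \<and> wf_prog K S q"
| "wf_prog K S (Cond b p q) \<longleftrightarrow> wf_prog K S p \<and> wf_prog K S q"
| "wf_prog K S (While b p) \<longleftrightarrow> wf_prog K S p"
| "wf_prog K S Skip \<longleftrightarrow> True"

lemma wf_residuals: "wf_prog K S p \<Longrightarrow> q \<in> residuals p \<Longrightarrow> wf_prog K S q"
proof (induction p arbitrary: q)
  case (Seq p1 p2)
  from Seq.prems have wf: "wf_prog K S p1" "wf_prog K S p2" by simp_all
  show ?case using Seq.prems Seq.IH(1)[OF wf(1)] Seq.IH(2)[OF wf(2)] wf by auto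
next
  case (Cond b p1 p2)
  from Cond.prems have wf: "wf_prog K S p1" "wf_prog K S p2" by simp_all
  show ?case using Cond.prems Cond.IH(1)[OF wf(1)] Cond.IH(2)[OF wf(2)] wf by auto
next
  case (While b p)
  from While.prems have wf: "wf_prog K S p" by simp
  show ?case using While.prems While.IH[OF wf] wf by auto
qed auto

lemma wf_next_act:
  assumes "wf_prog K S p" "\<forall>j. r j < S"
  shows "fst (next_act p r i) < S" and "i \<ge> K \<Longrightarrow> next_act p r i = (r i, MStay)"
proof -
  have "fst (next_act p r i) < S \<and> (i \<ge> K \<longrightarrow> next_act p r i = (r i, MStay))"
    using assms
  proof (induction p)
    case (Act f)
    then have "wf_act K S f" "\<forall>j. r j < S" by simp_all
    then show ?case unfolding wf_act_def by simp
  qed (auto simp: idle_def)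
  then show "fst (next_act p r i) < S" and "i \<ge> K \<Longrightarrow> next_act p r i = (r i, MStay)"
    by auto
qed

definition prog_step :: "prog \<times> state \<Rightarrow> prog \<times> state" where
  "prog_step c = (next_prog (fst c) (reads (snd c)),
                  apply_act (next_act (fst c) (reads (snd c))) (snd c))"

text \<open>\<open>prog_step\<close> would idle forever on \<open>Skip\<close>; the premise
  \<open>p \<noteq> Skip\<close> makes \<open>Skip\<close> the end of a run, matching the halting
  state, which has no transitions.\<close>

inductive small_steps :: "nat \<Rightarrow> prog \<Rightarrow> state \<Rightarrow> prog \<Rightarrow> state \<Rightarrow> bool" where
  small_refl: "small_steps 0 p s p s"
| small_step: "p \<noteq> Skip \<Longrightarrow> prog_step (p, s) = (p', s') \<Longrightarrow> small_steps n p' s' p'' s''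
    \<Longrightarrow> small_steps (Suc n) p s p'' s''"

lemma small_steps_trans:
  "small_steps m p s p' s' \<Longrightarrow> small_steps n p' s' p'' s'' \<Longrightarrow> small_steps (m + n) p s p'' s''"
  by (induction rule: small_steps.induct) (auto intro: small_step)

lemma small_steps_Seq:
  "small_steps n p s p' s' \<Longrightarrow> small_steps n (Seq p q) s (Seq p' q) s'"
proof (induction rule: small_steps.induct)
  case (small_step p s p' s' n p'' s'')
  then show ?case by (intro small_steps.small_step[of _ _ "Seq p' q" s']) (auto simp: prog_step_def)
qed (rule small_refl)

lemma apply_act_idle [simp]: "apply_act (idle (reads s)) s = s"
proof
  fix i show "apply_act (idle (reads s)) s i = s i"
    by (cases "s i") (simp add: apply_act_def idle_def reads_def)
qed

definition runs :: "prog \<Rightarrow> state \<Rightarrow> state \<Rightarrow> nat \<Rightarrow> bool" where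
  "runs p s s' t \<longleftrightarrow> (\<exists>n\<le>t. small_steps n p s Skip s')"

lemma runs_mono: "runs p s s' t \<Longrightarrow> t \<le> t' \<Longrightarrow> runs p s s' t'"
  unfolding runs_def using order_trans by blast

lemma runs_Skip: "runs Skip s s t"
  unfolding runs_def using small_refl by blast

lemma runs_Act: "runs (Act f) s (apply_act (f (reads s)) s) 1"
proof -
  have "small_steps (Suc 0) (Act f) s Skip (apply_act (f (reads s)) s)"
    by (rule small_step[OF _ _ small_refl]) (auto simp: prog_step_def)
  then show ?thesis unfolding runs_def by auto
qed

text \<open>The extra step is the one that turns \<open>Seq Skip q\<close> into
  \<open>q\<close>.\<close>

lemma runs_Seq:
  assumes "runs p s s' t" "runs q s' s'' t'"
  shows "runs (Seq p q) s s'' (t + t' + 1)"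
proof -
  obtain m n where mn: "m \<le> t" "n \<le> t'" "small_steps m p s Skip s'" "small_steps n q s' Skip s''"
    using assms unfolding runs_def by auto
  have "small_steps (Suc n) (Seq Skip q) s' Skip s''"
    by (rule small_step[OF _ _ mn(4)]) (auto simp: prog_step_def)
  with small_steps_trans[OF small_steps_Seq[OF mn(3)] this] show ?thesis
    unfolding runs_def using mn by (intro exI[of _ "m + Suc n"]) auto
qed

lemma runs_Cond:
  assumes "runs (if b (reads s) then p else q) s s' t"
  shows "runs (Cond b p q) s s' (t + 1)"
proof -
  obtain m where m: "m \<le> t" "small_steps m (if b (reads s) then p else q) s Skip s'"
    using assms unfolding runs_def by auto
  have "small_steps (Suc m) (Cond b p q) s Skip s'"
    by (rule small_step[OF _ _ m(2)]) (auto simp: prog_step_def)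
  then show ?thesis unfolding runs_def using m by auto
qed

lemma runs_While_False: "\<not> b (reads s) \<Longrightarrow> runs (While b p) s s 1"
proof -
  assume "\<not> b (reads s)"
  then have "small_steps (Suc 0) (While b p) s Skip s"
    by (intro small_step[OF _ _ small_refl]) (auto simp: prog_step_def)
  then show ?thesis unfolding runs_def by auto
qed

lemma runs_While_True:
  assumes "b (reads s)" "runs p s s' t" "runs (While b p) s' s'' t'"
  shows "runs (While b p) s s'' (t + t' + 2)"
proof -
  obtain m where m: "m \<le> t + t' + 1" "small_steps m (Seq p (While b p)) s Skip s''"
    using runs_Seq[OF assms(2,3)] unfolding runs_def by auto
  have "small_steps (Suc m) (While b p) s Skip s''"
    by (rule small_step[OF _ _ m(2)]) (auto simp: prog_step_def assms)
  then show ?thesis unfolding runs_def using m by (intro exI[of _ "Suc m"]) auto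
qed

lemma runs_While_iterate:
  assumes "\<And>j. j < N \<Longrightarrow> b (reads (st j))" "\<not> b (reads (st N))"
    and "\<And>j. j < N \<Longrightarrow> runs p (st j) (st (Suc j)) t"
  shows "runs (While b p) (st 0) (st N) (N * (t + 2) + 1)"
proof -
  \<comment> \<open>Induction on the number \<open>k\<close> of rounds left, because
    \<open>runs_While_True\<close> extends a run at its front.\<close>
  have "k \<le> N \<Longrightarrow> runs (While b p) (st (N - k)) (st N) (k * (t + 2) + 1)" for k
  proof (induction k)
    case 0
    then show ?case using runs_While_False assms(2) by simp
  next
    case (Suc k)
    then have *: "Suc (N - Suc k) = N - k" "N - Suc k < N" by auto
    have "runs (While b p) (st (N - Suc k)) (st N) (t + (k * (t + 2) + 1) + 2)"
      by (rule runs_While_True[of _ _ _ "st (N - k)"])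
        (use assms(1,3)[OF *(2)] * Suc in auto)
    then show ?case by (rule runs_mono) simp
  qed
  from this[of N] show ?thesis by simp
qed

section \<open>Compiling programs into deterministic machines\<close>

definition init_state :: "bool list \<Rightarrow> state" where
  "init_state x = (\<lambda>i. if i = 0 then (word_tape x, 0) else (word_tape [], 0))"

definition list_reads :: "nat list \<Rightarrow> nat \<Rightarrow> nat" where
  "list_reads rs = (\<lambda>i. if i < length rs then rs ! i else 0)"

text \<open>Exactly one transition for each remaining program and each tuple of scanned symbols,
  which gives determinism once \<open>g\<close> is injective. Padding by \<open>list_reads\<close>
  agrees with the state because the tapes from \<open>K\<close> on stay blank under their
  heads.\<close>

definition compile_trans ::
  "prog \<Rightarrow> nat \<Rightarrow> nat \<Rightarrow> (prog \<Rightarrow> nat) \<Rightarrow>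
    (nat \<times> nat list \<times> nat \<times> (nat \<times> move) list) set" where
  "compile_trans p0 K S g = {(g p, rs, g (next_prog p (list_reads rs)),
      map (next_act p (list_reads rs)) [0..<K]) |
     p rs. p \<in> residuals p0 \<and> p \<noteq> Skip \<and> length rs = K \<and> set rs \<subseteq> {..<S}}"

context
  fixes p0 :: prog and K S :: nat
  assumes wf: "wf_prog K S p0" and K: "K \<ge> 1" and S: "S \<ge> 3" and nonskip: "p0 \<noteq> Skip"
begin

lemma numbering_exists:
  "\<exists>g N. inj_on g (residuals p0) \<and> g p0 = 0 \<and> g Skip = 1 \<and> N \<ge> 2 \<and>
     (\<forall>p\<in>residuals p0. g p < (N::nat))"
proof -
  obtain h :: "prog \<Rightarrow> nat" where h: "inj_on h (residuals p0)"
    using finite_imp_inj_to_nat_seg[OF finite_residuals[of p0]] by blast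
  \<comment> \<open>The machine model fixes 0 as initial and 1 as halting state, so the remaining
    numbers are pushed up by 2.\<close>
  let ?g = "\<lambda>p. if p = p0 then 0 else if p = Skip then 1 else h p + (2::nat)"
  have 1: "inj_on ?g (residuals p0)" using h nonskip unfolding inj_on_def by auto
  let ?N = "Suc (Suc (Max (?g ` residuals p0)))"
  have "?g p < ?N" if "p \<in> residuals p0" for p
    using Max_ge[of "?g ` residuals p0" "?g p"] that finite_residuals by fastforce
  then show ?thesis using 1 nonskip by (intro exI[of _ ?g] exI[of _ ?N]) auto
qed

lemma reads_list:
  assumes "\<forall>i\<ge>K. reads s i = 0"
  shows "list_reads (map read_tape (map s [0..<K])) = reads s"
proof
  fix i show "list_reads (map read_tape (map s [0..<K])) i = reads s i"
    using assms by (auto simp: list_reads_def read_tape_reads)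
qed

lemma compile_simulates:
  assumes trans: "tm_trans M = compile_trans p0 K S g"
  shows "small_steps n p s p' s' \<Longrightarrow> p \<in> residuals p0 \<Longrightarrow> (\<forall>i\<ge>K. reads s i = 0) \<Longrightarrow>
    (\<forall>i j. fst (s i) j < S) \<Longrightarrow>
    (tm_step M ^^ n) (g p, map s [0..<K]) (g p', map s' [0..<K])"
proof (induction rule: small_steps.induct)
  case (small_step p s p' s' n p'' s'')
  let ?r = "reads s" and ?rs = "map read_tape (map s [0..<K])"
  have p': "p' = next_prog p ?r" and s': "s' = apply_act (next_act p ?r) s"
    using small_step.hyps(2) by (auto simp: prog_step_def)
  have lr: "list_reads ?rs = ?r" using small_step.prems(2) by (rule reads_list)
  have r: "\<forall>j. ?r j < S" using small_step.prems(3) by (auto simp: reads_def)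
  have rsS: "set ?rs \<subseteq> {..<S}"
  proof -
    show ?thesis using r by (auto simp: read_tape_reads)
  qed
  have wfp: "wf_prog K S p" using wf wf_residuals small_step.prems(1) by blast
  have "(g p, ?rs, g (next_prog p (list_reads ?rs)), map (next_act p (list_reads ?rs)) [0..<K]) \<in> tm_trans M"
    unfolding trans compile_trans_def using small_step.prems small_step.hyps(1) rsS
    by (simp only: mem_Collect_eq) (intro exI[of _ p] exI[of _ ?rs], simp)
  then have tr: "(g p, ?rs, g p', map (next_act p ?r) [0..<K]) \<in> tm_trans M"
    by (simp only: lr p')
  have "map2 act_tape (map (next_act p ?r) [0..<K]) (map s [0..<K]) = map s' [0..<K]"
    by (intro nth_equalityI) (auto simp: s' apply_act_def)
  with tr have "tm_step M (g p, map s [0..<K]) (g p', map s' [0..<K])"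
    unfolding tm_step_def by (intro exI[of _ "g p'"] exI[of _ "map (next_act p ?r) [0..<K]"]) simp
  moreover have "(tm_step M ^^ n) (g p', map s' [0..<K]) (g p'', map s'' [0..<K])"
  proof (rule small_step.IH)
    show "p' \<in> residuals p0" using p' next_prog_in_residuals small_step.prems(1) by simp
    show "\<forall>i\<ge>K. reads s' i = 0"
    proof (intro allI impI)
      fix i assume i: "K \<le> i"
      have "s' i = s i" using wf_next_act(2)[OF wfp r i]
        by (cases "s i") (auto simp: s' apply_act_def reads_def)
      then show "reads s' i = 0" using small_step.prems(2) i by (simp add: reads_def)
    qed
    show "\<forall>i j. fst (s' i) j < S"
    proof (intro allI)
      fix i j show "fst (s' i) j < S"
        using wf_next_act(1)[OF wfp r, of i] small_step.prems(3)
        by (cases "s i"; cases "next_act p ?r i") (auto simp: s' apply_act_def dest: spec[of _ i])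
    qed
  qed
  ultimately show ?case by (rule relpowp_Suc_I2)
qed simp

end

theorem polytime_computable_if_runs:
  fixes q :: "nat poly"
  assumes wf: "wf_prog K S p" and K: "K \<ge> 1" and S: "S \<ge> 3" and nonskip: "p \<noteq> Skip"
    and runs: "\<And>x. \<exists>s'. runs p (init_state x) s' (poly q (length x)) \<and> fst (s' 0) = word_tape (r x)"
  shows "polytime_computable r"
proof -
  note asm = wf K S nonskip
  obtain g N where g: "inj_on g (residuals p)" "g p = 0" "g Skip = 1" "N \<ge> 2"
    and gN: "\<forall>q\<in>residuals p. g q < (N::nat)"
    using numbering_exists[OF asm] by auto
  define M where "M = \<lparr>tm_tapes = K, tm_states = N, tm_symbols = S,
     tm_trans = compile_trans p K S g\<rparr>"
  have TM: "turing_machine M"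
    unfolding turing_machine_def
  proof (intro conjI ballI, goal_cases)
    case (4 tr)
    then obtain p' rs where tr: "tr = (g p', rs, g (next_prog p' (list_reads rs)),
        map (next_act p' (list_reads rs)) [0..<K])"
      and p': "p' \<in> residuals p" "p' \<noteq> Skip" "length rs = K" "set rs \<subseteq> {..<S}"
      unfolding M_def compile_trans_def by auto
    have "g p' \<noteq> 1" using g p' Skip_in_residuals unfolding inj_on_def by metis
    moreover have "\<forall>j. list_reads rs j < S" using p' S
      by (auto simp: list_reads_def subset_iff)
    then have "fst (next_act p' (list_reads rs) i) < S" for i
      using wf_next_act(1) wf_residuals[OF wf p'(1)] by blast
    ultimately show ?case
      using p' gN next_prog_in_residuals[OF p'(1)] by (auto simp: tr M_def)
  qed (use K S g in \<open>auto simp: M_def\<close>)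
  have det: "deterministic M"
    unfolding deterministic_def M_def compile_trans_def
    using g(1) by (auto simp: inj_on_def)
  have out: "outputs_within M x (r x) (poly q (length x))" for x
  proof -
    obtain s' n where n: "n \<le> poly q (length x)" "small_steps n p (init_state x) Skip s'"
      "fst (s' 0) = word_tape (r x)" using runs[of x] unfolding runs_def by auto
    have "(tm_step M ^^ n) (g p, map (init_state x) [0..<K]) (g Skip, map s' [0..<K])"
    proof (rule compile_simulates[OF asm _ n(2)])
      show "tm_trans M = compile_trans p K S g" by (simp add: M_def)
    qed (use K S in \<open>auto simp: self_in_residuals init_state_def reads_def word_tape_def\<close>)
    moreover have "map (init_state x) [0..<K] = (word_tape x, 0) # replicate (K - 1) (word_tape [], 0)"
      using K by (intro nth_equalityI) (auto simp: init_state_def nth_Cons split: nat.splits)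
    moreover have "hd (map s' [0..<K]) = s' 0" using K by (simp add: hd_map)
    ultimately show ?thesis unfolding outputs_within_def tm_init_def using n g
      by (intro exI[of _ n] exI[of _ "map s' [0..<K]"]) (auto simp: M_def)
  qed
  show ?thesis unfolding polytime_computable_def using TM det out by blast
qed

section \<open>Counting loops and output\<close>

definition shift :: "(nat \<Rightarrow> int) \<Rightarrow> int \<Rightarrow> state \<Rightarrow> state" where
  "shift u j s = (\<lambda>i. (fst (s i), snd (s i) + j * u i))"

lemma shift_0 [simp]: "shift u 0 s = s"
  by (auto simp: shift_def)

lemma shift_shift: "shift u j (shift u k s) = shift u (k + j) s"
  by (auto simp: shift_def algebra_simps)

lemma shift_commute: "shift u j (shift v k s) = shift v k (shift u j s)"
  by (auto simp: shift_def algebra_simps)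

lemma shift_upd: "u i = 0 \<Longrightarrow> shift u j (s(i := v)) = (shift u j s)(i := v)"
  by (auto simp: shift_def)

definition dir_vec :: "(nat \<Rightarrow> int) \<Rightarrow> bool" where
  "dir_vec u \<longleftrightarrow> (\<forall>i. u i = -1 \<or> u i = 0 \<or> u i = 1)"

definition move_of :: "int \<Rightarrow> move" where
  "move_of k = (if k > 0 then MRight else if k < 0 then MLeft else MStay)"

definition Shift :: "(nat \<Rightarrow> int) \<Rightarrow> prog" where
  "Shift u = Act (\<lambda>r i. (r i, move_of (u i)))"

lemma runs_Shift:
  assumes "dir_vec u"
  shows "runs (Shift u) s (shift u 1 s) 1"
proof -
  have "apply_act (\<lambda>i. (reads s i, move_of (u i))) s = shift u 1 s"
  proof
    fix i show "apply_act (\<lambda>i. (reads s i, move_of (u i))) s i = shift u 1 s i"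
      using assms[unfolded dir_vec_def, rule_format, of i]
      by (cases "s i") (auto simp: apply_act_def reads_def shift_def move_of_def)
  qed
  then show ?thesis unfolding Shift_def using runs_Act[of "\<lambda>r i. (r i, move_of (u i))" s] by simp
qed

lemma runs_Shift_neg:
  assumes "dir_vec u"
  shows "runs (Shift (\<lambda>i. - u i)) s (shift u (-1) s) 1"
proof -
  have "dir_vec (\<lambda>i. - u i)" using assms by (auto simp: dir_vec_def)
  from runs_Shift[OF this, of s] show ?thesis by (simp add: shift_def)
qed

text \<open>A tape that counts the rounds of a loop: only the number of nonblank cells matters, so a
  copy of the input \<open>x\<close> serves as the number \<open>length x\<close>.\<close>

definition is_block :: "tape \<Rightarrow> nat \<Rightarrow> bool" where
  "is_block tp N \<longleftrightarrow> snd tp = 0 \<and> (\<forall>i. fst tp i \<noteq> 0 \<longleftrightarrow> 0 \<le> i \<and> i < int N)"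

lemma is_block_word_tape [simp]: "is_block (word_tape w, 0) (length w)"
  by (auto simp: is_block_def word_tape_def)

lemma reads_shift_block:
  assumes "is_block (s c) N" "u c = 1"
  shows "(reads (shift u j s) c = 0) = (\<not> (0 \<le> j \<and> j < int N))"
proof -
  have "(fst (s c) j = 0) = (\<not> (0 \<le> j \<and> j < int N))" using assms(1) unfolding is_block_def by blast
  then show ?thesis using assms by (simp add: reads_def shift_def is_block_def)
qed

text \<open>All heads of \<open>u\<close> travel back together, so tape \<open>c\<close> alone tells
  when they are home. The first move left leaves the blank behind the block, where a loop ends; the
  last move right leaves the blank in front of it.\<close>

definition rewind :: "nat \<Rightarrow> (nat \<Rightarrow> int) \<Rightarrow> prog" where
  "rewind c u = Seq (Shift (\<lambda>i. - u i)) (Seq (While (\<lambda>r. r c \<noteq> 0) (Shift (\<lambda>i. - u i))) (Shift u))"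

lemma runs_rewind:
  assumes u: "dir_vec u" "u c = 1" and b: "is_block (s c) N"
  shows "runs (rewind c u) (shift u (int N) s) s (N * 3 + 6)"
proof -
  let ?st = "\<lambda>k. shift u (int N - 1 - int k) s"
  have 1: "runs (Shift (\<lambda>i. - u i)) (shift u (int N) s) (?st 0) 1"
    using runs_Shift_neg[OF u(1), of "shift u (int N) s"] by (simp add: shift_shift algebra_simps)
  have 2: "runs (While (\<lambda>r. r c \<noteq> 0) (Shift (\<lambda>i. - u i))) (?st 0) (?st N) (N * (1 + 2) + 1)"
  proof (rule runs_While_iterate)
    fix j assume j: "j < N"
    then show "reads (?st j) c \<noteq> 0" by (simp add: reads_shift_block[of s c N u, OF b u(2)])
    show "runs (Shift (\<lambda>i. - u i)) (?st j) (?st (Suc j)) 1"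
      using runs_Shift_neg[OF u(1), of "?st j"] by (simp add: shift_shift algebra_simps)
  next
    show "\<not> reads (?st N) c \<noteq> 0" by (simp add: reads_shift_block[of s c N u, OF b u(2)])
  qed
  have 3: "runs (Shift u) (?st N) s 1"
    using runs_Shift[OF u(1), of "?st N"] by (simp add: shift_shift)
  from runs_Seq[OF 1 runs_Seq[OF 2 3]] show ?thesis
    unfolding rewind_def by (rule runs_mono) simp
qed

text \<open>The loop moves the heads along \<open>u\<close> after every round, so the body can read off the tapes
  whether an affine function of the loop counters takes some fixed value.\<close>

definition For :: "nat \<Rightarrow> (nat \<Rightarrow> int) \<Rightarrow> prog \<Rightarrow> prog" where
  "For c u body = Seq (While (\<lambda>r. r c \<noteq> 0) (Seq body (Shift u))) (rewind c u)"

text \<open>\<open>st j\<close> describes the state after \<open>j\<close> rounds as if all loop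
  heads were home; the body meets it displaced by \<open>j\<close>, and the final rewinding removes
  the displacement.\<close>

lemma runs_For:
  assumes u: "dir_vec u" "u c = 1" and b: "\<And>j. is_block (st j c) N"
    and body: "\<And>j. j < N \<Longrightarrow> runs body (shift u (int j) (st j)) (shift u (int j) (st (Suc j))) t"
  shows "runs (For c u body) (st 0) (st N) (N * (t + 7) + 8)"
proof -
  let ?st = "\<lambda>j. shift u (int j) (st j)"
  have 1: "runs (While (\<lambda>r. r c \<noteq> 0) (Seq body (Shift u))) (?st 0) (?st N) (N * ((t + 1 + 1) + 2) + 1)"
  proof (rule runs_While_iterate)
    fix j assume j: "j < N"
    then show "reads (?st j) c \<noteq> 0" by (simp add: reads_shift_block[of "st j" c N u, OF b u(2)])
    have "runs (Shift u) (shift u (int j) (st (Suc j))) (?st (Suc j)) 1"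
      using runs_Shift[OF u(1), of "shift u (int j) (st (Suc j))"]
      by (simp add: shift_shift algebra_simps)
    with body[OF j] show "runs (Seq body (Shift u)) (?st j) (?st (Suc j)) (t + 1 + 1)"
      by (rule runs_Seq)
  next
    show "\<not> reads (?st N) c \<noteq> 0" by (simp add: reads_shift_block[of "st N" c N u, OF b u(2)])
  qed
  have 2: "runs (rewind c u) (?st N) (st N) (N * 3 + 6)"
    using runs_rewind[of u c "st N" N, OF u b] .
  from runs_Seq[OF 1 2] show ?thesis
    unfolding For_def by (simp add: algebra_simps)
qed

definition axis :: "nat \<Rightarrow> nat \<Rightarrow> int" where
  "axis c = (\<lambda>i. if i = c then 1 else 0)"

lemma dir_vec_axis [simp]: "dir_vec (axis c)"
  by (auto simp: dir_vec_def axis_def)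

lemma axis_same [simp]: "axis c c = 1"
  by (auto simp: axis_def)

lemma axis_other [simp]: "i \<noteq> c \<Longrightarrow> axis c i = 0"
  by (auto simp: axis_def)

definition seqs :: "prog list \<Rightarrow> prog" where
  "seqs ps = foldr Seq ps Skip"

lemma runs_replicate:
  assumes "\<And>k. a \<le> k \<Longrightarrow> k < a + n \<Longrightarrow> runs p (st k) (st (Suc k)) t"
  shows "runs (seqs (replicate n p)) (st a) (st (a + n)) (n * (t + 1))"
  using assms
proof (induction n arbitrary: a)
  case (Suc n)
  have "runs (seqs (replicate n p)) (st (Suc a)) (st (Suc a + n)) (n * (t + 1))"
    by (rule Suc.IH) (use Suc.prems in auto)
  with Suc.prems[of a] have "runs (Seq p (seqs (replicate n p))) (st a) (st (Suc a + n)) (t + n * (t + 1) + 1)"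
    by (intro runs_Seq) auto
  then show ?case by (simp add: seqs_def add.assoc add.left_commute)
qed (simp add: seqs_def runs_Skip)

section \<open>Repeating a program polynomially often\<close>

fun horner :: "nat list \<Rightarrow> nat \<Rightarrow> nat" where
  "horner [] x = 0"
| "horner (a # as) x = a + x * horner as x"

lemma horner_coeffs: "horner (coeffs p) x = poly p x"
proof -
  have "horner as x = poly (Poly as) x" for as
    by (induction as) auto
  then show ?thesis by simp
qed

text \<open>Horner's rule as a nest of loops: \<open>p\<close> is run \<open>a\<close> times and the
  remaining polynomial \<open>L\<close> times, so a polynomial number of rounds is reached without
  arithmetic. Every coefficient occupies one tape holding a block of length
  \<open>L\<close>.\<close>

fun poly_loop :: "nat \<Rightarrow> nat list \<Rightarrow> prog \<Rightarrow> prog" where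
  "poly_loop d [] p = Skip"
| "poly_loop d (a # as) p = Seq (seqs (replicate a p)) (For d (axis d) (poly_loop (Suc d) as p))"

fun poly_loop_time :: "nat list \<Rightarrow> nat \<Rightarrow> nat \<Rightarrow> nat" where
  "poly_loop_time [] L t = 0"
| "poly_loop_time (a # as) L t = a * (t + 1) + (L * (poly_loop_time as L t + 7) + 8) + 1"

text \<open>The bound \<open>M\<close> on the count lets a single \<open>t\<close> cover all rounds
  of a body whose cost grows with the count, such as \<open>binary_inc\<close>. The conditions on
  \<open>st\<close> say that the body neither changes the loop tapes nor notices where their heads
  are.\<close>

lemma runs_poly_loop:
  assumes p: "\<And>s a. a < M \<Longrightarrow> runs p (st s a) (st s (Suc a)) t"
    and comm: "\<And>s a d j. d \<ge> d0 \<Longrightarrow> st (shift (axis d) j s) a = shift (axis d) j (st s a)"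
    and keep: "\<And>s a d. d \<ge> d0 \<Longrightarrow> st s a d = s d"
  shows "d \<ge> d0 \<Longrightarrow> (\<forall>i<length as. is_block (s (d + i)) L) \<Longrightarrow> a + horner as L \<le> M \<Longrightarrow>
     runs (poly_loop d as p) (st s a) (st s (a + horner as L)) (poly_loop_time as L t)"
proof (induction as arbitrary: d s a)
  case (Cons c as)
  have 1: "runs (seqs (replicate c p)) (st s a) (st s (a + c)) (c * (t + 1))"
    by (rule runs_replicate) (use p Cons.prems in auto)
  let ?st = "\<lambda>j. st s (a + c + j * horner as L)"
  have 2: "runs (For d (axis d) (poly_loop (Suc d) as p)) (?st 0) (?st L)
     (L * (poly_loop_time as L t + 7) + 8)"
  proof (rule runs_For)
    fix j show "is_block (?st j d) L"
      using Cons.prems(1) Cons.prems(2)[rule_format, of 0] by (simp add: keep)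
  next
    fix j assume j: "j < L"
    let ?s = "shift (axis d) (int j) s"
    have "runs (poly_loop (Suc d) as p) (st ?s (a + c + j * horner as L))
      (st ?s (a + c + j * horner as L + horner as L)) (poly_loop_time as L t)"
    proof (rule Cons.IH)
      show "\<forall>i<length as. is_block (?s (Suc d + i)) L"
      proof (intro allI impI)
        fix i assume i: "i < length as"
        have "?s (Suc d + i) = s (d + Suc i)" by (simp add: shift_def)
        then show "is_block (?s (Suc d + i)) L" using Cons.prems(2)[rule_format, of "Suc i"] i by simp
      qed
      have "Suc j * horner as L \<le> L * horner as L" using j by (intro mult_right_mono) auto
      then show "a + c + j * horner as L + horner as L \<le> M" using Cons.prems(3) by simp
    qed (use Cons.prems in auto)
    then show "runs (poly_loop (Suc d) as p) (shift (axis d) (int j) (?st j))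
      (shift (axis d) (int j) (?st (Suc j))) (poly_loop_time as L t)"
      using Cons.prems(1) by (simp add: comm algebra_simps)
  qed auto
  have loop: "runs (For d (axis d) (poly_loop (Suc d) as p)) (st s (a + c)) (st s (a + horner (c # as) L))
     (L * (poly_loop_time as L t + 7) + 8)" using 2 by (simp add: add.assoc)
  show ?case using runs_Seq[OF 1 loop] by simp
qed (simp add: runs_Skip)

lemma poly_loop_time_poly:
  "\<exists>q'. \<forall>L. poly_loop_time as L (poly q L) = poly q' (L::nat)"
proof (induction as)
  case Nil
  show ?case by (rule exI[of _ 0]) simp
next
  case (Cons a as)
  then obtain q' where "\<forall>L. poly_loop_time as L (poly q L) = poly q' L" by blast
  then show ?case
    by (intro exI[of _ "[:a:] * (q + 1) + ([:0, 1:] * (q' + [:7:]) + [:8:]) + 1"]) simp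
qed

text \<open>One polynomial for a whole family of runs. It is existentially quantified so that time
  bounds compose without being written out, and the index type is free so that loop counters can
  join the input in the index while \<open>len\<close> still measures the input.\<close>

definition pruns :: "'i set \<Rightarrow> ('i \<Rightarrow> nat) \<Rightarrow> prog \<Rightarrow> ('i \<Rightarrow> state) \<Rightarrow> ('i \<Rightarrow> state) \<Rightarrow> bool" where
  "pruns I len p S S' \<longleftrightarrow> (\<exists>q::nat poly. \<forall>i\<in>I. runs p (S i) (S' i) (poly q (len i)))"

lemma prunsI: "(\<And>i. i \<in> I \<Longrightarrow> runs p (S i) (S' i) (poly q (len i))) \<Longrightarrow> pruns I len p S S'"
  unfolding pruns_def by blast

lemma pruns_const: "(\<And>i. i \<in> I \<Longrightarrow> runs p (S i) (S' i) t) \<Longrightarrow> pruns I len p S S'"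
  by (rule prunsI[where q = "[:t:]"]) simp

lemma pruns_Seq:
  assumes "pruns I len p S M" "pruns I len q M S'"
  shows "pruns I len (Seq p q) S S'"
proof -
  obtain a b where a: "\<forall>i\<in>I. runs p (S i) (M i) (poly a (len i))"
    and b: "\<forall>i\<in>I. runs q (M i) (S' i) (poly b (len i))"
    using assms unfolding pruns_def by blast
  show ?thesis by (rule prunsI[where q = "a + b + 1"]) (use a b runs_Seq in auto)
qed

lemma pruns_cong:
  assumes "pruns I len p S S'" "\<And>i. i \<in> I \<Longrightarrow> S i = R i" "\<And>i. i \<in> I \<Longrightarrow> S' i = R' i"
  shows "pruns I len p R R'"
  using assms unfolding pruns_def by auto

text \<open>Restricting the index set by the outcome of the test lets each branch be verified only
  where it is taken.\<close>

lemma pruns_Cond: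
  assumes "pruns {i \<in> I. b (reads (S i))} len p S S'" "pruns {i \<in> I. \<not> b (reads (S i))} len q S S'"
  shows "pruns I len (Cond b p q) S S'"
proof -
  obtain c d where c: "\<And>i. i \<in> I \<Longrightarrow> b (reads (S i)) \<Longrightarrow> runs p (S i) (S' i) (poly c (len i))"
    and d: "\<And>i. i \<in> I \<Longrightarrow> \<not> b (reads (S i)) \<Longrightarrow> runs q (S i) (S' i) (poly d (len i))"
    using assms unfolding pruns_def by blast
  show ?thesis
  proof (rule prunsI[where q = "c + d + 1"])
    fix i assume i: "i \<in> I"
    have "runs (if b (reads (S i)) then p else q) (S i) (S' i) (poly c (len i) + poly d (len i))"
      using c[OF i] d[OF i] by (auto intro: runs_mono)
    from runs_Cond[of b "S i" p q "S' i", OF this] show "runs (Cond b p q) (S i) (S' i) (poly (c + d + 1) (len i))" by simp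
  qed
qed

lemma pruns_For:
  assumes u: "dir_vec u" "u c = 1" and b: "\<And>i j. i \<in> I \<Longrightarrow> is_block (st i j c) (N i)"
    and N: "\<And>i. i \<in> I \<Longrightarrow> N i \<le> poly qN (len i)"
    and body: "pruns {(i, j). i \<in> I \<and> j < N i} (\<lambda>(i, j). len i) body
      (\<lambda>(i, j). shift u (int j) (st i j)) (\<lambda>(i, j). shift u (int j) (st i (Suc j)))"
  shows "pruns I len (For c u body) (\<lambda>i. st i 0) (\<lambda>i. st i (N i))"
proof -
  obtain q where q: "\<And>i j. i \<in> I \<Longrightarrow> j < N i \<Longrightarrow>
      runs body (shift u (int j) (st i j)) (shift u (int j) (st i (Suc j))) (poly q (len i))"
    using body unfolding pruns_def by auto
  show ?thesis
  proof (rule prunsI[where q = "qN * (q + [:7:]) + [:8:]"])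
    fix i assume i: "i \<in> I"
    have "runs (For c u body) (st i 0) (st i (N i)) (N i * (poly q (len i) + 7) + 8)"
      by (rule runs_For[OF u b[OF i] q[OF i]])
    then show "runs (For c u body) (st i 0) (st i (N i)) (poly (qN * (q + [:7:]) + [:8:]) (len i))"
      by (rule runs_mono) (use N[OF i] in simp)
  qed
qed

lemma pruns_poly_loop:
  fixes pl :: "nat poly"
  assumes p: "pruns {(i, s, a). i \<in> I \<and> a < poly pl (len i)} (\<lambda>(i, s, a). len i) p
      (\<lambda>(i, s, a). st s a) (\<lambda>(i, s, a). st s (Suc a))"
    and comm: "\<And>s a d j. d \<ge> d0 \<Longrightarrow> st (shift (axis d) j s) a = shift (axis d) j (st s a)"
    and keep: "\<And>s a d. d \<ge> d0 \<Longrightarrow> st s a d = s d"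
    and b: "\<And>i j. i \<in> I \<Longrightarrow> j < length (coeffs pl) \<Longrightarrow> is_block (S i (d0 + j)) (len i)"
  shows "pruns I len (poly_loop d0 (coeffs pl) p) (\<lambda>i. st (S i) 0) (\<lambda>i. st (S i) (poly pl (len i)))"
proof -
  obtain q where q: "\<And>i s a. i \<in> I \<Longrightarrow> a < poly pl (len i) \<Longrightarrow>
      runs p (st s a) (st s (Suc a)) (poly q (len i))"
    using p unfolding pruns_def by auto
  obtain q' where q': "\<forall>L. poly_loop_time (coeffs pl) L (poly q L) = poly q' L"
    using poly_loop_time_poly by blast
  show ?thesis
  proof (rule prunsI[where q = q'])
    fix i assume i: "i \<in> I"
    have "runs (poly_loop d0 (coeffs pl) p) (st (S i) 0) (st (S i) (0 + horner (coeffs pl) (len i)))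
      (poly_loop_time (coeffs pl) (len i) (poly q (len i)))"
      by (rule runs_poly_loop[where M = "poly pl (len i)" and ?d0.0 = d0])
        (use q[OF i] comm keep b[OF i] in \<open>auto simp: horner_coeffs\<close>)
    then show "runs (poly_loop d0 (coeffs pl) p) (st (S i) 0) (st (S i) (poly pl (len i))) (poly q' (len i))"
      by (simp add: horner_coeffs q')
  qed
qed

section \<open>Emitting words on the output tape\<close>

definition out_tape :: "bool list \<Rightarrow> tape" where
  "out_tape y = (word_tape y, int (length y))"

text \<open>The word \<open>y\<close> already written is an arbitrary index that \<open>len\<close>
  ignores, so emitted words concatenate and the time bound cannot depend on the earlier
  output.\<close>

definition emits :: "'i set \<Rightarrow> ('i \<Rightarrow> nat) \<Rightarrow> prog \<Rightarrow> ('i \<Rightarrow> state) \<Rightarrow> ('i \<Rightarrow> bool list) \<Rightarrow> bool" where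
  "emits I len p S w \<longleftrightarrow> pruns (I \<times> UNIV) (\<lambda>(i, y). len i) p
     (\<lambda>(i, y). (S i)(0 := out_tape y)) (\<lambda>(i, y). (S i)(0 := out_tape (y @ w i)))"

lemma emitsI:
  assumes "\<And>i y. i \<in> I \<Longrightarrow> runs p ((S i)(0 := out_tape y)) ((S i)(0 := out_tape (y @ w i))) t"
  shows "emits I len p S w"
  unfolding emits_def by (rule pruns_const[where t = t]) (use assms in auto)

lemma emitsE:
  assumes "emits I len p S w"
  obtains q where "\<And>i y. i \<in> I \<Longrightarrow>
    runs p ((S i)(0 := out_tape y)) ((S i)(0 := out_tape (y @ w i))) (poly q (len i))"
  using assms unfolding emits_def pruns_def by auto

lemma emits_cong:
  assumes "emits I len p S w" "\<And>i. i \<in> I \<Longrightarrow> S i = S' i" "\<And>i. i \<in> I \<Longrightarrow> w i = w' i"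
  shows "emits I len p S' w'"
  using assms unfolding emits_def by (elim pruns_cong) auto

lemma emits_Skip: "emits I len Skip S (\<lambda>_. [])"
  by (rule emitsI[where t = 0]) (simp add: runs_Skip)

lemma emits_Seq:
  assumes "emits I len p S v" "emits I len q S w"
  shows "emits I len (Seq p q) S (\<lambda>i. v i @ w i)"
proof -
  obtain a where a: "\<And>i y. i \<in> I \<Longrightarrow>
      runs p ((S i)(0 := out_tape y)) ((S i)(0 := out_tape (y @ v i))) (poly a (len i))"
    using emitsE[OF assms(1)] by blast
  obtain b where b: "\<And>i y. i \<in> I \<Longrightarrow>
      runs q ((S i)(0 := out_tape y)) ((S i)(0 := out_tape (y @ w i))) (poly b (len i))"
    using emitsE[OF assms(2)] by blast
  show ?thesis unfolding emits_def
  proof (rule prunsI[where q = "a + b + 1"])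
    fix iy assume "iy \<in> I \<times> (UNIV :: bool list set)"
    then obtain i y where iy: "iy = (i, y)" "i \<in> I" by auto
    from runs_Seq[OF a[OF iy(2), of y] b[OF iy(2), of "y @ v i"]]
    show "runs (Seq p q) (case iy of (i, y) \<Rightarrow> (S i)(0 := out_tape y))
      (case iy of (i, y) \<Rightarrow> (S i)(0 := out_tape (y @ v i @ w i))) (poly (a + b + 1) (case iy of (i, y) \<Rightarrow> len i))"
      by (simp add: iy)
  qed
qed

lemma emits_seqs:
  assumes "\<And>k. k \<in> set ks \<Longrightarrow> emits I len (P k) S (w k)"
  shows "emits I len (seqs (map P ks)) S (\<lambda>i. concat (map (\<lambda>k. w k i) ks))"
  using assms
proof (induction ks)
  case (Cons k ks)
  have "emits I len (Seq (P k) (seqs (map P ks))) S (\<lambda>i. w k i @ concat (map (\<lambda>k. w k i) ks))"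
    by (rule emits_Seq) (use Cons in auto)
  then show ?case by (simp add: seqs_def)
qed (simp add: seqs_def emits_Skip)

lemma reads_upd_0: "reads (s(0 := v)) = (reads s)(0 := fst v (snd v))"
  by (auto simp: reads_def)

text \<open>The test must ignore tape 0, since the run starts from \<open>S i\<close> with that tape
  replaced.\<close>

lemma emits_Cond:
  assumes "emits {i \<in> I. b (reads (S i))} len p S w" "emits {i \<in> I. \<not> b (reads (S i))} len q S w"
    and b: "\<And>r v. b (r(0 := v)) = b r"
  shows "emits I len (Cond b p q) S w"
  unfolding emits_def
proof (rule pruns_Cond, goal_cases)
  case 1
  have "{i \<in> I \<times> (UNIV :: bool list set). b (reads (case i of (i, y) \<Rightarrow> (S i)(0 := out_tape y)))}
    = {i \<in> I. b (reads (S i))} \<times> UNIV" by (auto simp: reads_upd_0 b)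
  then show ?case using assms(1) by (simp add: emits_def)
next
  case 2
  have "{i \<in> I \<times> (UNIV :: bool list set). \<not> b (reads (case i of (i, y) \<Rightarrow> (S i)(0 := out_tape y)))}
    = {i \<in> I. \<not> b (reads (S i))} \<times> UNIV" by (auto simp: reads_upd_0 b)
  then show ?case using assms(2) by (simp add: emits_def)
qed

lemma emits_For:
  assumes u: "dir_vec u" "u c = 1" "u 0 = 0" and b: "\<And>i. i \<in> I \<Longrightarrow> is_block (S i c) (N i)"
    and N: "\<And>i. i \<in> I \<Longrightarrow> N i \<le> poly qN (len i)"
    and body: "emits {(i, j). i \<in> I \<and> j < N i} (\<lambda>(i, j). len i) body (\<lambda>(i, j). shift u (int j) (S i)) w"
  shows "emits I len (For c u body) S (\<lambda>i. concat (map (\<lambda>j. w (i, j)) [0..<N i]))"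
proof -
  have c: "c \<noteq> 0" using u by (metis zero_neq_one)
  let ?st = "\<lambda>iy j. (S (fst iy))(0 := out_tape (snd iy @ concat (map (\<lambda>j. w (fst iy, j)) [0..<j])))"
  obtain q where q: "\<And>i j y. i \<in> I \<Longrightarrow> j < N i \<Longrightarrow>
      runs body ((shift u (int j) (S i))(0 := out_tape y))
        ((shift u (int j) (S i))(0 := out_tape (y @ w (i, j)))) (poly q (len i))"
    using body unfolding emits_def pruns_def by auto
  have "pruns (I \<times> UNIV) (\<lambda>(i, y). len i) (For c u body) (\<lambda>i. ?st i 0) (\<lambda>i. ?st i (N (fst i)))"
  proof (rule pruns_For[where qN = qN and st = ?st], goal_cases)
    case 5
    have "runs body (shift u (int j) (?st (i, y) j)) (shift u (int j) (?st (i, y) (Suc j))) (poly q (len i))"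
      if "i \<in> I" "j < N i" for i y j
      using q[OF that, of "y @ concat (map (\<lambda>j. w (i, j)) [0..<j])"] by (simp add: shift_upd[of u 0, OF u(3)])
    then show ?case by (intro prunsI[where q = q]) auto
  qed (use u b N c in auto)
  then show ?thesis unfolding emits_def by (elim pruns_cong) auto
qed

definition write_move :: "nat set \<Rightarrow> nat \<Rightarrow> move \<Rightarrow> prog" where
  "write_move A a m = Act (\<lambda>r i. if i \<in> A then (a, m) else (r i, MStay))"

lemma runs_write_move:
  "runs (write_move A a m) s (\<lambda>i. if i \<in> A then act_tape (a, m) (s i) else s i) 1"
proof -
  have "apply_act (\<lambda>i. if i \<in> A then (a, m) else (reads s i, MStay)) s =
    (\<lambda>i. if i \<in> A then act_tape (a, m) (s i) else s i)"
  proof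
    fix i show "apply_act (\<lambda>i. if i \<in> A then (a, m) else (reads s i, MStay)) s i =
      (if i \<in> A then act_tape (a, m) (s i) else s i)"
      by (cases "s i") (auto simp: apply_act_def reads_def)
  qed
  then show ?thesis unfolding write_move_def
    using runs_Act[of "\<lambda>r i. if i \<in> A then (a, m) else (r i, MStay)" s] by simp
qed

lemma runs_write_move_1:
  "runs (write_move {c} a m) s (s(c := act_tape (a, m) (s c))) 1"
proof -
  have "(\<lambda>i. if i \<in> {c} then act_tape (a, m) (s i) else s i) = s(c := act_tape (a, m) (s c))"
    by auto
  then show ?thesis using runs_write_move[of "{c}" a m s] by simp
qed

lemma word_tape_snoc: "(word_tape y)(int (length y) := (if b then 2 else 1)) = word_tape (y @ [b])"
  by (auto simp: word_tape_def nth_append fun_eq_iff nat_less_iff)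

lemma word_tape_update:
  "j < length y \<Longrightarrow> (word_tape y)(int j := (if b then 2 else 1)) = word_tape (y[j := b])"
  by (auto simp: word_tape_def nth_list_update fun_eq_iff)

definition emit_bit :: "bool \<Rightarrow> prog" where
  "emit_bit b = write_move {0} (if b then 2 else 1) MRight"

lemma emits_bit: "emits I len (emit_bit b) S (\<lambda>_. [b])"
proof (rule emitsI[where t = 1])
  fix i y
  have "act_tape (if b then 2 else 1, MRight) (out_tape y) = out_tape (y @ [b])"
    by (simp add: out_tape_def word_tape_snoc flip: word_tape_snoc)
  then show "runs (emit_bit b) ((S i)(0 := out_tape y)) ((S i)(0 := out_tape (y @ [b]))) 1"
    unfolding emit_bit_def
    using runs_write_move_1[of 0 "if b then 2 else 1" MRight "(S i)(0 := out_tape y)"] by simp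
qed

definition emit_word :: "bool list \<Rightarrow> prog" where
  "emit_word w = seqs (map emit_bit w)"

lemma emits_word: "emits I len (emit_word w) S (\<lambda>_. w)"
  using emits_seqs[of w I len emit_bit S "\<lambda>b _. [b]", OF emits_bit]
  by (simp add: emit_word_def)

definition emit_copy :: "nat \<Rightarrow> prog" where
  "emit_copy c = Act (\<lambda>r i. if i = 0 then (r c, MRight) else (r i, MStay))"

lemma runs_emit_copy:
  assumes "c \<noteq> 0" "reads s c = (if b then 2 else 1)"
  shows "runs (emit_copy c) (s(0 := out_tape y)) (s(0 := out_tape (y @ [b]))) 1"
proof -
  let ?s = "s(0 := out_tape y)"
  have r: "reads ?s c = (if b then 2 else 1)" using assms by (simp add: reads_upd_0)
  have "apply_act (\<lambda>i. if i = 0 then (reads ?s c, MRight) else (reads ?s i, MStay)) ?s = s(0 := out_tape (y @ [b]))"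
  proof
    fix i show "apply_act (\<lambda>i. if i = 0 then (reads ?s c, MRight) else (reads ?s i, MStay)) ?s i = (s(0 := out_tape (y @ [b]))) i"
      unfolding r by (cases "s i") (auto simp: apply_act_def reads_def out_tape_def word_tape_snoc simp flip: word_tape_snoc)
  qed
  then show ?thesis unfolding emit_copy_def
    using runs_Act[of "\<lambda>r i. if i = 0 then (r c, MRight) else (r i, MStay)" ?s] by simp
qed

definition emit_num :: "nat \<Rightarrow> prog" where
  "emit_num c = Seq (For c (axis c) (Seq (emit_bit True) (emit_copy c))) (emit_bit False)"

lemma length_binary_le: "length (binary n) \<le> n"
proof (induction n rule: less_induct)
  case (less n)
  show ?case using less[of "n div 2"] by (subst binary.simps) auto
qed

lemma emits_num:
  assumes c: "c \<noteq> 0" and S: "\<And>i. i \<in> I \<Longrightarrow> S i c = (word_tape (binary (v i)), 0)"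
    and v: "\<And>i. i \<in> I \<Longrightarrow> v i \<le> poly qv (len i)"
  shows "emits I len (emit_num c) S (\<lambda>i. encode_nat (v i))"
proof -
  have body: "emits {(i, j). i \<in> I \<and> j < length (binary (v i))} (\<lambda>(i, j). len i)
     (Seq (emit_bit True) (emit_copy c)) (\<lambda>(i, j). shift (axis c) (int j) (S i))
     (\<lambda>ij. [True] @ [case ij of (i, j) \<Rightarrow> binary (v i) ! j])"
  proof (rule emits_Seq[OF emits_bit], rule emitsI[where t = 1], safe)
    fix i j y assume i: "i \<in> I" and j: "j < length (binary (v i))"
    have "reads (shift (axis c) (int j) (S i)) c = (if binary (v i) ! j then 2 else 1)"
      using j by (simp add: S[OF i] shift_def reads_def word_tape_def)
    from runs_emit_copy[OF c this] show
      "runs (emit_copy c) ((shift (axis c) (int j) (S i))(0 := out_tape y))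
        ((shift (axis c) (int j) (S i))(0 := out_tape (y @ [binary (v i) ! j]))) 1" .
  qed
  have "emits I len (For c (axis c) (Seq (emit_bit True) (emit_copy c))) S
     (\<lambda>i. concat (map (\<lambda>j. [True] @ [case (i, j) of (i, j) \<Rightarrow> binary (v i) ! j]) [0..<length (binary (v i))]))"
    by (rule emits_For[where qN = qv, OF _ _ _ _ _ body])
      (use c S order_trans[OF length_binary_le v] in auto)
  from emits_Seq[OF this emits_bit[of _ _ False]] show ?thesis
    unfolding emit_num_def
  proof (rule emits_cong)
    fix i assume "i \<in> I"
    have "map (\<lambda>b. [True, b]) (binary (v i)) = map (\<lambda>j. [True, binary (v i) ! j]) [0..<length (binary (v i))]"
      by (rule nth_equalityI) auto
    then show "concat (map (\<lambda>j. [True] @ [case (i, j) of (i, j) \<Rightarrow> binary (v i) ! j]) [0..<length (binary (v i))]) @ [False]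
      = encode_nat (v i)" by (simp add: encode_nat_def)
  qed simp
qed

section \<open>Incrementing a binary counter\<close>

lemma binary_Suc:
  "\<exists>k r. binary a = replicate k True @ r \<and> (r = [] \<or> hd r = False) \<and>
     binary (Suc a) = replicate k False @ True # tl r"
proof (induction a rule: less_induct)
  case (less a)
  consider "a = 0" | "a > 0" "even a" | "odd a" by blast
  then show ?case
  proof cases
    case 1
    show ?thesis by (rule exI[of _ 0], rule exI[of _ "[]"]) (simp add: 1 binary.simps)
  next
    case 2
    then have "binary a = False # binary (a div 2)" "binary (Suc a) = True # binary (a div 2)"
      by (subst binary.simps, simp)+
    then show ?thesis by (intro exI[of _ 0] exI[of _ "False # binary (a div 2)"]) simp
  next
    case 3
    then obtain m where m: "a = 2 * m + 1" by (rule oddE)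
    have e: "binary a = True # binary (a div 2)" "binary (Suc a) = False # binary (Suc (a div 2))"
      by (subst binary.simps, simp add: m)+
    from 3 obtain k r where "binary (a div 2) = replicate k True @ r" "r = [] \<or> hd r = False"
      "binary (Suc (a div 2)) = replicate k False @ True # tl r" using less[of "a div 2"] by (auto simp: odd_pos)
    with e show ?thesis by (intro exI[of _ "Suc k"] exI[of _ r]) simp
  qed
qed

definition binary_inc :: "nat \<Rightarrow> prog" where
  "binary_inc c = Seq (While (\<lambda>r. r c = 2) (write_move {c} 1 MRight))
     (Seq (write_move {c} 2 MRight) (Seq (While (\<lambda>r. r c \<noteq> 0) (Shift (axis c))) (rewind c (axis c))))"

text \<open>A generous linear bound suffices, as the counters only count up to values polynomial in
  the input length.\<close>

lemma runs_binary_inc: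
  "runs (binary_inc c) (s(c := (word_tape (binary a), 0))) (s(c := (word_tape (binary (Suc a)), 0)))
     (9 * a + 20)"
proof -
  \<comment> \<open>The carry passes \<open>k\<close> ones and stops at the head of
    \<open>r\<close>; for empty \<open>r\<close> it adds a new digit, and \<open>tl r\<close> fits
    both cases.\<close>
  obtain k r where k: "binary a = replicate k True @ r" "r = [] \<or> hd r = False"
    "binary (Suc a) = replicate k False @ True # tl r" using binary_Suc by blast
  have ka: "k + length r \<le> a" using length_binary_le[of a] k(1) by simp
  let ?st = "\<lambda>j. s(c := (word_tape (replicate j False @ replicate (k - j) True @ r), int j))"
  have 1: "runs (While (\<lambda>r. r c = 2) (write_move {c} 1 MRight)) (?st 0) (?st k) (k * (1 + 2) + 1)"
  proof (rule runs_While_iterate)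
    fix j assume j: "j < k"
    then show "reads (?st j) c = 2" by (simp add: reads_def word_tape_def nth_append)
    have "(replicate j False @ replicate (k - j) True @ r)[j := False]
      = replicate (Suc j) False @ replicate (k - Suc j) True @ r"
      using list_update_length[of "replicate j False" True "replicate (k - Suc j) True @ r" False] j
      by (simp add: Suc_diff_Suc[symmetric] replicate_append_same[symmetric] del: replicate.simps(2))
        (simp add: replicate_append_same)
    then have "(word_tape (replicate j False @ replicate (k - j) True @ r))(int j := 1)
      = word_tape (replicate (Suc j) False @ replicate (k - Suc j) True @ r)"
      using word_tape_update[of j "replicate j False @ replicate (k - j) True @ r" False] j by simp
    then show "runs (write_move {c} 1 MRight) (?st j) (?st (Suc j)) 1"
      using runs_write_move_1[of c 1 MRight "?st j"] by (simp add: add.commute)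
  next
    show "\<not> reads (?st k) c = 2" using k(2)
      by (cases r) (auto simp: reads_def word_tape_def nth_append)
  qed
  let ?w = "binary (Suc a)"
  let ?s = "s(c := (word_tape ?w, 0))"
  have 2: "runs (write_move {c} 2 MRight) (?st k) (shift (axis c) (int (Suc k)) ?s) 1"
  proof -
    have "(word_tape (replicate k False @ r))(int k := 2) = word_tape ?w"
    proof (cases r)
      case Nil
      then show ?thesis using word_tape_snoc[of "replicate k False" True] by (simp add: k(3))
    next
      case (Cons b r')
      then show ?thesis using word_tape_update[of k "replicate k False @ r" True] k(2)
          list_update_length[of "replicate k False" b r' True] by (simp add: k(3))
    qed
    moreover have "shift (axis c) (int (Suc k)) ?s = s(c := (word_tape ?w, int (Suc k)))"
      by (auto simp: shift_def fun_eq_iff axis_def)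
    ultimately show ?thesis using runs_write_move_1[of c 2 MRight "?st k"]
      by (simp add: add.commute)
  qed
  let ?m = "length (tl r)"
  have lw: "length ?w = Suc k + ?m" by (simp add: k(3))
  let ?st' = "\<lambda>j. shift (axis c) (int (Suc k) + int j) ?s"
  have b: "is_block (?s c) (length ?w)" by simp
  have 3: "runs (While (\<lambda>r. r c \<noteq> 0) (Shift (axis c))) (?st' 0) (?st' ?m) (?m * (1 + 2) + 1)"
  proof (rule runs_While_iterate)
    fix j assume j: "j < ?m"
    then show "reads (?st' j) c \<noteq> 0" using lw by (simp add: reads_shift_block[of ?s c "length ?w" "axis c", OF b])
    show "runs (Shift (axis c)) (?st' j) (?st' (Suc j)) 1"
      using runs_Shift[of "axis c" "?st' j"] by (simp add: shift_shift algebra_simps)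
  next
    show "\<not> reads (?st' ?m) c \<noteq> 0" using lw by (simp add: reads_shift_block[of ?s c "length ?w" "axis c", OF b])
  qed
  have 4: "runs (rewind c (axis c)) (?st' ?m) ?s (length ?w * 3 + 6)"
    using runs_rewind[of "axis c" c ?s "length ?w", OF _ _ b] lw by (simp add: add.assoc)
  have 3: "runs (While (\<lambda>r. r c \<noteq> 0) (Shift (axis c))) (shift (axis c) (int (Suc k)) ?s) (?st' ?m) (?m * (1 + 2) + 1)"
    using 3 by simp
  note runs_Seq[OF 1 runs_Seq[OF 2 runs_Seq[OF 3 4]], folded binary_inc_def]
  then have "runs (binary_inc c) (?st 0) ?s (9 * a + 20)"
    by (rule runs_mono) (use ka lw in simp)
  then show ?thesis by (simp add: k(1))
qed

text \<open>The output goes to the tape that held the input, so the input is erased there while it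
  is copied to the tapes in \<open>A\<close>; afterwards all heads return together under the control
  of tape \<open>c\<close>.\<close>

definition copy_input :: "nat \<Rightarrow> nat set \<Rightarrow> prog" where
  "copy_input c A = Seq
     (While (\<lambda>r. r 0 \<noteq> 0) (Act (\<lambda>r i. if i = 0 then (0, MRight) else if i \<in> A then (r 0, MRight) else (r i, MStay))))
     (rewind c (\<lambda>i. if i = 0 \<or> i \<in> A then 1 else 0))"

definition copied_state :: "nat set \<Rightarrow> bool list \<Rightarrow> state" where
  "copied_state A x = (\<lambda>i. if i \<in> A then (word_tape x, 0) else (word_tape [], 0))"

lemma runs_copy_input:
  assumes c: "c \<in> A" and A0: "0 \<notin> A"
  shows "runs (copy_input c A) (init_state x) (copied_state A x) (7 * length x + 10)"
proof -
  let ?f = "\<lambda>r i. if i = 0 then (0, MRight) else if i \<in> A then (r 0, MRight) else (r i, MStay)"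
  let ?st = "\<lambda>j i. if i = 0 then (\<lambda>p. if p < int j then 0 else word_tape x p, int j)
     else if i \<in> A then (word_tape (take j x), int j) else (word_tape [], 0)"
  let ?u = "\<lambda>i. if i = 0 \<or> i \<in> A then 1 else (0::int)"
  let ?n = "length x"
  have 1: "runs (While (\<lambda>r. r 0 \<noteq> 0) (Act ?f)) (?st 0) (?st ?n) (?n * (1 + 2) + 1)"
  proof (rule runs_While_iterate)
    fix j assume j: "j < ?n"
    then show "reads (?st j) 0 \<noteq> 0" by (simp add: reads_def word_tape_def)
    have r0: "reads (?st j) 0 = (if x ! j then 2 else 1)" using j by (simp add: reads_def word_tape_def)
    have "apply_act (?f (reads (?st j))) (?st j) = ?st (Suc j)"
    proof
      fix i
      have "(word_tape (take j x))(int j := (if x ! j then 2 else 1)) = word_tape (take (Suc j) x)"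
        using word_tape_snoc[of "take j x" "x ! j"] j by (simp add: take_Suc_conv_app_nth)
      then show "apply_act (?f (reads (?st j))) (?st j) i = ?st (Suc j) i"
        using A0 unfolding r0
        by (auto simp: apply_act_def fun_eq_iff reads_def)
    qed
    then show "runs (Act ?f) (?st j) (?st (Suc j)) 1" using runs_Act[of ?f "?st j"] by simp
  next
    show "\<not> reads (?st ?n) 0 \<noteq> 0" by (simp add: reads_def word_tape_def)
  qed
  have s0: "?st 0 = init_state x"
    by (auto simp: init_state_def fun_eq_iff word_tape_def)
  have sn: "?st ?n = shift ?u (int ?n) (copied_state A x)"
    using A0 by (auto simp: fun_eq_iff shift_def copied_state_def word_tape_def)
  have "runs (rewind c ?u) (shift ?u (int ?n) (copied_state A x)) (copied_state A x) (?n * 3 + 6)"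
    by (rule runs_rewind) (use c in \<open>auto simp: dir_vec_def copied_state_def\<close>)
  from runs_Seq[OF 1[unfolded s0 sn] this] show ?thesis
    unfolding copy_input_def by (rule runs_mono) simp
qed

section \<open>Tapes and symbols used by the programs\<close>

lemma wf_Shift [simp]: "(\<And>i. i \<ge> K \<Longrightarrow> u i = 0) \<Longrightarrow> wf_prog K S (Shift u)"
  by (auto simp: Shift_def wf_act_def move_of_def)

lemma wf_rewind [simp]: "(\<And>i. i \<ge> K \<Longrightarrow> u i = 0) \<Longrightarrow> wf_prog K S (rewind c u)"
  by (auto simp: rewind_def)

lemma wf_For: "(\<And>i. i \<ge> K \<Longrightarrow> u i = 0) \<Longrightarrow> wf_prog K S p \<Longrightarrow> wf_prog K S (For c u p)"
  by (auto simp: For_def)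

lemma wf_seqs [simp]: "wf_prog K S (seqs ps) \<longleftrightarrow> (\<forall>p\<in>set ps. wf_prog K S p)"
  by (induction ps) (auto simp: seqs_def)

lemma wf_write_move [simp]: "A \<subseteq> {..<K} \<Longrightarrow> a < S \<Longrightarrow> wf_prog K S (write_move A a m)"
  by (auto simp: write_move_def wf_act_def)

lemma wf_poly_loop: "wf_prog K S p \<Longrightarrow> d + length as \<le> K \<Longrightarrow> wf_prog K S (poly_loop d as p)"
  by (induction as arbitrary: d) (auto intro!: wf_For simp: axis_def)

lemma wf_emit_bit [simp]: "K \<ge> 1 \<Longrightarrow> S \<ge> 3 \<Longrightarrow> wf_prog K S (emit_bit b)"
  by (auto simp: emit_bit_def)

lemma wf_emit_word [simp]: "K \<ge> 1 \<Longrightarrow> S \<ge> 3 \<Longrightarrow> wf_prog K S (emit_word w)"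
  by (auto simp: emit_word_def)

lemma wf_emit_num [simp]: "c < K \<Longrightarrow> S \<ge> 3 \<Longrightarrow> wf_prog K S (emit_num c)"
  by (auto simp: emit_num_def emit_copy_def wf_act_def axis_def intro!: wf_For)

lemma wf_binary_inc [simp]: "c < K \<Longrightarrow> S \<ge> 3 \<Longrightarrow> wf_prog K S (binary_inc c)"
  by (auto simp: binary_inc_def axis_def)

lemma wf_copy_input [simp]:
  "c < K \<Longrightarrow> A \<subseteq> {..<K} \<Longrightarrow> S \<ge> 3 \<Longrightarrow> wf_prog K S (copy_input c A)"
  by (auto simp: copy_input_def wf_act_def intro!: wf_rewind)

section \<open>Split graphs with universal vertices\<close>

text \<open>Listing \<open>u\<close> last keeps it in every suffix graph, where its closed
  neighbourhood is everything; so it is a maximum neighbor of each vertex.\<close>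

lemma dually_chordal_if_universal:
  assumes G: "simple_graph G" and u: "u \<in> verts G" and un: "\<And>v. v \<in> verts G \<Longrightarrow> v \<noteq> u \<Longrightarrow> {u, v} \<in> edges G"
  shows "dually_chordal G"
proof -
  have "finite (verts G)" using G by (simp add: simple_graph_def)
  then obtain ws where ws: "set ws = verts G - {u}" "distinct ws"
    using finite_distinct_list by (metis finite_Diff)
  let ?vs = "ws @ [u]"
  have "\<exists>w. maximum_neighbor (induced G (set (drop i ?vs))) (?vs ! i) w" if i: "i < length ?vs" for i
  proof -
    define U where "U = set (drop i ?vs)"
    define v where "v = ?vs ! i"
    have uU: "u \<in> U" using i by (simp add: U_def)
    have sub: "U \<subseteq> verts G" using ws u set_drop_subset[of i ?vs] by (auto simp: U_def)
    have vU: "v \<in> U" unfolding U_def v_def using i by (metis Cons_nth_drop_Suc list.set_intros(1))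
    have nb: "closed_nbhd (induced G U) u = U"
      using un sub uU by (auto simp: closed_nbhd_def induced_def insert_commute)
    have "closed_nbhd (induced G U) w \<subseteq> U" for w
      by (auto simp: closed_nbhd_def induced_def)
    moreover have "u \<in> closed_nbhd (induced G U) v"
      using un[of v] sub uU vU u by (auto simp: closed_nbhd_def induced_def)
    ultimately have "maximum_neighbor (induced G U) v u" unfolding maximum_neighbor_def nb by simp
    then show ?thesis unfolding U_def v_def by blast
  qed
  moreover have "distinct ?vs" "set ?vs = verts G" using ws u by auto
  ultimately show ?thesis unfolding dually_chordal_def maximum_neighborhood_order_def by blast
qed

text \<open>Two consecutive vertices of a cycle cannot both lie outside \<open>Q\<close>. Hence
  either the vertex at position 0 or 2 lies outside and both its neighbours on the cycle are in
  \<open>Q\<close>, or positions 0 and 2 are in \<open>Q\<close>; length at least 4 makes the two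
  found vertices non-consecutive.\<close>

lemma chordal_if_split:
  assumes clique: "\<And>u v. u \<in> Q \<Longrightarrow> v \<in> Q \<Longrightarrow> u \<in> verts G \<Longrightarrow> v \<in> verts G \<Longrightarrow> u \<noteq> v \<Longrightarrow> {u, v} \<in> edges G"
    and indep: "\<And>u v. {u, v} \<in> edges G \<Longrightarrow> u \<in> Q \<or> v \<in> Q"
  shows "chordal G"
  unfolding chordal_def
proof (intro allI impI)
  fix cs assume cyc: "is_cycle G cs" and len: "4 \<le> length cs"
  let ?m = "length cs"
  have edge: "{cs ! i, cs ! (Suc i mod ?m)} \<in> edges G" if "i < ?m" for i
    using cyc that by (simp add: is_cycle_def)
  have chord: "has_chord G cs" if "i < ?m" "j < ?m" "i \<noteq> j" "j \<noteq> Suc i mod ?m" "i \<noteq> Suc j mod ?m"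
    "cs ! i \<in> Q" "cs ! j \<in> Q" for i j
  proof -
    have "cs ! i \<noteq> cs ! j" using cyc that by (simp add: is_cycle_def nth_eq_iff_index_eq)
    moreover have "cs ! i \<in> verts G" "cs ! j \<in> verts G" using cyc that by (auto simp: is_cycle_def)
    ultimately have "{cs ! i, cs ! j} \<in> edges G" using clique that by blast
    then show ?thesis unfolding has_chord_def using that by blast
  qed
  have ne: "cs \<noteq> []" using len by auto
  have e0: "{cs ! 0, cs ! 1} \<in> edges G" using edge[of 0] len ne by simp
  have el: "{cs ! (?m - 1), cs ! 0} \<in> edges G"
  proof -
    have "Suc (?m - 1) mod ?m = 0" using ne by simp
    then show ?thesis using edge[of "?m - 1"] ne by simp
  qed
  have e1: "{cs ! 1, cs ! 2} \<in> edges G" using edge[of 1] len by (simp add: numeral_2_eq_2)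
  have e2: "{cs ! 2, cs ! 3} \<in> edges G" using edge[of 2] len by (simp add: numeral_3_eq_3 numeral_2_eq_2)
  consider "cs ! 0 \<notin> Q" | "cs ! 2 \<notin> Q" | "cs ! 0 \<in> Q" "cs ! 2 \<in> Q" by blast
  then show "has_chord G cs"
  proof cases
    case 1
    then have "cs ! 1 \<in> Q" "cs ! (?m - 1) \<in> Q" using indep[OF e0] indep[OF el] by auto
    moreover have "Suc (?m - 1) mod ?m = 0" using ne by simp
    ultimately show ?thesis using len ne by (intro chord[of 1 "?m - 1"]) auto
  next
    case 2
    then have "cs ! 1 \<in> Q" "cs ! 3 \<in> Q" using indep[OF e1] indep[OF e2] by auto
    moreover have "Suc 3 mod ?m \<noteq> 1" using len by (cases "?m = 4") auto
    ultimately show ?thesis using len ne by (intro chord[of 1 3]) auto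
  next
    case 3
    moreover have "Suc 2 mod ?m = 3" using len by simp
    ultimately show ?thesis using len ne by (intro chord[of 0 2]) auto
  qed
qed

text \<open>Input graphs must live on an initial segment of the naturals, whereas the construction
  has structured vertices; the list is the numbering that connects them.\<close>

definition list_graph :: "'v list \<Rightarrow> ('v \<Rightarrow> 'v \<Rightarrow> bool) \<Rightarrow> nat graph" where
  "list_graph vl adj = \<lparr>verts = {..<length vl},
     edges = {{i, j} | i j. i < length vl \<and> j < length vl \<and> adj (vl ! i) (vl ! j)}\<rparr>"

lemma list_graph_edge:
  assumes "\<And>v w. adj v w = adj w v"
  shows "{i, j} \<in> edges (list_graph vl adj) \<longleftrightarrow> i < length vl \<and> j < length vl \<and> adj (vl ! i) (vl ! j)"
  using assms by (auto simp: list_graph_def doubleton_eq_iff)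

lemma graph_code_list_graph:
  assumes "\<And>v w. adj v w = adj w v"
  shows "graph_code (list_graph vl adj) =
    length vl # concat (map (\<lambda>v. map (\<lambda>w. if adj v w then 1 else 0) vl) vl)"
proof -
  have m: "map h vl = map (\<lambda>i. h (vl ! i)) [0..<length vl]" for h :: "'a \<Rightarrow> 'b"
    by (intro nth_equalityI) auto
  have "card (verts (list_graph vl adj)) = length vl" by (simp add: list_graph_def)
  then show ?thesis
    unfolding graph_code_def Let_def list_graph_edge[where adj = adj, OF assms] m
    by (auto intro!: arg_cong[of _ _ concat])
qed

lemma vector_code_list_graph: "vector_code (list_graph vl adj) (\<lambda>i. k (vl ! i)) = map k vl"
  by (intro nth_equalityI) (auto simp: vector_code_def list_graph_def)

text \<open>\<open>un\<close> stands for universal and \<open>fr\<close> for free: only the free vertices will carry weight.\<close>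

definition split_adj :: "('v \<Rightarrow> bool) \<Rightarrow> ('v \<Rightarrow> bool) \<Rightarrow> ('v \<Rightarrow> 'v \<Rightarrow> bool) \<Rightarrow> 'v \<Rightarrow> 'v \<Rightarrow> bool" where
  "split_adj un fr inc v w \<longleftrightarrow> v \<noteq> w \<and>
     (un v \<or> un w \<or> fr v \<and> fr w \<or> fr w \<and> \<not> fr v \<and> inc v w \<or> fr v \<and> \<not> fr w \<and> inc w v)"

lemma split_adj_sym: "split_adj un fr inc v w = split_adj un fr inc w v"
  by (auto simp: split_adj_def)

locale split_system =
  fixes vl :: "'v list" and un fr :: "'v \<Rightarrow> bool" and inc :: "'v \<Rightarrow> 'v \<Rightarrow> bool"
  assumes dist: "distinct vl" and excl: "\<not> (un v \<and> fr v)" and ex_un: "\<exists>v\<in>set vl. un v"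
begin

abbreviation "G \<equiv> list_graph vl (split_adj un fr inc)"
abbreviation "X \<equiv> {x \<in> set vl. fr x}"

text \<open>The part of a closed neighbourhood that can carry weight. A free vertex sees all of
  \<open>X\<close> because the free vertices form a clique, so its constraint is on the total, like
  that of a universal vertex.\<close>

definition scope :: "'v \<Rightarrow> 'v set" where
  "scope v = (if un v \<or> fr v then X else {x \<in> X. inc v x})"

lemma edge_iff: "{i, j} \<in> edges G \<longleftrightarrow>
    i < length vl \<and> j < length vl \<and> split_adj un fr inc (vl ! i) (vl ! j)"
  by (rule list_graph_edge) (rule split_adj_sym)

lemma verts_G: "verts G = {..<length vl}"
  by (simp add: list_graph_def)

lemma simple_G: "simple_graph G"
  unfolding simple_graph_def
proof (intro conjI ballI)
  fix e assume "e \<in> edges G"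
  then obtain i j where "e = {i, j}" "i < length vl" "j < length vl" "split_adj un fr inc (vl ! i) (vl ! j)"
    unfolding list_graph_def by auto
  moreover then have "i \<noteq> j" by (auto simp: split_adj_def)
  ultimately show "\<exists>u\<in>verts G. \<exists>v\<in>verts G. u \<noteq> v \<and> e = {u, v}" unfolding verts_G by blast
qed (simp add: verts_G)

lemma nth_eq: "i < length vl \<Longrightarrow> j < length vl \<Longrightarrow> vl ! i = vl ! j \<longleftrightarrow> i = j"
  using dist by (simp add: nth_eq_iff_index_eq)

lemma doubly_chordal_G: "doubly_chordal G"
proof -
  obtain u where u: "u < length vl" "un (vl ! u)" using ex_un by (auto simp: in_set_conv_nth)
  have "dually_chordal G"
    by (rule dually_chordal_if_universal[OF simple_G, of u])
      (use u in \<open>auto simp: verts_G edge_iff split_adj_def nth_eq\<close>)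
  moreover have "chordal G"
  proof (rule chordal_if_split[where Q = "{i. un (vl ! i) \<or> fr (vl ! i)}"])
    fix i j assume "{i, j} \<in> edges G"
    then show "i \<in> {i. un (vl ! i) \<or> fr (vl ! i)} \<or> j \<in> {i. un (vl ! i) \<or> fr (vl ! i)}"
      unfolding edge_iff by (auto simp: split_adj_def)
  next
    fix i j assume "i \<in> verts G" "j \<in> verts G" "i \<noteq> j"
      "i \<in> {i. un (vl ! i) \<or> fr (vl ! i)}" "j \<in> {i. un (vl ! i) \<or> fr (vl ! i)}"
    then show "{i, j} \<in> edges G" unfolding edge_iff by (auto simp: split_adj_def verts_G nth_eq)
  qed
  ultimately show ?thesis by (simp add: doubly_chordal_def)
qed

lemma sum_nth:
  assumes f: "\<And>i. i < length vl \<Longrightarrow> f i = (if fr (vl ! i) then F (vl ! i) else (0::nat))"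
  shows "sum f {i. i < length vl \<and> P (vl ! i)} = sum F {x \<in> X. P x}"
proof -
  have "sum f {i. i < length vl \<and> P (vl ! i)} = sum f {i. i < length vl \<and> fr (vl ! i) \<and> P (vl ! i)}"
    by (rule sum.mono_neutral_right) (use f in auto)
  also have "\<dots> = sum (\<lambda>i. F (vl ! i)) {i. i < length vl \<and> fr (vl ! i) \<and> P (vl ! i)}"
    by (rule sum.cong) (use f in auto)
  also have "\<dots> = sum F {x \<in> X. P x}"
  proof (rule sum.reindex_bij_betw)
    show "bij_betw (\<lambda>i. vl ! i) {i. i < length vl \<and> fr (vl ! i) \<and> P (vl ! i)} {x \<in> X. P x}"
      unfolding bij_betw_def by (auto simp: inj_on_def nth_eq in_set_conv_nth)
  qed
  finally show ?thesis .
qed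

lemma sum_nbhd:
  assumes f: "\<And>i. i < length vl \<Longrightarrow> f i = (if fr (vl ! i) then F (vl ! i) else (0::nat))" and i: "i < length vl"
  shows "sum f (closed_nbhd G i) = sum F (scope (vl ! i))"
proof -
  have "closed_nbhd G i = {j. j < length vl \<and> (vl ! j = vl ! i \<or> split_adj un fr inc (vl ! j) (vl ! i))}"
    using i by (auto simp: closed_nbhd_def verts_G edge_iff nth_eq)
  then have "sum f (closed_nbhd G i) = sum F {x \<in> X. x = vl ! i \<or> split_adj un fr inc x (vl ! i)}"
    using sum_nth[OF f, where P = "\<lambda>x. x = vl ! i \<or> split_adj un fr inc x (vl ! i)"] by simp
  also have "{x \<in> X. x = vl ! i \<or> split_adj un fr inc x (vl ! i)} = scope (vl ! i)"
    using excl by (auto simp: scope_def split_adj_def)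
  finally show ?thesis .
qed

lemma sum_verts:
  assumes f: "\<And>i. i < length vl \<Longrightarrow> f i = (if fr (vl ! i) then F (vl ! i) else (0::nat))"
  shows "sum f (verts G) = sum F X"
  using sum_nth[OF f, where P = "\<lambda>_. True"] by (simp add: verts_G lessThan_def)

text \<open>\<open>R\<close> and \<open>Q\<close> stay abstract so that packing and domination, with
  their opposite inequalities, share this passage from vertex numbers to weights on
  \<open>X\<close>.\<close>

lemma ex_feasible_iff:
  fixes l :: nat
  shows "(\<exists>f. (\<forall>i\<in>verts G. f i \<le> (if fr (vl ! i) then l else 0) \<and> R (vl ! i) (sum f (closed_nbhd G i))) \<and>
       Q (sum f (verts G))) \<longleftrightarrow>
    (\<exists>F. (\<forall>x\<in>X. F x \<le> l) \<and> (\<forall>v\<in>set vl. R v (sum F (scope v))) \<and> Q (sum F X))" (is "?L \<longleftrightarrow> ?R")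
proof
  assume ?L
  then obtain f where f: "\<And>i. i < length vl \<Longrightarrow> f i \<le> (if fr (vl ! i) then l else 0)"
    "\<And>i. i < length vl \<Longrightarrow> R (vl ! i) (sum f (closed_nbhd G i))" "Q (sum f (verts G))"
    by (auto simp: verts_G)
  define F where "F x = f (inv_into {..<length vl} (\<lambda>i. vl ! i) x)" for x
  have inj: "inj_on (\<lambda>i. vl ! i) {..<length vl}" by (auto simp: inj_on_def nth_eq)
  have F: "F (vl ! i) = f i" if "i < length vl" for i
    unfolding F_def using inv_into_f_f[OF inj, of i] that by simp
  have fF: "f i = (if fr (vl ! i) then F (vl ! i) else 0)" if "i < length vl" for i
    using f(1)[OF that] F[OF that] by (auto split: if_splits)
  show ?R
  proof (intro exI[of _ F] conjI ballI)
    fix x assume "x \<in> X"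
    then show "F x \<le> l" using f(1) F by (force simp: in_set_conv_nth)
  next
    fix v assume "v \<in> set vl"
    then show "R v (sum F (scope v))" using f(2) sum_nbhd[OF fF] by (force simp: in_set_conv_nth)
  next
    show "Q (sum F X)" using f(3) sum_verts[OF fF] by simp
  qed
next
  assume ?R
  then obtain F where F: "\<forall>x\<in>X. F x \<le> l" "\<forall>v\<in>set vl. R v (sum F (scope v))" "Q (sum F X)" by blast
  define f where "f i = (if fr (vl ! i) then F (vl ! i) else 0)" for i
  have "sum f (closed_nbhd G i) = sum F (scope (vl ! i))" if "i < length vl" for i
    by (rule sum_nbhd) (use that in \<open>auto simp: f_def\<close>)
  moreover have "sum f (verts G) = sum F X" by (rule sum_verts) (simp add: f_def)
  ultimately show ?L using F by (intro exI[of _ f]) (auto simp: verts_G f_def)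
qed

end

section \<open>Optimum values as existence statements\<close>

lemma gpf_max_ge_iff:
  assumes "finite (verts G)"
  shows "B \<le> gpf_max G k u \<longleftrightarrow> (\<exists>f. gpf_feasible G k u f \<and> B \<le> sum f (verts G))"
proof -
  let ?A = "{sum f (verts G) | f. gpf_feasible G k u f}"
  have "?A \<subseteq> {..sum u (verts G)}" by (auto simp: gpf_feasible_def intro: sum_mono)
  then have fin: "finite ?A" using finite_subset by blast
  \<comment> \<open>The zero function keeps \<open>Max\<close> away from the empty set.\<close>
  have "gpf_feasible G k u (\<lambda>_. 0)" by (simp add: gpf_feasible_def)
  then have "?A \<noteq> {}" by blast
  from Max_ge_iff[OF fin this, of B] show ?thesis unfolding gpf_max_def by blast
qed

lemma lpf_max_eq_gpf_max: "lpf_max l G k t = gpf_max G k (\<lambda>v. if t v = Zero then 0 else l)"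
proof -
  have "lpf_feasible l G k t f = gpf_feasible G k (\<lambda>v. if t v = Zero then 0 else l) f" for f
    unfolding lpf_feasible_def gpf_feasible_def by (rule ball_cong[OF refl]) auto
  then show ?thesis by (simp add: lpf_max_def gpf_max_def)
qed

lemma gdf_min_le_iff:
  "gdf_min G k u \<le> enat B \<longleftrightarrow> (\<exists>f. gdf_feasible G k u f \<and> sum f (verts G) \<le> B)"
proof -
  let ?A = "{enat (sum f (verts G)) | f. gdf_feasible G k u f}"
  show ?thesis
  proof
    assume le: "gdf_min G k u \<le> enat B"
    have "?A \<noteq> {}"
    proof
      assume "?A = {}"
      then have "gdf_min G k u = Inf {}" by (simp only: gdf_min_def)
      then have "gdf_min G k u = \<infinity>" by (simp add: Inf_enat_def)
      then show False using le by simp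
    qed
    then have "Inf ?A \<in> ?A" by (metis (no_types, lifting) Inf_enat_def LeastI ex_in_conv)
    then show "\<exists>f. gdf_feasible G k u f \<and> sum f (verts G) \<le> B"
      using le unfolding gdf_min_def by force
  next
    assume "\<exists>f. gdf_feasible G k u f \<and> sum f (verts G) \<le> B"
    then obtain f where "gdf_feasible G k u f" "sum f (verts G) \<le> B" by blast
    then show "gdf_min G k u \<le> enat B" unfolding gdf_min_def
      by (intro Inf_lower2[of "enat (sum f (verts G))"]) auto
  qed
qed

text \<open>In both directions, the bound on the total weight forces weight one on every group.\<close>

lemma packing_iff_choice:
  fixes grp :: "'v \<Rightarrow> 'g" and N :: "'c \<Rightarrow> 'v set" and l :: nat
  assumes fin: "finite X" and l: "l \<ge> 1"
    and N: "\<And>c. c \<in> C \<Longrightarrow> N c \<subseteq> X" "\<And>c. c \<in> C \<Longrightarrow> card (N c) = Suc (k c)"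
  shows "(\<exists>F. (\<forall>x\<in>X. F x \<le> l) \<and> (\<forall>g\<in>grp ` X. sum F {x \<in> X. grp x = g} \<le> 1) \<and>
       (\<forall>c\<in>C. sum F (N c) \<le> k c) \<and> sum F X \<le> card (grp ` X) \<and> card (grp ` X) \<le> sum F X) \<longleftrightarrow>
    (\<exists>a. (\<forall>g\<in>grp ` X. a g \<in> X \<and> grp (a g) = g) \<and> (\<forall>c\<in>C. \<exists>x\<in>N c. a (grp x) \<noteq> x))" (is "?L \<longleftrightarrow> ?R")
proof
  assume ?L
  then obtain F where F: "\<forall>g\<in>grp ` X. sum F {x \<in> X. grp x = g} \<le> 1" "\<forall>c\<in>C. sum F (N c) \<le> k c"
    "card (grp ` X) \<le> sum F X" by blast
  \<comment> \<open>No group exceeds weight 1, so a group of weight 0 would push the total below the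
    number of groups.\<close>
  have "\<exists>x\<in>X. grp x = g \<and> F x \<ge> 1" if g: "g \<in> grp ` X" for g
  proof (rule ccontr)
    assume "\<not> ?thesis"
    then have "sum F {x \<in> X. grp x = g} = 0" by (intro sum.neutral) (auto simp: not_less_eq_eq)
    then have "(\<Sum>g\<in>grp ` X. sum F {x \<in> X. grp x = g}) < (\<Sum>g\<in>grp ` X. 1)"
      using F(1) g fin by (intro sum_strict_mono_ex1) (auto intro!: bexI[of _ g])
    then show False using F(3) sum.image_gen[OF fin, of F grp] by simp
  qed
  then obtain a where a: "\<And>g. g \<in> grp ` X \<Longrightarrow> a g \<in> X \<and> grp (a g) = g \<and> F (a g) \<ge> 1" by metis
  \<comment> \<open>If every literal were chosen, the \<open>Suc (k c)\<close> vertices of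
    \<open>N c\<close> would break the bound \<open>k c\<close>.\<close>
  have "\<exists>x\<in>N c. a (grp x) \<noteq> x" if c: "c \<in> C" for c
  proof (rule ccontr)
    assume "\<not> ?thesis"
    then have "\<forall>x\<in>N c. 1 \<le> F x" using a N(1)[OF c] by (metis image_eqI subsetD)
    then have "card (N c) \<le> sum F (N c)" using sum_mono[of "N c" "\<lambda>_. 1" F] by simp
    then show False using F(2) c N(2)[OF c] by fastforce
  qed
  then show ?R using a by blast
next
  assume ?R
  then obtain a where a: "\<And>g. g \<in> grp ` X \<Longrightarrow> a g \<in> X \<and> grp (a g) = g"
    and aN: "\<And>c. c \<in> C \<Longrightarrow> \<exists>x\<in>N c. a (grp x) \<noteq> x" by blast
  define F where "F x = (if a (grp x) = x then 1 else 0 :: nat)" for x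
  have sumF: "sum F A = card {x \<in> A. a (grp x) = x}" if "finite A" for A
    using sum.mono_neutral_cong_right[of A "{x \<in> A. a (grp x) = x}" F "\<lambda>_. 1"] that by (auto simp: F_def)
  have one: "sum F {x \<in> X. grp x = g} = 1" if g: "g \<in> grp ` X" for g
  proof -
    have "{x \<in> {x \<in> X. grp x = g}. a (grp x) = x} = {a g}" using a[OF g] by auto
    then show ?thesis using fin by (simp add: sumF)
  qed
  then have tot: "sum F X = card (grp ` X)" using sum.image_gen[OF fin, of F grp] by simp
  have "sum F (N c) \<le> k c" if c: "c \<in> C" for c
  proof -
    have fN: "finite (N c)" using N(1)[OF c] fin finite_subset by blast
    have "{x \<in> N c. a (grp x) = x} \<subset> N c" using aN[OF c] by auto
    from psubset_card_mono[OF fN this] show ?thesis using sumF[OF fN] N(2)[OF c] by simp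
  qed
  moreover have "F x \<le> l" for x using l by (simp add: F_def)
  ultimately show ?L using one tot by (intro exI[of _ F]) auto
qed

text \<open>The roles are exchanged: groups demand weight at least 1, and the total leaves at most 1
  for each. With exactly one unit per group, weight on another alternative in the group of
  \<open>x\<close> says that \<open>x\<close> is not chosen, which turns a prohibition into a
  demand.\<close>

lemma covering_iff_choice:
  fixes grp :: "'v \<Rightarrow> 'g" and N :: "'c \<Rightarrow> 'v set"
  assumes fin: "finite X" and N: "\<And>c. c \<in> C \<Longrightarrow> N c \<subseteq> X"
  shows "(\<exists>F. (\<forall>x\<in>X. F x \<le> (1::nat)) \<and> (\<forall>g\<in>grp ` X. 1 \<le> sum F {x \<in> X. grp x = g}) \<and>
       (\<forall>c\<in>C. 1 \<le> sum F {y \<in> X. \<exists>x\<in>N c. grp y = grp x \<and> y \<noteq> x}) \<and> sum F X \<le> card (grp ` X)) \<longleftrightarrow>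
    (\<exists>a. (\<forall>g\<in>grp ` X. a g \<in> X \<and> grp (a g) = g) \<and> (\<forall>c\<in>C. \<exists>x\<in>N c. a (grp x) \<noteq> x))" (is "?L \<longleftrightarrow> ?R")
proof
  assume ?L
  then obtain F where F: "\<forall>g\<in>grp ` X. 1 \<le> sum F {x \<in> X. grp x = g}"
    "\<forall>c\<in>C. 1 \<le> sum F {y \<in> X. \<exists>x\<in>N c. grp y = grp x \<and> y \<noteq> x}" "sum F X \<le> card (grp ` X)" by blast
  have one: "sum F {x \<in> X. grp x = g} \<le> 1" if g: "g \<in> grp ` X" for g
  proof (rule ccontr)
    assume "\<not> ?thesis"
    then have "1 < sum F {x \<in> X. grp x = g}" by simp
    then have "(\<Sum>g\<in>grp ` X. 1) < (\<Sum>g\<in>grp ` X. sum F {x \<in> X. grp x = g})"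
      using F(1) g fin by (intro sum_strict_mono_ex1) blast+
    then show False using F(3) sum.image_gen[OF fin, of F grp] by simp
  qed
  have "\<exists>x\<in>X. grp x = g \<and> F x \<ge> 1" if g: "g \<in> grp ` X" for g
  proof (rule ccontr)
    assume "\<not> ?thesis"
    then have "sum F {x \<in> X. grp x = g} = 0" by (intro sum.neutral) (auto simp: not_less_eq_eq)
    then show False using F(1) g by fastforce
  qed
  then obtain a where a: "\<And>g. g \<in> grp ` X \<Longrightarrow> a g \<in> X \<and> grp (a g) = g \<and> F (a g) \<ge> 1" by metis
  have "\<exists>x\<in>N c. a (grp x) \<noteq> x" if c: "c \<in> C" for c
  proof -
    have "\<exists>y\<in>{y \<in> X. \<exists>x\<in>N c. grp y = grp x \<and> y \<noteq> x}. F y \<noteq> 0"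
    proof (rule ccontr)
      assume "\<not> ?thesis"
      then have "sum F {y \<in> X. \<exists>x\<in>N c. grp y = grp x \<and> y \<noteq> x} = 0" by (intro sum.neutral) blast
      then show False using F(2) c by fastforce
    qed
    then obtain x y where xy: "y \<in> X" "F y \<noteq> 0" "x \<in> N c" "grp y = grp x" "y \<noteq> x" by blast
    \<comment> \<open>Otherwise \<open>x\<close> and \<open>y\<close> would both carry weight in one
      group.\<close>
    have "a (grp x) \<noteq> x"
    proof
      assume ax: "a (grp x) = x"
      have xX: "x \<in> X" using N[OF c] xy by blast
      then have "F x \<ge> 1" using a[of "grp x"] ax by auto
      then have "2 \<le> sum F {x, y}" using xy by auto
      also have "\<dots> \<le> sum F {z \<in> X. grp z = grp x}"
        by (rule sum_mono2) (use fin xX xy in auto)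
      finally show False using one[of "grp x"] xX by auto
    qed
    then show ?thesis using xy by blast
  qed
  then show ?R using a by blast
next
  assume ?R
  then obtain a where a: "\<And>g. g \<in> grp ` X \<Longrightarrow> a g \<in> X \<and> grp (a g) = g"
    and aN: "\<And>c. c \<in> C \<Longrightarrow> \<exists>x\<in>N c. a (grp x) \<noteq> x" by blast
  define F where "F x = (if a (grp x) = x then 1 else 0 :: nat)" for x
  have one: "sum F {x \<in> X. grp x = g} = 1" if g: "g \<in> grp ` X" for g
  proof -
    have "sum F {x \<in> X. grp x = g} = sum F {a g}"
      by (rule sum.mono_neutral_right) (use a[OF g] fin in \<open>auto simp: F_def\<close>)
    then show ?thesis using a[OF g] by (simp add: F_def)
  qed
  then have tot: "sum F X = card (grp ` X)" using sum.image_gen[OF fin, of F grp] by simp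
  have "1 \<le> sum F {y \<in> X. \<exists>x\<in>N c. grp y = grp x \<and> y \<noteq> x}" if c: "c \<in> C" for c
  proof -
    obtain x where x: "x \<in> N c" "a (grp x) \<noteq> x" using aN[OF c] by blast
    have "x \<in> X" using N[OF c] x by blast
    then have ag: "a (grp x) \<in> X" "grp (a (grp x)) = grp x" using a by auto
    have "F (a (grp x)) \<le> sum F {y \<in> X. \<exists>x\<in>N c. grp y = grp x \<and> y \<noteq> x}"
      by (rule member_le_sum) (use ag x fin in auto)
    then show ?thesis using ag by (simp add: F_def)
  qed
  moreover have "F x \<le> 1" for x by (simp add: F_def)
  ultimately show ?L using one tot by (intro exI[of _ F]) auto
qed

section \<open>Computation tableaux\<close>

text \<open>State 1 has no transitions of its own; letting it idle pads every accepting computation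
  to length exactly \<open>T\<close>.\<close>

definition extended_trans :: "tm \<Rightarrow> (nat \<times> nat list \<times> nat \<times> (nat \<times> move) list) set" where
  "extended_trans M = tm_trans M \<union> {(1, rs, 1, map (\<lambda>r. (r, MStay)) rs) | rs.
     length rs = tm_tapes M \<and> set rs \<subseteq> {..<tm_symbols M}}"

fun displacement :: "move \<Rightarrow> int" where
  "displacement MLeft = -1"
| "displacement MStay = 0"
| "displacement MRight = 1"

lemma move_head_eq: "move_head m h = h + displacement m"
  by (cases m) auto

text \<open>What a head sees on a tape carrying the marks 1, 2, 3 at the cells -1, 0, 1.\<close>

definition win :: "int \<Rightarrow> nat" where
  "win j = (if j = -1 then 1 else if j = 0 then 2 else if j = 1 then 3 else 0)"

lemma win_eq_2 [simp]: "win j = 2 \<longleftrightarrow> j = 0"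
  by (auto simp: win_def)

lemma win_eq_iff: "k = -1 \<or> k = 0 \<or> k = 1 \<Longrightarrow> win j = win k \<longleftrightarrow> j = k"
  by (auto simp: win_def)

lemma displacement_cases: "displacement m = -1 \<or> displacement m = 0 \<or> displacement m = 1"
  by (cases m) auto

text \<open>The tableau of a computation of length \<open>T\<close> has rows \<open>\<tau> \<le> T\<close> and columns \<open>z \<le> 2T\<close>. Group 0 at
  \<open>(\<tau>, T)\<close> is the transition applied at time \<open>\<tau>\<close>; group \<open>i + 1\<close> at \<open>(\<tau>, z)\<close> is the symbol on tape
  \<open>i\<close> at distance \<open>z - T\<close> from the head, so that heads never move and tapes do. A clause forbids a
  set of literals, each placed relative to the clause or in the central column.\<close>

datatype place = Rel int | Central

text \<open>The arguments name the offending values: a symbol that is wrong on tape \<open>i\<close>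
  at the start, a transition that is wrong at the start or at the end, a transition with a scanned
  symbol it does not expect, two transitions that cannot follow each other, a transition with an old
  and a new symbol that do not match.\<close>

datatype clause =
    CInit nat nat | CStart nat | CEnd nat | CRead nat nat nat | CState nat nat | CMove nat nat nat nat

datatype kind = KUniv | KVal nat nat | KGroup nat | KClause clause

type_synonym obs = "nat \<times> nat \<times> nat \<times> nat \<times> nat \<times> nat"

text \<open>All that the activity of a clause may depend on at \<open>(\<tau>, z)\<close>. Every
  component is what a single head sees, the form in which the emitting machine will have the
  information.\<close>

definition observe :: "bool list \<Rightarrow> nat \<Rightarrow> nat \<Rightarrow> nat \<Rightarrow> obs" where
  "observe x T \<tau> z = (win (int \<tau>), win (int \<tau> - int T), win (int z), win (int z - int T),
     win (int z - 2 * int T), word_tape x (int z - int T))"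

locale tableau =
  fixes M :: tm
  assumes M: "turing_machine M"
begin

abbreviation "K \<equiv> tm_tapes M"
abbreviation "S \<equiv> tm_symbols M"

definition trl :: "(nat \<times> nat list \<times> nat \<times> (nat \<times> move) list) list" where
  "trl = (SOME l. set l = extended_trans M)"

lemma extended_trans_wf:
  assumes "(q, rs, q', as) \<in> extended_trans M"
  shows "q < tm_states M" "q' < tm_states M" "length rs = K" "set rs \<subseteq> {..<S}"
    "length as = K" "fst ` set as \<subseteq> {..<S}"
  using assms M unfolding extended_trans_def turing_machine_def by fastforce+

lemma finite_extended_trans: "finite (extended_trans M)"
proof -
  have mv: "finite (UNIV :: move set)"
  proof -
    have "(UNIV :: move set) \<subseteq> {MLeft, MStay, MRight}" using move.exhaust by auto
    then show ?thesis using finite_subset by blast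
  qed
  let ?A = "{as :: (nat \<times> move) list. set as \<subseteq> {..<S} \<times> UNIV \<and> length as = K}"
  let ?R = "{rs. set rs \<subseteq> {..<S} \<and> length rs = K}"
  have "extended_trans M \<subseteq> {..<tm_states M} \<times> ?R \<times> {..<tm_states M} \<times> ?A"
  proof
    fix tr assume tr: "tr \<in> extended_trans M"
    obtain q rs q' as where e: "tr = (q, rs, q', as)" by (cases tr)
    have "as \<in> ?A" using extended_trans_wf[OF tr[unfolded e]] by force
    then show "tr \<in> {..<tm_states M} \<times> ?R \<times> {..<tm_states M} \<times> ?A"
      using extended_trans_wf[OF tr[unfolded e]] by (simp add: e)
  qed
  moreover have "finite ({..<tm_states M} \<times> ?R \<times> {..<tm_states M} \<times> ?A)"
    using mv by (intro finite_cartesian_product finite_lists_length_eq) auto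
  ultimately show ?thesis using finite_subset by blast
qed

lemma set_trl: "set trl = extended_trans M"
  unfolding trl_def using finite_list[OF finite_extended_trans] by (rule someI_ex)

definition src :: "nat \<Rightarrow> nat" where "src a = fst (trl ! a)"
definition rds :: "nat \<Rightarrow> nat list" where "rds a = fst (snd (trl ! a))"
definition tgt :: "nat \<Rightarrow> nat" where "tgt a = fst (snd (snd (trl ! a)))"
definition acts :: "nat \<Rightarrow> (nat \<times> move) list" where "acts a = snd (snd (snd (trl ! a)))"

lemma trl_nth: "trl ! a = (src a, rds a, tgt a, acts a)"
  by (simp add: src_def rds_def tgt_def acts_def)

definition dom_size :: "nat \<Rightarrow> nat" where
  "dom_size g = (if g = 0 then length trl else S)"

definition dsp :: "nat \<Rightarrow> nat \<Rightarrow> int" where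
  "dsp a i = displacement (snd (acts a ! i))"

fun lits :: "clause \<Rightarrow> (nat \<times> place \<times> nat \<times> nat) list" where
  "lits (CInit i s) = [(0, Rel 0, Suc i, s)]"
| "lits (CStart a) = [(0, Central, 0, a)]"
| "lits (CEnd a) = [(0, Central, 0, a)]"
| "lits (CRead i a s) = [(0, Central, 0, a), (0, Central, Suc i, s)]"
| "lits (CState a b) = [(0, Central, 0, a), (1, Central, 0, b)]"
| "lits (CMove i a s s') = [(0, Central, 0, a), (0, Rel (dsp a i), Suc i, s), (1, Rel 0, Suc i, s')]"

text \<open>For \<open>CMove\<close>, the cell in column \<open>z\<close> after the step was in
  column \<open>z + dsp a i\<close> before, so it keeps \<open>s\<close> unless that column is
  \<open>T\<close>, where the head has just written. The tests on \<open>tT\<close>,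
  \<open>z0\<close> and \<open>z2\<close> switch a clause off when one of its literals would lie
  outside the tableau.\<close>

fun active :: "obs \<Rightarrow> clause \<Rightarrow> bool" where
  "active (t0, tT, z0, zT, z2, w) (CInit i s) \<longleftrightarrow> t0 = 2 \<and> s \<noteq> (if i = 0 then w else 0)"
| "active (t0, tT, z0, zT, z2, w) (CStart a) \<longleftrightarrow> t0 = 2 \<and> src a \<noteq> 0"
| "active (t0, tT, z0, zT, z2, w) (CEnd a) \<longleftrightarrow> tT = 2 \<and> src a \<noteq> 1"
| "active (t0, tT, z0, zT, z2, w) (CRead i a s) \<longleftrightarrow> rds a ! i \<noteq> s"
| "active (t0, tT, z0, zT, z2, w) (CState a b) \<longleftrightarrow> tT \<noteq> 2 \<and> tgt a \<noteq> src b"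
| "active (t0, tT, z0, zT, z2, w) (CMove i a s s') \<longleftrightarrow> tT \<noteq> 2 \<and>
     (dsp a i = -1 \<longrightarrow> z0 \<noteq> 2) \<and> (dsp a i = 1 \<longrightarrow> z2 \<noteq> 2) \<and>
     s' \<noteq> (if zT = win (- dsp a i) then fst (acts a ! i) else s)"

fun valid_clause :: "clause \<Rightarrow> bool" where
  "valid_clause (CInit i s) \<longleftrightarrow> i < K \<and> s < S"
| "valid_clause (CStart a) \<longleftrightarrow> a < length trl"
| "valid_clause (CEnd a) \<longleftrightarrow> a < length trl"
| "valid_clause (CRead i a s) \<longleftrightarrow> i < K \<and> a < length trl \<and> s < S"
| "valid_clause (CState a b) \<longleftrightarrow> a < length trl \<and> b < length trl"
| "valid_clause (CMove i a s s') \<longleftrightarrow> i < K \<and> a < length trl \<and> s < S \<and> s' < S"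

text \<open>Truncation by \<open>nat\<close> never affects an active clause: a literal one column to
  the left is switched off in column 0.\<close>

definition column :: "nat \<Rightarrow> nat \<Rightarrow> place \<Rightarrow> nat" where
  "column T z p = (case p of Rel d \<Rightarrow> nat (int z + d) | Central \<Rightarrow> T)"

definition solves :: "bool list \<Rightarrow> nat \<Rightarrow> (nat \<Rightarrow> nat \<Rightarrow> nat \<Rightarrow> nat) \<Rightarrow> bool" where
  "solves x T V \<longleftrightarrow>
     (\<forall>\<tau>\<le>T. \<forall>z\<le>2 * T. \<forall>g\<le>K. V \<tau> z g < dom_size g) \<and>
     (\<forall>\<tau>\<le>T. \<forall>z\<le>2 * T. \<forall>c. valid_clause c \<longrightarrow> active (observe x T \<tau> z) c \<longrightarrow>
        (\<exists>(dt, p, g, v)\<in>set (lits c). V (\<tau> + dt) (column T z p) g \<noteq> v))"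

section \<open>Accepting computations as solutions of the tableau\<close>

lemma initial_config:
  "fst (tm_init M x) = 0" "length (snd (tm_init M x)) = K"
  "i < K \<Longrightarrow> snd (tm_init M x) ! i = (word_tape (if i = 0 then x else []), 0)"
  using M by (auto simp: tm_init_def turing_machine_def nth_Cons split: nat.splits)

lemma act_tape_eq: "act_tape a t = ((fst t)(snd t := fst a), snd t + displacement (snd a))"
  by (cases a; cases t) (simp add: move_head_eq)

lemma read_tape_eq: "read_tape t = fst t (snd t)"
  by (cases t) simp

lemma accepts_if_solves:
  assumes "solves x T V"
  shows "accepts_within M x T"
proof -
  have V: "V \<tau> z g < dom_size g" if "\<tau> \<le> T" "z \<le> 2 * T" "g \<le> K" for \<tau> z g
    using assms that by (auto simp: solves_def)
  have cl: "\<exists>(dt, p, g, v)\<in>set (lits c). V (\<tau> + dt) (column T z p) g \<noteq> v"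
    if "\<tau> \<le> T" "z \<le> 2 * T" "valid_clause c" "active (observe x T \<tau> z) c" for \<tau> z c
    using assms that unfolding solves_def by blast
  define A where "A \<tau> = V \<tau> T 0" for \<tau>
  have A: "A \<tau> < length trl" if "\<tau> \<le> T" for \<tau>
    using V[of \<tau> T 0] that by (simp add: A_def dom_size_def)
  have trA: "(src (A \<tau>), rds (A \<tau>), tgt (A \<tau>), acts (A \<tau>)) \<in> extended_trans M" if "\<tau> \<le> T" for \<tau>
    using A[OF that] set_trl trl_nth by (metis nth_mem)
  have VS: "V \<tau> z (Suc i) < S" if "\<tau> \<le> T" "z \<le> 2 * T" "i < K" for \<tau> z i
    using V[of \<tau> z "Suc i"] that by (simp add: dom_size_def)
  \<comment> \<open>Here and below a clause is instantiated with the values that \<open>V\<close>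
    takes, so all its literals hold and it cannot be active.\<close>
  have start: "src (A 0) = 0"
    using cl[of 0 T "CStart (A 0)"] A[of 0] by (auto simp: observe_def column_def A_def)
  have final: "src (A T) = 1"
    using cl[of T T "CEnd (A T)"] A[of T] by (auto simp: observe_def column_def A_def)
  have init: "V 0 z (Suc i) = (if i = 0 then word_tape x (int z - int T) else 0)" if "z \<le> 2 * T" "i < K" for z i
  proof (rule ccontr)
    assume "\<not> ?thesis"
    then show False
      using cl[of 0 z "CInit i (V 0 z (Suc i))"] VS[of 0 z i] that
      by (auto simp: observe_def column_def split: if_splits)
  qed
  have read: "V \<tau> T (Suc i) = rds (A \<tau>) ! i" if "\<tau> \<le> T" "i < K" for \<tau> i
    using cl[of \<tau> T "CRead i (A \<tau>) (V \<tau> T (Suc i))"] VS[of \<tau> T i] A[of \<tau>] that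
    by (fastforce simp: observe_def column_def A_def)
  have state: "src (A (Suc \<tau>)) = tgt (A \<tau>)" if "\<tau> < T" for \<tau>
    using cl[of \<tau> T "CState (A \<tau>) (A (Suc \<tau>))"] A[of \<tau>] A[of "Suc \<tau>"] that
    by (fastforce simp: observe_def column_def A_def)
  have move: "V (Suc \<tau>) z (Suc i) =
      (if int z + dsp (A \<tau>) i = int T then fst (acts (A \<tau>) ! i) else V \<tau> (nat (int z + dsp (A \<tau>) i)) (Suc i))"
    if \<tau>: "\<tau> < T" and z: "z \<le> 2 * T" "0 \<le> int z + dsp (A \<tau>) i" "int z + dsp (A \<tau>) i \<le> 2 * int T" and i: "i < K" for \<tau> z i
  proof (rule ccontr)
    let ?d = "dsp (A \<tau>) i" and ?z = "nat (int z + dsp (A \<tau>) i)"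
    assume neq: "\<not> ?thesis"
    have d: "?d = -1 \<or> ?d = 0 \<or> ?d = 1" using displacement_cases by (simp add: dsp_def)
    have w: "win (int z - int T) = win (- ?d) \<longleftrightarrow> int z + ?d = int T"
      using d by (subst win_eq_iff) auto
    have z': "?z \<le> 2 * T" using z by linarith
    have "\<exists>(dt, p, g, v)\<in>set (lits (CMove i (A \<tau>) (V \<tau> ?z (Suc i)) (V (Suc \<tau>) z (Suc i)))).
        V (\<tau> + dt) (column T z p) g \<noteq> v"
    proof (rule cl)
      show "active (observe x T \<tau> z) (CMove i (A \<tau>) (V \<tau> ?z (Suc i)) (V (Suc \<tau>) z (Suc i)))"
        using \<tau> z neq by (auto simp: observe_def w)
    qed (use \<tau> z i A[of \<tau>] VS[of \<tau> ?z i] VS[of "Suc \<tau>" z i] z' in auto)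
    then show False by (auto simp: column_def A_def)
  qed
  \<comment> \<open>The tableau is trusted only in a shrinking cone: a column depends on itself or a
    neighbour one step earlier, and switched-off clauses can leave the outermost columns open. With
    \<open>T\<close> columns on either side at the start, the head column is still correct at time
    \<open>T\<close>.\<close>
  let ?ok = "\<lambda>\<tau> c. fst c = src (A \<tau>) \<and> length (snd c) = K \<and>
    (\<forall>i<K. \<forall>z::nat. \<bar>int z - int T\<bar> \<le> int T - int \<tau> \<longrightarrow>
       V \<tau> z (Suc i) = fst (snd c ! i) (snd (snd c ! i) + int z - int T))"
  \<comment> \<open>Idling transitions fill rows without machine steps, hence
    \<open>n \<le> \<tau>\<close> instead of equality.\<close>
  have run: "\<tau> \<le> T \<Longrightarrow> \<exists>c. ?ok \<tau> c \<and> (\<exists>n\<le>\<tau>. (tm_step M ^^ n) (tm_init M x) c)" for \<tau>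
  proof (induction \<tau>)
    case 0
    have "?ok 0 (tm_init M x)"
      using start initial_config init M by (auto simp: word_tape_def)
    then show ?case by (intro exI[of _ "tm_init M x"]) auto
  next
    case (Suc \<tau>)
    then have "\<exists>c. ?ok \<tau> c \<and> (\<exists>n\<le>\<tau>. (tm_step M ^^ n) (tm_init M x) c)" by simp
    then obtain c n where c: "?ok \<tau> c" and n: "n \<le> \<tau>" "(tm_step M ^^ n) (tm_init M x) c" by blast
    define c' where "c' = (tgt (A \<tau>), map2 act_tape (acts (A \<tau>)) (snd c))"
    have tr: "(src (A \<tau>), rds (A \<tau>), tgt (A \<tau>), acts (A \<tau>)) \<in> extended_trans M"
      using trA Suc.prems by simp
    note wf = extended_trans_wf[OF tr]
    have rd: "map read_tape (snd c) = rds (A \<tau>)"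
    proof (rule nth_equalityI)
      fix i assume "i < length (map read_tape (snd c))"
      then have i: "i < K" using c by simp
      have "V \<tau> T (Suc i) = fst (snd c ! i) (snd (snd c ! i) + int T - int T)"
        using c i Suc.prems by (auto simp del: add_diff_cancel_right')
      then show "map read_tape (snd c) ! i = rds (A \<tau>) ! i"
        using read[of \<tau> i] i c Suc.prems by (simp add: read_tape_eq)
    qed (use c wf in simp)
    have ok': "?ok (Suc \<tau>) c'"
    proof (intro conjI allI impI)
      show "fst c' = src (A (Suc \<tau>))" using state[of \<tau>] Suc.prems by (simp add: c'_def)
      show "length (snd c') = K" using c wf by (simp add: c'_def)
      fix i z assume i: "i < K" and z: "\<bar>int z - int T\<bar> \<le> int T - int (Suc \<tau>)"
      let ?d = "dsp (A \<tau>) i" and ?t = "fst (snd c ! i)" and ?h = "snd (snd c ! i)"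
      have d: "?d = -1 \<or> ?d = 0 \<or> ?d = 1" using displacement_cases by (simp add: dsp_def)
      have t': "snd c' ! i = (?t(?h := fst (acts (A \<tau>) ! i)), ?h + ?d)"
        using i c wf by (simp add: c'_def act_tape_eq dsp_def)
      have 1: "V (Suc \<tau>) z (Suc i) =
        (if int z + ?d = int T then fst (acts (A \<tau>) ! i) else V \<tau> (nat (int z + ?d)) (Suc i))"
        by (rule move) (use Suc.prems z d i in auto)
      have nn: "0 \<le> int z + ?d" "\<bar>int z + ?d - int T\<bar> \<le> int T - int \<tau>" using z d Suc.prems by auto
      then have "V \<tau> (nat (int z + ?d)) (Suc i) = ?t (?h + int (nat (int z + ?d)) - int T)"
        using c i by auto
      then have 2: "V \<tau> (nat (int z + ?d)) (Suc i) = ?t (?h + ?d + int z - int T)"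
        using nn by (simp add: algebra_simps)
      show "V (Suc \<tau>) z (Suc i) = fst (snd c' ! i) (snd (snd c' ! i) + int z - int T)"
        unfolding 1 2 t' by (auto simp: algebra_simps)
    qed
    show ?case
    proof (cases "(src (A \<tau>), rds (A \<tau>), tgt (A \<tau>), acts (A \<tau>)) \<in> tm_trans M")
      case True
      then have "tm_step M c c'" unfolding tm_step_def c'_def using c rd by auto
      then have "(tm_step M ^^ Suc n) (tm_init M x) c'" using n by (auto intro: relpowp_Suc_I)
      then show ?thesis using ok' n by (intro exI[of _ c'] conjI exI[of _ "Suc n"]) auto
    next
      case False
      then have id: "src (A \<tau>) = 1" "tgt (A \<tau>) = 1" "acts (A \<tau>) = map (\<lambda>r. (r, MStay)) (rds (A \<tau>))"
        using tr by (auto simp: extended_trans_def)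
      have "map2 act_tape (acts (A \<tau>)) (snd c) = snd c"
        unfolding id rd[symmetric]
        by (rule nth_equalityI) (auto simp: act_tape_eq read_tape_eq)
      then have "c' = c" using c id by (simp add: c'_def prod_eq_iff)
      then show ?thesis using ok' n by (intro exI[of _ c'] conjI exI[of _ n]) auto
    qed
  qed
  from run[of T] final obtain c n where "fst c = 1" "n \<le> T" "(tm_step M ^^ n) (tm_init M x) c" by auto
  then show ?thesis unfolding accepts_within_def by (metis prod.collapse)
qed

text \<open>The tableau is cut out of the configurations of an accepting run, frozen in state 1 once
  it has halted. Since the tapes are infinite both ways, the outermost columns hold true symbols
  too.\<close>

lemma solves_if_accepts:
  assumes "accepts_within M x T"
  shows "\<exists>V. solves x T V"
proof -
  obtain n ts where n: "n \<le> T" "(tm_step M ^^ n) (tm_init M x) (1, ts)"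
    using assms unfolding accepts_within_def by blast
  then obtain f where f: "f 0 = tm_init M x" "f n = (1, ts)" "\<And>i. i < n \<Longrightarrow> tm_step M (f i) (f (Suc i))"
    unfolding relpowp_fun_conv by blast
  define C where "C \<tau> = f (min \<tau> n)" for \<tau>
  have wfC: "length (snd (C \<tau>)) = K \<and> (\<forall>i<K. \<forall>j. fst (snd (C \<tau>) ! i) j < S)" for \<tau>
  proof (induction \<tau>)
    case 0
    then show ?case using M by (auto simp: C_def f initial_config word_tape_def turing_machine_def)
  next
    case (Suc \<tau>)
    show ?case
    proof (cases "\<tau> < n")
      case True
      then have "tm_step M (C \<tau>) (C (Suc \<tau>))" using f(3)[of \<tau>] by (simp add: C_def)
      then obtain q' as where tr: "(fst (C \<tau>), map read_tape (snd (C \<tau>)), q', as) \<in> tm_trans M"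
        and C': "C (Suc \<tau>) = (q', map2 act_tape as (snd (C \<tau>)))" unfolding tm_step_def by blast
      have wf: "length as = K" "fst ` set as \<subseteq> {..<S}"
        using extended_trans_wf(5,6)[of "fst (C \<tau>)" "map read_tape (snd (C \<tau>))" q' as] tr
        by (auto simp: extended_trans_def)
      have "fst (as ! i) < S" if "i < K" for i using wf that by (auto simp: image_subset_iff)
      then show ?thesis using Suc.IH wf by (auto simp: C' act_tape_eq)
    next
      case False
      then have "C (Suc \<tau>) = C \<tau>" by (simp add: C_def)
      then show ?thesis using Suc.IH by simp
    qed
  qed
  \<comment> \<open>Group 0 needs a transition at every time, also at \<open>T\<close>; after the
    run has halted it is the idling of state 1.\<close>
  have "\<exists>a<length trl. src a = fst (C \<tau>) \<and> rds a = map read_tape (snd (C \<tau>)) \<and>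
    C (Suc \<tau>) = (tgt a, map2 act_tape (acts a) (snd (C \<tau>)))" for \<tau>
  proof -
    have "\<exists>q' as. (fst (C \<tau>), map read_tape (snd (C \<tau>)), q', as) \<in> extended_trans M \<and>
      C (Suc \<tau>) = (q', map2 act_tape as (snd (C \<tau>)))"
    proof (cases "\<tau> < n")
      case True
      then have "tm_step M (C \<tau>) (C (Suc \<tau>))" using f(3)[of \<tau>] by (simp add: C_def)
      then show ?thesis unfolding tm_step_def extended_trans_def by blast
    next
      case False
      then have C: "C \<tau> = (1, ts)" "C (Suc \<tau>) = (1, ts)" using f(2) by (auto simp: C_def min_def)
      let ?rs = "map read_tape ts"
      have len: "length ?rs = K" and sym: "\<And>i j. i < K \<Longrightarrow> fst (ts ! i) j < S"
        using wfC[of \<tau>] by (auto simp: C)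
      have "set ?rs \<subseteq> {..<S}"
      proof
        fix r assume "r \<in> set ?rs"
        then obtain i where "i < K" "r = read_tape (ts ! i)" using len by (auto simp: in_set_conv_nth)
        then show "r \<in> {..<S}" using sym by (simp add: read_tape_eq)
      qed
      with len have "(1, ?rs, 1, map (\<lambda>r. (r, MStay)) ?rs) \<in> extended_trans M"
        unfolding extended_trans_def by blast
      moreover have "map2 act_tape (map (\<lambda>r. (r, MStay)) ?rs) ts = ts"
        by (rule nth_equalityI) (auto simp: act_tape_eq read_tape_eq)
      ultimately show ?thesis unfolding C by (intro exI[of _ 1] exI[of _ "map (\<lambda>r. (r, MStay)) ?rs"]) simp
    qed
    then obtain q' as where "(fst (C \<tau>), map read_tape (snd (C \<tau>)), q', as) \<in> set trl"
      "C (Suc \<tau>) = (q', map2 act_tape as (snd (C \<tau>)))" using set_trl by auto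
    then show ?thesis unfolding in_set_conv_nth by (auto simp: src_def rds_def tgt_def acts_def)
  qed
  then obtain A where A: "\<And>\<tau>. A \<tau> < length trl" "\<And>\<tau>. src (A \<tau>) = fst (C \<tau>)"
    "\<And>\<tau>. rds (A \<tau>) = map read_tape (snd (C \<tau>))"
    "\<And>\<tau>. C (Suc \<tau>) = (tgt (A \<tau>), map2 act_tape (acts (A \<tau>)) (snd (C \<tau>)))" by metis
  have lenacts: "length (acts (A \<tau>)) = K" for \<tau>
    using extended_trans_wf(5)[of "src (A \<tau>)" "rds (A \<tau>)" "tgt (A \<tau>)" "acts (A \<tau>)"] A(1)[of \<tau>] set_trl trl_nth
    by (metis nth_mem)
  define V where "V \<tau> z g = (if g = 0 then A \<tau> else fst (snd (C \<tau>) ! (g - 1)) (snd (snd (C \<tau>) ! (g - 1)) + int z - int T))" for \<tau> z g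
  have V0 [simp]: "V \<tau> z 0 = A \<tau>" for \<tau> z by (simp add: V_def)
  have VS: "V \<tau> z (Suc i) = fst (snd (C \<tau>) ! i) (snd (snd (C \<tau>) ! i) + int z - int T)" for \<tau> z i
    by (simp add: V_def)
  have C0: "C 0 = tm_init M x" by (simp add: C_def f)
  have "\<exists>(dt, p, g, v)\<in>set (lits c). V (\<tau> + dt) (column T z p) g \<noteq> v"
    if \<tau>: "\<tau> \<le> T" and z: "z \<le> 2 * T" and c: "valid_clause c" and act: "active (observe x T \<tau> z) c" for \<tau> z c
  proof (cases c)
    case (CInit i s)
    then have "V 0 z (Suc i) \<noteq> s" "\<tau> = 0"
      using act c initial_config(3)[of i x] by (auto simp: VS C0 observe_def word_tape_def)
    then show ?thesis by (simp add: CInit column_def)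
  next
    case (CStart a)
    then have "A 0 \<noteq> a" "\<tau> = 0" using act A(2)[of 0] by (auto simp: observe_def C0 initial_config)
    then show ?thesis by (simp add: CStart)
  next
    case (CEnd a)
    have "fst (C T) = 1" using n f(2) by (simp add: C_def min_def)
    then have "A T \<noteq> a" "\<tau> = T" using act A(2)[of T] CEnd by (auto simp: observe_def)
    then show ?thesis by (simp add: CEnd)
  next
    case (CRead i a s)
    have "V \<tau> T (Suc i) = rds (A \<tau>) ! i" using c wfC[of \<tau>] by (simp add: CRead A(3) VS read_tape_eq)
    then have "A \<tau> \<noteq> a \<or> V \<tau> T (Suc i) \<noteq> s" using act by (auto simp: CRead observe_def)
    then show ?thesis by (auto simp: CRead column_def)
  next
    case (CState a b)
    have "src (A (Suc \<tau>)) = tgt (A \<tau>)" using A(2)[of "Suc \<tau>"] A(4)[of \<tau>] by simp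
    then have "A \<tau> \<noteq> a \<or> A (Suc \<tau>) \<noteq> b" using act by (auto simp: CState observe_def)
    then show ?thesis by (auto simp: CState)
  next
    case (CMove i a s s')
    let ?d = "dsp a i" and ?t = "fst (snd (C \<tau>) ! i)" and ?h = "snd (snd (C \<tau>) ! i)"
    have i: "i < K" using c by (simp add: CMove)
    have d: "?d = -1 \<or> ?d = 0 \<or> ?d = 1" using displacement_cases by (simp add: dsp_def)
    have w: "win (int z - int T) = win (- ?d) \<longleftrightarrow> int z + ?d = int T"
      using d by (subst win_eq_iff) auto
    have nn: "0 \<le> int z + ?d" using act d by (auto simp: CMove observe_def)
    have "V (Suc \<tau>) z (Suc i) = (if int z + ?d = int T then fst (acts a ! i) else V \<tau> (nat (int z + ?d)) (Suc i))"
      if a: "A \<tau> = a"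
    proof -
      have t': "snd (C (Suc \<tau>)) ! i = (?t(?h := fst (acts a ! i)), ?h + ?d)"
        using i wfC[of \<tau>] lenacts[of \<tau>] by (simp add: A(4) act_tape_eq dsp_def a)
      show ?thesis unfolding VS t' using nn by (auto simp: algebra_simps)
    qed
    then have "A \<tau> \<noteq> a \<or> V \<tau> (nat (int z + ?d)) (Suc i) \<noteq> s \<or> V (Suc \<tau>) z (Suc i) \<noteq> s'"
      using act by (auto simp: CMove observe_def w split: if_splits)
    then show ?thesis by (auto simp: CMove column_def)
  qed
  moreover have "V \<tau> z g < dom_size g" if "g \<le> K" for \<tau> z g
    using A(1) wfC[of \<tau>] that by (cases g) (auto simp: dom_size_def VS)
  ultimately show ?thesis unfolding solves_def by blast
qed

theorem accepts_iff_solvable: "accepts_within M x T \<longleftrightarrow> (\<exists>V. solves x T V)"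
  using accepts_if_solves solves_if_accepts by blast

end

section \<open>From tableaux to packing and covering\<close>

text \<open>\<open>wz\<close> is the window on \<open>z' - z\<close> and \<open>wc\<close> the one
  on \<open>z' - T\<close>, so central literals are found without knowing how far the clause is from
  the center.\<close>

definition placed :: "place \<Rightarrow> nat \<Rightarrow> nat \<Rightarrow> bool" where
  "placed p wz wc = (case p of Rel d \<Rightarrow> wz = win d | Central \<Rightarrow> wc = 2)"

type_synonym vertex = "nat \<times> nat \<times> kind"

fun is_univ :: "vertex \<Rightarrow> bool" where
  "is_univ (\<tau>, z, \<kappa>) \<longleftrightarrow> \<kappa> = KUniv"

fun is_val :: "vertex \<Rightarrow> bool" where
  "is_val (\<tau>, z, KVal g a) \<longleftrightarrow> True"
| "is_val _ \<longleftrightarrow> False"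

fun group_of :: "vertex \<Rightarrow> nat \<times> nat \<times> nat" where
  "group_of (\<tau>, z, KVal g a) = (\<tau>, z, g)"
| "group_of (\<tau>, z, _) = (\<tau>, z, 0)"

context tableau
begin

text \<open>In the packing instances a clause is joined to its literals, in the covering instances
  (\<open>cov\<close>) to the literals that contradict one of its own.\<close>

fun incident :: "bool \<Rightarrow> obs \<Rightarrow> nat \<Rightarrow> nat \<Rightarrow> nat \<Rightarrow> kind \<Rightarrow> kind \<Rightarrow> bool" where
  "incident cov ob wt wz wc (KGroup g) (KVal g' a) \<longleftrightarrow> g = g' \<and> wt = 2 \<and> wz = 2"
| "incident cov ob wt wz wc (KClause c) (KVal g a) \<longleftrightarrow> active ob c \<and>
     (\<exists>(dt, p, g', a')\<in>set (lits c). wt = win (int dt) \<and> placed p wz wc \<and> g' = g \<and> (a = a') \<noteq> cov)"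
| "incident cov ob wt wz wc _ _ \<longleftrightarrow> False"

fun inc :: "bool \<Rightarrow> bool list \<Rightarrow> nat \<Rightarrow> vertex \<Rightarrow> vertex \<Rightarrow> bool" where
  "inc cov x T (\<tau>, z, \<kappa>) (\<tau>', z', \<kappa>') \<longleftrightarrow> incident cov (observe x T \<tau> z)
     (win (int \<tau>' - int \<tau>)) (win (int z' - int z)) (win (int z' - int T)) \<kappa> \<kappa>'"

fun valid_kind :: "kind \<Rightarrow> bool" where
  "valid_kind KUniv \<longleftrightarrow> True"
| "valid_kind (KVal g a) \<longleftrightarrow> g \<le> K \<and> a < dom_size g"
| "valid_kind (KGroup g) \<longleftrightarrow> g \<le> K"
| "valid_kind (KClause c) \<longleftrightarrow> valid_clause c"

text \<open>The kinds depend on the machine alone, so a program can unroll them, while times and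
  columns need loops.\<close>

definition ks :: "kind list" where
  "ks = (SOME l. distinct l \<and> set l = {\<kappa>. valid_kind \<kappa>})"

lemma finite_valid_clause: "finite {c. valid_clause c}"
proof -
  let ?n = "length trl"
  have "{c. valid_clause c} \<subseteq> (\<lambda>(i, s). CInit i s) ` ({..<K} \<times> {..<S}) \<union> CStart ` {..<?n} \<union> CEnd ` {..<?n}
    \<union> (\<lambda>(i, a, s). CRead i a s) ` ({..<K} \<times> {..<?n} \<times> {..<S}) \<union> (\<lambda>(a, b). CState a b) ` ({..<?n} \<times> {..<?n})
    \<union> (\<lambda>(i, a, s, s'). CMove i a s s') ` ({..<K} \<times> {..<?n} \<times> {..<S} \<times> {..<S})" (is "_ \<subseteq> ?R")
  proof
    fix c assume "c \<in> {c. valid_clause c}"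
    then show "c \<in> ?R" by (cases c) (auto simp: image_iff)
  qed
  then show ?thesis by (rule finite_subset) auto
qed

lemma set_ks: "set ks = {\<kappa>. valid_kind \<kappa>}" and distinct_ks: "distinct ks"
proof -
  have "{\<kappa>. valid_kind \<kappa>} \<subseteq> insert KUniv ((\<lambda>(g, a). KVal g a) ` ({..K} \<times> {..<length trl + S}) \<union>
    KGroup ` {..K} \<union> KClause ` {c. valid_clause c})" (is "_ \<subseteq> ?R")
  proof
    fix \<kappa> assume "\<kappa> \<in> {\<kappa>. valid_kind \<kappa>}"
    then show "\<kappa> \<in> ?R" by (cases \<kappa>) (auto simp: image_iff dom_size_def split: if_splits)
  qed
  then have "finite {\<kappa>. valid_kind \<kappa>}" by (rule finite_subset) (auto simp: finite_valid_clause)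
  then have "\<exists>l. distinct l \<and> set l = {\<kappa>. valid_kind \<kappa>}" using finite_distinct_list by blast
  from someI_ex[OF this] show "set ks = {\<kappa>. valid_kind \<kappa>}" "distinct ks" unfolding ks_def by auto
qed

text \<open>A full product, every kind at every position, so that nested loops over times and
  columns visit the vertices in order. Clauses out of place are present but inactive.\<close>

definition vlist :: "nat \<Rightarrow> vertex list" where
  "vlist T = List.product [0..<Suc T] (List.product [0..<2 * T + 1] ks)"

lemma in_vlist: "(\<tau>, z, \<kappa>) \<in> set (vlist T) \<longleftrightarrow> \<tau> \<le> T \<and> z \<le> 2 * T \<and> valid_kind \<kappa>"
  by (auto simp: vlist_def set_ks)

lemma map_vlist: "map f (vlist T) =
    concat (map (\<lambda>\<tau>. concat (map (\<lambda>z. map (\<lambda>\<kappa>. f (\<tau>, z, \<kappa>)) ks) [0..<2 * T + 1])) [0..<Suc T])"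
  by (simp only: vlist_def product_concat_map map_concat map_map comp_def)

lemma split_system_vlist: "split_system (vlist T) is_univ is_val"
proof
  show "distinct (vlist T)" by (simp add: vlist_def distinct_product distinct_ks)
  show "\<exists>v\<in>set (vlist T). is_univ v" by (rule bexI[of _ "(0, 0, KUniv)"]) (simp_all add: in_vlist)
  fix v show "\<not> (is_univ v \<and> is_val v)" by (cases v rule: is_val.cases) auto
qed

definition groups_number :: "nat \<Rightarrow> nat" where
  "groups_number T = Suc T * ((2 * T + 1) * Suc K)"

definition vals :: "nat \<Rightarrow> vertex set" where
  "vals T = {v \<in> set (vlist T). is_val v}"

lemma in_vals: "v \<in> vals T \<longleftrightarrow> (\<exists>\<tau> z g a. v = (\<tau>, z, KVal g a) \<and> \<tau> \<le> T \<and> z \<le> 2 * T \<and> g \<le> K \<and> a < dom_size g)"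
  by (cases v rule: is_val.cases) (auto simp: vals_def in_vlist)

text \<open>A group without alternatives would be missing from the count of groups; the idling
  transitions give group 0 one even if \<open>tm_trans M\<close> is empty.\<close>

lemma dom_size_pos: "dom_size g > 0"
proof -
  have S: "S > 0" using M by (simp add: turing_machine_def)
  then have "(1, replicate K 0, 1, map (\<lambda>r. (r, MStay)) (replicate K 0)) \<in> extended_trans M"
    unfolding extended_trans_def by auto
  then have "trl \<noteq> []" using set_trl by force
  then show ?thesis using S by (simp add: dom_size_def)
qed

lemma group_of_vals: "group_of ` vals T = {..T} \<times> {..2 * T} \<times> {..K}"
proof
  show "group_of ` vals T \<subseteq> {..T} \<times> {..2 * T} \<times> {..K}" by (auto simp: in_vals)
  show "{..T} \<times> {..2 * T} \<times> {..K} \<subseteq> group_of ` vals T"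
  proof
    fix y assume y: "y \<in> {..T} \<times> {..2 * T} \<times> {..K}"
    obtain \<tau> z g where e: "y = (\<tau>, z, g)" by (cases y)
    have "(\<tau>, z, KVal g 0) \<in> vals T" using y dom_size_pos by (auto simp: in_vals e)
    then show "y \<in> group_of ` vals T" by (force simp: e)
  qed
qed

lemma card_groups: "card (group_of ` vals T) = groups_number T"
  by (simp add: group_of_vals card_cartesian_product groups_number_def)

lemma finite_vals: "finite (vals T)"
  by (simp add: vals_def)

fun place_lit :: "nat \<Rightarrow> nat \<Rightarrow> nat \<Rightarrow> nat \<times> place \<times> nat \<times> nat \<Rightarrow> vertex" where
  "place_lit T \<tau> z (dt, p, g, v) = (\<tau> + dt, column T z p, KVal g v)"

lemma dsp_cases: "dsp a i = -1 \<or> dsp a i = 0 \<or> dsp a i = 1"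
  using displacement_cases by (simp add: dsp_def)

text \<open>The guards in \<open>active\<close> exist for this: they keep the literals of an active
  clause inside the tableau and within reach of the windows.\<close>

lemma lits_wf:
  assumes "valid_clause c" "active (observe x T \<tau> z) c" "\<tau> \<le> T" "z \<le> 2 * T" "(dt, p, g, v) \<in> set (lits c)"
  shows "\<tau> + dt \<le> T" "column T z p \<le> 2 * T" "g \<le> K" "v < dom_size g" "dt \<le> 1"
    "p = Rel d \<Longrightarrow> (d = -1 \<or> d = 0 \<or> d = 1) \<and> 0 \<le> int z + d"
proof -
  have *: "\<tau> + dt \<le> T \<and> column T z p \<le> 2 * T \<and> g \<le> K \<and> v < dom_size g \<and> dt \<le> 1 \<and>
    (\<forall>d. p = Rel d \<longrightarrow> (d = -1 \<or> d = 0 \<or> d = 1) \<and> 0 \<le> int z + d)"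
  proof (cases c)
    case (CMove i a s s')
    then show ?thesis using assms dsp_cases[of a i]
      by (auto simp: observe_def column_def dom_size_def)
  qed (use assms in \<open>auto simp: observe_def column_def dom_size_def\<close>)
  then show "\<tau> + dt \<le> T" "column T z p \<le> 2 * T" "g \<le> K" "v < dom_size g" "dt \<le> 1"
    "p = Rel d \<Longrightarrow> (d = -1 \<or> d = 0 \<or> d = 1) \<and> 0 \<le> int z + d" by auto
qed

text \<open>Windows tell apart only -1, 0 and 1, which is enough because a literal is at most one
  row away from its clause and either at most one column away or central.\<close>

lemma placed_iff:
  assumes "dt \<le> 1" "\<And>d. p = Rel d \<Longrightarrow> (d = -1 \<or> d = 0 \<or> d = 1) \<and> 0 \<le> int z + d"
  shows "win (int \<tau>' - int \<tau>) = win (int dt) \<and> placed p (win (int z' - int z)) (win (int z' - int T)) \<longleftrightarrow>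
    \<tau>' = \<tau> + dt \<and> z' = column T z p"
proof -
  have "win (int \<tau>' - int \<tau>) = win (int dt) \<longleftrightarrow> \<tau>' = \<tau> + dt"
    using assms(1) by (subst win_eq_iff) auto
  moreover have "placed p (win (int z' - int z)) (win (int z' - int T)) \<longleftrightarrow> z' = column T z p"
  proof (cases p)
    case (Rel d)
    then show ?thesis using assms(2)[OF Rel]
      by (simp add: placed_def column_def win_eq_iff[of d]) linarith
  qed (auto simp: placed_def column_def)
  ultimately show ?thesis by blast
qed

lemma inc_clause_iff:
  assumes "valid_clause c" "active (observe x T \<tau> z) c" "\<tau> \<le> T" "z \<le> 2 * T"
  shows "inc cov x T (\<tau>, z, KClause c) (\<tau>', z', KVal g a) \<longleftrightarrow>
    (\<exists>(dt, p, g', a')\<in>set (lits c). \<tau>' = \<tau> + dt \<and> z' = column T z p \<and> g' = g \<and> (a = a') \<noteq> cov)"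
proof -
  have "win (int \<tau>' - int \<tau>) = win (int dt) \<and> placed p (win (int z' - int z)) (win (int z' - int T)) \<longleftrightarrow>
    \<tau>' = \<tau> + dt \<and> z' = column T z p" if "(dt, p, g', a') \<in> set (lits c)" for dt p g' a'
    by (rule placed_iff) (use lits_wf[OF assms that] in blast)+
  then show ?thesis using assms(2) by (simp only: inc.simps incident.simps) blast
qed

lemma packing_scope:
  assumes "valid_clause c" "active (observe x T \<tau> z) c" "\<tau> \<le> T" "z \<le> 2 * T"
  shows "{v \<in> vals T. inc False x T (\<tau>, z, KClause c) v} = place_lit T \<tau> z ` set (lits c)"
proof (intro set_eqI iffI)
  fix v assume v: "v \<in> {v \<in> vals T. inc False x T (\<tau>, z, KClause c) v}"
  then obtain \<tau>' z' g a where e: "v = (\<tau>', z', KVal g a)" by (auto simp: in_vals)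
  have "inc False x T (\<tau>, z, KClause c) (\<tau>', z', KVal g a)" using v e by blast
  then show "v \<in> place_lit T \<tau> z ` set (lits c)"
    unfolding inc_clause_iff[OF assms] e by (force simp: image_iff)
next
  fix v assume "v \<in> place_lit T \<tau> z ` set (lits c)"
  then obtain dt p g a where l: "(dt, p, g, a) \<in> set (lits c)" and e: "v = (\<tau> + dt, column T z p, KVal g a)"
    by auto
  have "inc False x T (\<tau>, z, KClause c) v" unfolding e inc_clause_iff[OF assms] using l by force
  moreover have "v \<in> vals T" using lits_wf[OF assms l] by (simp add: in_vals e)
  ultimately show "v \<in> {v \<in> vals T. inc False x T (\<tau>, z, KClause c) v}" by blast
qed

lemma covering_scope:
  assumes "valid_clause c" "active (observe x T \<tau> z) c" "\<tau> \<le> T" "z \<le> 2 * T"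
  shows "{v \<in> vals T. inc True x T (\<tau>, z, KClause c) v} =
    {v \<in> vals T. \<exists>w\<in>place_lit T \<tau> z ` set (lits c). group_of v = group_of w \<and> v \<noteq> w}"
proof -
  have "inc True x T (\<tau>, z, KClause c) v \<longleftrightarrow>
    (\<exists>w\<in>place_lit T \<tau> z ` set (lits c). group_of v = group_of w \<and> v \<noteq> w)" if v: "v \<in> vals T" for v
  proof -
    obtain \<tau>' z' g a where e: "v = (\<tau>', z', KVal g a)" using v by (auto simp: in_vals)
    show ?thesis unfolding e inc_clause_iff[OF assms] by force
  qed
  then show ?thesis by blast
qed

text \<open>A clause bound is one less than the length of the list of literals, so two literals must
  not fall on the same vertex; they differ in group or in time.\<close>

lemma card_place_lit: "card (place_lit T \<tau> z ` set (lits c)) = length (lits c)"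
proof (cases c)
  case (CMove i a s s')
  then show ?thesis by (auto simp: card_insert_if)
qed (auto simp: card_insert_if)

definition active_clauses :: "bool list \<Rightarrow> nat \<Rightarrow> (nat \<times> nat \<times> clause) set" where
  "active_clauses x T = {(\<tau>, z, c). \<tau> \<le> T \<and> z \<le> 2 * T \<and> valid_clause c \<and> active (observe x T \<tau> z) c}"

fun clause_lits :: "nat \<Rightarrow> nat \<times> nat \<times> clause \<Rightarrow> vertex set" where
  "clause_lits T (\<tau>, z, c) = place_lit T \<tau> z ` set (lits c)"

lemma clause_lits_subset: "c \<in> active_clauses x T \<Longrightarrow> clause_lits T c \<subseteq> vals T"
  using packing_scope by (fastforce simp: active_clauses_def)

lemma choice_iff_solvable:
  "(\<exists>a. (\<forall>g\<in>group_of ` vals T. a g \<in> vals T \<and> group_of (a g) = g) \<and>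
     (\<forall>c\<in>active_clauses x T. \<exists>v\<in>clause_lits T c. a (group_of v) \<noteq> v)) \<longleftrightarrow> (\<exists>V. solves x T V)"
    (is "?L \<longleftrightarrow> ?R")
proof
  assume ?L
  then obtain a where a: "\<And>g. g \<in> group_of ` vals T \<Longrightarrow> a g \<in> vals T \<and> group_of (a g) = g"
    and cl: "\<And>c. c \<in> active_clauses x T \<Longrightarrow> \<exists>v\<in>clause_lits T c. a (group_of v) \<noteq> v" by blast
  have "\<exists>v. a (\<tau>, z, g) = (\<tau>, z, KVal g v) \<and> v < dom_size g" if "\<tau> \<le> T" "z \<le> 2 * T" "g \<le> K" for \<tau> z g
    using a[of "(\<tau>, z, g)"] that unfolding group_of_vals by (auto simp: in_vals)
  then obtain V where V: "\<And>\<tau> z g. \<tau> \<le> T \<Longrightarrow> z \<le> 2 * T \<Longrightarrow> g \<le> K \<Longrightarrow>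
      a (\<tau>, z, g) = (\<tau>, z, KVal g (V \<tau> z g)) \<and> V \<tau> z g < dom_size g" by metis
  have "\<exists>(dt, p, g, v)\<in>set (lits c). V (\<tau> + dt) (column T z p) g \<noteq> v"
    if c: "valid_clause c" "active (observe x T \<tau> z) c" "\<tau> \<le> T" "z \<le> 2 * T" for \<tau> z c
  proof -
    have "(\<tau>, z, c) \<in> active_clauses x T" using c by (simp add: active_clauses_def)
    from cl[OF this] obtain w where w: "w \<in> place_lit T \<tau> z ` set (lits c)" "a (group_of w) \<noteq> w"
      unfolding clause_lits.simps by blast
    then obtain dt p g v where l: "(dt, p, g, v) \<in> set (lits c)" and e: "w = (\<tau> + dt, column T z p, KVal g v)"
      by auto
    have "V (\<tau> + dt) (column T z p) g \<noteq> v"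
      using w(2) V lits_wf[OF c l] by (auto simp: e)
    then show ?thesis using l by blast
  qed
  then show ?R unfolding solves_def using V by blast
next
  assume ?R
  then obtain V where V: "solves x T V" by blast
  define a where "a = (\<lambda>(\<tau>, z, g). (\<tau>, z, KVal g (V \<tau> z g)))"
  have "a g \<in> vals T \<and> group_of (a g) = g" if "g \<in> group_of ` vals T" for g
    using that V unfolding group_of_vals by (auto simp: a_def in_vals solves_def)
  moreover have "\<exists>v\<in>clause_lits T c. a (group_of v) \<noteq> v" if c: "c \<in> active_clauses x T" for c
  proof -
    obtain \<tau> z c' where e: "c = (\<tau>, z, c')" by (cases c)
    then obtain dt p g v where "(dt, p, g, v) \<in> set (lits c')" "V (\<tau> + dt) (column T z p) g \<noteq> v"
      using V c unfolding solves_def active_clauses_def by blast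
    then show ?thesis unfolding e clause_lits.simps
      by (intro bexI[of _ "place_lit T \<tau> z (dt, p, g, v)"] imageI) (auto simp: a_def)
  qed
  ultimately show ?L by blast
qed

text \<open>The right-hand side of a vertex; \<open>None\<close> stands for the number of groups.\<close>

fun bound :: "bool \<Rightarrow> obs \<Rightarrow> kind \<Rightarrow> nat option" where
  "bound cov ob (KGroup g) = Some 1"
| "bound cov ob (KClause c) = Some (if cov then of_bool (active ob c) else length (lits c) - 1)"
| "bound cov ob _ = (if cov then Some 0 else None)"

fun rhs :: "bool \<Rightarrow> bool list \<Rightarrow> nat \<Rightarrow> vertex \<Rightarrow> nat" where
  "rhs cov x T (\<tau>, z, \<kappa>) = (case bound cov (observe x T \<tau> z) \<kappa> of None \<Rightarrow> groups_number T | Some m \<Rightarrow> m)"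

definition hard_graph :: "bool \<Rightarrow> bool list \<Rightarrow> nat \<Rightarrow> nat graph" where
  "hard_graph cov x T = list_graph (vlist T) (split_adj is_univ is_val (inc cov x T))"

lemma scope_cases:
  "split_system.scope (vlist T) is_univ is_val (inc cov x T) (\<tau>, z, KUniv) = vals T"
  "split_system.scope (vlist T) is_univ is_val (inc cov x T) (\<tau>, z, KVal g a) = vals T"
  "split_system.scope (vlist T) is_univ is_val (inc cov x T) (\<tau>, z, KGroup g) =
     {v \<in> vals T. group_of v = (\<tau>, z, g)}"
  "split_system.scope (vlist T) is_univ is_val (inc cov x T) (\<tau>, z, KClause c) =
     {v \<in> vals T. inc cov x T (\<tau>, z, KClause c) v}"
proof -
  interpret split_system "vlist T" is_univ is_val "inc cov x T" by (rule split_system_vlist)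
  show "scope (\<tau>, z, KUniv) = vals T" "scope (\<tau>, z, KVal g a) = vals T"
    "scope (\<tau>, z, KClause c) = {v \<in> vals T. inc cov x T (\<tau>, z, KClause c) v}"
    by (auto simp: scope_def vals_def)
  have "inc cov x T (\<tau>, z, KGroup g) v \<longleftrightarrow> group_of v = (\<tau>, z, g)" if "v \<in> vals T" for v
    using that by (auto simp: in_vals)
  moreover have "scope (\<tau>, z, KGroup g) = {v \<in> vals T. inc cov x T (\<tau>, z, KGroup g) v}"
    by (auto simp: scope_def vals_def)
  ultimately show "scope (\<tau>, z, KGroup g) = {v \<in> vals T. group_of v = (\<tau>, z, g)}" by blast
qed

text \<open>An inactive clause sees no weight at all, which satisfies every packing bound; in the
  covering case \<open>bound\<close> asks for 0 instead.\<close>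

lemma inactive_scope: "\<not> active (observe x T \<tau> z) c \<Longrightarrow> {v \<in> vals T. inc cov x T (\<tau>, z, KClause c) v} = {}"
  by (auto simp: in_vals)

lemma ball_vlist:
  "(\<forall>v\<in>set (vlist T). P v) \<longleftrightarrow> (\<forall>\<tau>\<le>T. \<forall>z\<le>2 * T. P (\<tau>, z, KUniv) \<and>
     (\<forall>g\<le>K. \<forall>a<dom_size g. P (\<tau>, z, KVal g a)) \<and> (\<forall>g\<le>K. P (\<tau>, z, KGroup g)) \<and>
     (\<forall>c. valid_clause c \<longrightarrow> P (\<tau>, z, KClause c)))"
proof -
  have "(\<forall>\<kappa>. valid_kind \<kappa> \<longrightarrow> Q \<kappa>) \<longleftrightarrow> Q KUniv \<and> (\<forall>g\<le>K. \<forall>a<dom_size g. Q (KVal g a)) \<and>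
    (\<forall>g\<le>K. Q (KGroup g)) \<and> (\<forall>c. valid_clause c \<longrightarrow> Q (KClause c))" for Q
    by (metis (full_types) kind.exhaust valid_kind.simps)
  from this[of "\<lambda>\<kappa>. P (_, _, \<kappa>)"] show ?thesis by (simp add: in_vlist split_paired_Ball_Sigma Ball_def) blast
qed

text \<open>The group bounds keep every weight at most 1, so the same instance works for every cap
  \<open>l\<close>. The upper bound on the total comes from the universal and value vertices, the
  lower one from the threshold.\<close>

theorem packing_iff_solvable:
  assumes "l \<ge> 1"
  shows "groups_number T \<le> gpf_max (hard_graph False x T) (\<lambda>i. rhs False x T (vlist T ! i))
     (\<lambda>i. if is_val (vlist T ! i) then l else 0) \<longleftrightarrow> (\<exists>V. solves x T V)"
proof -
  interpret split_system "vlist T" is_univ is_val "inc False x T" by (rule split_system_vlist)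
  have eq: "(\<forall>v\<in>set (vlist T). sum F (scope v) \<le> rhs False x T v) \<longleftrightarrow>
    (\<forall>g\<in>group_of ` vals T. sum F {v \<in> vals T. group_of v = g} \<le> 1) \<and>
    (\<forall>c\<in>active_clauses x T. sum F (clause_lits T c) \<le> length (lits (snd (snd c))) - 1) \<and>
    sum F (vals T) \<le> card (group_of ` vals T)" (is "?A \<longleftrightarrow> ?B") for F :: "vertex \<Rightarrow> nat"
  proof
    assume A: ?A
    show ?B
    proof (intro conjI ballI)
      fix g assume "g \<in> group_of ` vals T"
      then obtain \<tau> z g' where "g = (\<tau>, z, g')" "\<tau> \<le> T" "z \<le> 2 * T" "g' \<le> K"
        unfolding group_of_vals by auto
      then show "sum F {v \<in> vals T. group_of v = g} \<le> 1"
        using A[rule_format, of "(\<tau>, z, KGroup g')"] by (simp add: scope_cases in_vlist)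
    next
      fix c assume c: "c \<in> active_clauses x T"
      obtain \<tau> z c' where e: "c = (\<tau>, z, c')" by (cases c)
      then show "sum F (clause_lits T c) \<le> length (lits (snd (snd c))) - 1"
        using A[rule_format, of "(\<tau>, z, KClause c')"] c packing_scope[of c' x T \<tau> z]
        by (simp add: scope_cases in_vlist active_clauses_def)
    next
      show "sum F (vals T) \<le> card (group_of ` vals T)"
        using A[rule_format, of "(0, 0, KUniv)"] by (simp add: scope_cases in_vlist card_groups)
    qed
  next
    assume B: ?B
    show ?A unfolding ball_vlist
    proof (intro allI impI conjI)
      fix \<tau> z assume \<tau>: "\<tau> \<le> T" and z: "z \<le> 2 * T"
      show "sum F (scope (\<tau>, z, KUniv)) \<le> rhs False x T (\<tau>, z, KUniv)"
        "sum F (scope (\<tau>, z, KVal g a)) \<le> rhs False x T (\<tau>, z, KVal g a)" for g a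
        using B by (auto simp: scope_cases card_groups)
      show "sum F (scope (\<tau>, z, KGroup g)) \<le> rhs False x T (\<tau>, z, KGroup g)" if "g \<le> K" for g
        using B \<tau> z that unfolding group_of_vals by (auto simp: scope_cases)
      show "sum F (scope (\<tau>, z, KClause c)) \<le> rhs False x T (\<tau>, z, KClause c)" if c: "valid_clause c" for c
      proof (cases "active (observe x T \<tau> z) c")
        case True
        then have "(\<tau>, z, c) \<in> active_clauses x T" using c \<tau> z by (simp add: active_clauses_def)
        then have "sum F (clause_lits T (\<tau>, z, c)) \<le> length (lits c) - 1" using B by fastforce
        then show ?thesis using packing_scope[OF c True \<tau> z] by (simp add: scope_cases)
      qed (simp add: scope_cases inactive_scope)
    qed
  qed
  have "groups_number T \<le> gpf_max G (\<lambda>i. rhs False x T (vlist T ! i)) (\<lambda>i. if is_val (vlist T ! i) then l else 0) \<longleftrightarrow>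
    (\<exists>F. (\<forall>v\<in>X. F v \<le> l) \<and> (\<forall>v\<in>set (vlist T). sum F (scope v) \<le> rhs False x T v) \<and> groups_number T \<le> sum F X)"
    unfolding gpf_max_ge_iff[OF simple_G[unfolded simple_graph_def, THEN conjunct1]] gpf_feasible_def
    by (rule ex_feasible_iff[where R = "\<lambda>v s. s \<le> rhs False x T v" and Q = "\<lambda>s. groups_number T \<le> s"])
  also have "\<dots> \<longleftrightarrow> (\<exists>F. (\<forall>v\<in>vals T. F v \<le> l) \<and> (\<forall>g\<in>group_of ` vals T. sum F {v \<in> vals T. group_of v = g} \<le> 1) \<and>
    (\<forall>c\<in>active_clauses x T. sum F (clause_lits T c) \<le> length (lits (snd (snd c))) - 1) \<and>
    sum F (vals T) \<le> card (group_of ` vals T) \<and> card (group_of ` vals T) \<le> sum F (vals T))"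
    unfolding eq by (simp only: vals_def[symmetric] card_groups conj_assoc)
  also have "\<dots> \<longleftrightarrow> (\<exists>a. (\<forall>g\<in>group_of ` vals T. a g \<in> vals T \<and> group_of (a g) = g) \<and>
     (\<forall>c\<in>active_clauses x T. \<exists>v\<in>clause_lits T c. a (group_of v) \<noteq> v))"
  proof (rule packing_iff_choice[OF finite_vals assms clause_lits_subset])
    fix c assume "c \<in> active_clauses x T"
    obtain \<tau> z c' where e: "c = (\<tau>, z, c')" by (cases c)
    have "length (lits c') > 0" by (cases c') auto
    then show "card (clause_lits T c) = Suc (length (lits (snd (snd c))) - 1)"
      unfolding e clause_lits.simps card_place_lit by simp
  qed
  finally show ?thesis unfolding choice_iff_solvable hard_graph_def .
qed

text \<open>Here the threshold supplies the upper bound on the total, and the lower bounds come from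
  the groups and active clauses alone.\<close>

theorem covering_iff_solvable:
  "gdf_min (hard_graph True x T) (\<lambda>i. rhs True x T (vlist T ! i))
     (\<lambda>i. if is_val (vlist T ! i) then 1 else 0) \<le> enat (groups_number T) \<longleftrightarrow> (\<exists>V. solves x T V)"
proof -
  interpret split_system "vlist T" is_univ is_val "inc True x T" by (rule split_system_vlist)
  let ?P = "\<lambda>c. {v \<in> vals T. \<exists>w\<in>clause_lits T c. group_of v = group_of w \<and> v \<noteq> w}"
  have eq: "(\<forall>v\<in>set (vlist T). rhs True x T v \<le> sum F (scope v)) \<longleftrightarrow>
    (\<forall>g\<in>group_of ` vals T. 1 \<le> sum F {v \<in> vals T. group_of v = g}) \<and>
    (\<forall>c\<in>active_clauses x T. 1 \<le> sum F (?P c))" (is "?A \<longleftrightarrow> ?B") for F :: "vertex \<Rightarrow> nat"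
  proof
    assume A: ?A
    show ?B
    proof (intro conjI ballI)
      fix g assume "g \<in> group_of ` vals T"
      then obtain \<tau> z g' where "g = (\<tau>, z, g')" "\<tau> \<le> T" "z \<le> 2 * T" "g' \<le> K"
        unfolding group_of_vals by auto
      then show "1 \<le> sum F {v \<in> vals T. group_of v = g}"
        using A[rule_format, of "(\<tau>, z, KGroup g')"] by (simp add: scope_cases in_vlist)
    next
      fix c assume c: "c \<in> active_clauses x T"
      obtain \<tau> z c' where e: "c = (\<tau>, z, c')" by (cases c)
      then show "1 \<le> sum F (?P c)"
        using A[rule_format, of "(\<tau>, z, KClause c')"] c covering_scope[of c' x T \<tau> z]
        by (simp add: scope_cases in_vlist active_clauses_def)
    qed
  next
    assume B: ?B
    show ?A unfolding ball_vlist
    proof (intro allI impI conjI)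
      fix \<tau> z assume \<tau>: "\<tau> \<le> T" and z: "z \<le> 2 * T"
      show "rhs True x T (\<tau>, z, KUniv) \<le> sum F (scope (\<tau>, z, KUniv))"
        "rhs True x T (\<tau>, z, KVal g a) \<le> sum F (scope (\<tau>, z, KVal g a))" for g a
        by auto
      show "rhs True x T (\<tau>, z, KGroup g) \<le> sum F (scope (\<tau>, z, KGroup g))" if "g \<le> K" for g
        using B \<tau> z that unfolding group_of_vals by (auto simp: scope_cases)
      show "rhs True x T (\<tau>, z, KClause c) \<le> sum F (scope (\<tau>, z, KClause c))" if c: "valid_clause c" for c
      proof (cases "active (observe x T \<tau> z) c")
        case True
        then have "(\<tau>, z, c) \<in> active_clauses x T" using c \<tau> z by (simp add: active_clauses_def)
        then have "1 \<le> sum F (?P (\<tau>, z, c))" using B by blast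
        then show ?thesis using covering_scope[OF c True \<tau> z] by (simp add: scope_cases)
      qed simp
    qed
  qed
  have "gdf_min G (\<lambda>i. rhs True x T (vlist T ! i)) (\<lambda>i. if is_val (vlist T ! i) then 1 else 0) \<le> enat (groups_number T) \<longleftrightarrow>
    (\<exists>F. (\<forall>v\<in>X. F v \<le> 1) \<and> (\<forall>v\<in>set (vlist T). rhs True x T v \<le> sum F (scope v)) \<and> sum F X \<le> groups_number T)"
    unfolding gdf_min_le_iff gdf_feasible_def
    by (rule ex_feasible_iff[where R = "\<lambda>v s. rhs True x T v \<le> s" and Q = "\<lambda>s. s \<le> groups_number T"])
  also have "\<dots> \<longleftrightarrow> (\<exists>F. (\<forall>v\<in>vals T. F v \<le> 1) \<and> (\<forall>g\<in>group_of ` vals T. 1 \<le> sum F {v \<in> vals T. group_of v = g}) \<and>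
    (\<forall>c\<in>active_clauses x T. 1 \<le> sum F (?P c)) \<and> sum F (vals T) \<le> card (group_of ` vals T))"
    unfolding eq by (simp only: vals_def[symmetric] card_groups conj_assoc)
  also have "\<dots> \<longleftrightarrow> (\<exists>a. (\<forall>g\<in>group_of ` vals T. a g \<in> vals T \<and> group_of (a g) = g) \<and>
     (\<forall>c\<in>active_clauses x T. \<exists>v\<in>clause_lits T c. a (group_of v) \<noteq> v))"
    by (rule covering_iff_choice[OF finite_vals clause_lits_subset])
  finally show ?thesis unfolding choice_iff_solvable hard_graph_def .
qed

end

section \<open>The reduction as a program\<close>

definition make_block :: "nat \<Rightarrow> nat \<Rightarrow> nat poly \<Rightarrow> prog" where
  "make_block d c q = Seq (poly_loop d (coeffs q) (write_move {c} 1 MRight)) (rewind c (axis c))"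

lemma pruns_make_block:
  assumes c: "c < d" and S: "\<And>x. S x c = (word_tape [], 0)"
    and b: "\<And>x j. j < length (coeffs q) \<Longrightarrow> S x (d + j) = (word_tape x, 0)"
  shows "pruns UNIV length (make_block d c q) S
    (\<lambda>x. (S x)(c := (word_tape (replicate (poly q (length x)) False), 0)))"
  unfolding make_block_def
proof (rule pruns_Seq)
  let ?st = "\<lambda>s a. s(c := out_tape (replicate a False))"
  have "pruns UNIV length (poly_loop d (coeffs q) (write_move {c} 1 MRight))
    (\<lambda>x. ?st (S x) 0) (\<lambda>x. ?st (S x) (poly q (length x)))"
  proof (rule pruns_poly_loop[where st = ?st])
    have "runs (write_move {c} 1 MRight) (?st s a) (?st s (Suc a)) 1" for s a
    proof -
      have "act_tape (1, MRight) (out_tape (replicate a False)) = out_tape (replicate (Suc a) False)"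
        using word_tape_snoc[of "replicate a False" False]
        by (simp add: out_tape_def replicate_append_same)
      then show ?thesis using runs_write_move_1[of c 1 MRight "?st s a"] by simp
    qed
    then show "pruns {(i :: bool list, s, a). i \<in> UNIV \<and> a < poly q (length i)} (\<lambda>(i, s, a). length i)
      (write_move {c} 1 MRight) (\<lambda>(i, s, a). ?st s a) (\<lambda>(i, s, a). ?st s (Suc a))"
      by (intro pruns_const[where t = 1]) auto
  qed (use c b in \<open>auto simp: shift_upd\<close>)
  moreover have "?st (S x) 0 = S x" for x using S[of x] by (auto simp: out_tape_def)
  ultimately show "pruns UNIV length (poly_loop d (coeffs q) (write_move {c} 1 MRight)) S
    (\<lambda>x. ?st (S x) (poly q (length x)))" by simp
next
  show "pruns UNIV length (rewind c (axis c)) (\<lambda>x. (S x)(c := out_tape (replicate (poly q (length x)) False)))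
    (\<lambda>x. (S x)(c := (word_tape (replicate (poly q (length x)) False), 0)))"
  proof (rule prunsI[where q = "q * [:3:] + [:6:]"])
    fix x :: "bool list"
    let ?n = "poly q (length x)"
    let ?s = "(S x)(c := (word_tape (replicate ?n False), 0))"
    have "runs (rewind c (axis c)) (shift (axis c) (int ?n) ?s) ?s (?n * 3 + 6)"
      by (rule runs_rewind) (use is_block_word_tape[of "replicate ?n False"] in auto)
    moreover have "shift (axis c) (int ?n) ?s = (S x)(c := out_tape (replicate ?n False))"
      by (auto simp: shift_def out_tape_def axis_def fun_eq_iff)
    ultimately show "runs (rewind c (axis c)) ((S x)(c := out_tape (replicate ?n False))) ?s
      (poly (q * [:3:] + [:6:]) (length x))" by (simp add: mult.commute)
  qed
qed

text \<open>The value is counted up one by one in binary; this is fast enough because it is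
  polynomial in the input length.\<close>

definition make_number :: "nat \<Rightarrow> nat \<Rightarrow> nat poly \<Rightarrow> prog" where
  "make_number d c q = poly_loop d (coeffs q) (binary_inc c)"

lemma pruns_make_number:
  assumes c: "c < d" and S: "\<And>x. S x c = (word_tape [], 0)"
    and b: "\<And>x j. j < length (coeffs q) \<Longrightarrow> S x (d + j) = (word_tape x, 0)"
  shows "pruns UNIV length (make_number d c q) S
    (\<lambda>x. (S x)(c := (word_tape (binary (poly q (length x))), 0)))"
proof -
  let ?st = "\<lambda>s a. s(c := (word_tape (binary a), 0::int))"
  have "pruns UNIV length (poly_loop d (coeffs q) (binary_inc c))
    (\<lambda>x. ?st (S x) 0) (\<lambda>x. ?st (S x) (poly q (length x)))"
  proof (rule pruns_poly_loop[where st = ?st])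
    have "runs (binary_inc c) (?st s a) (?st s (Suc a)) (poly ([:9:] * q + [:20:]) (length x))"
      if "a < poly q (length x)" for s a and x :: "bool list"
      by (rule runs_mono[OF runs_binary_inc]) (use that in simp)
    then show "pruns {(i :: bool list, s, a). i \<in> UNIV \<and> a < poly q (length i)} (\<lambda>(i, s, a). length i)
      (binary_inc c) (\<lambda>(i, s, a). ?st s a) (\<lambda>(i, s, a). ?st s (Suc a))"
      by (intro prunsI[where q = "[:9:] * q + [:20:]"]) auto
  qed (use c b in \<open>auto simp: shift_upd\<close>)
  moreover have "?st (S x) 0 = S x" for x using S[of x] by (auto simp: binary.simps)
  ultimately show ?thesis by (simp add: make_number_def)
qed

lemma pruns_make_offset:
  assumes u: "dir_vec u" "\<And>i. i \<ge> d \<Longrightarrow> u i = 0"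
    and b: "\<And>x j. j < length (coeffs q) \<Longrightarrow> S x (d + j) = (word_tape x, 0)"
  shows "pruns UNIV length (poly_loop d (coeffs q) (Shift u)) S
    (\<lambda>x. shift u (int (poly q (length x))) (S x))"
proof -
  let ?st = "\<lambda>s a. shift u (int a) s"
  have "pruns UNIV length (poly_loop d (coeffs q) (Shift u))
    (\<lambda>x. ?st (S x) 0) (\<lambda>x. ?st (S x) (poly q (length x)))"
  proof (rule pruns_poly_loop[where st = ?st])
    have "runs (Shift u) (?st s a) (?st s (Suc a)) 1" for s a
      using runs_Shift[OF u(1), of "?st s a"] by (simp add: shift_shift add.commute)
    then show "pruns {(i :: bool list, s, a). i \<in> UNIV \<and> a < poly q (length i)} (\<lambda>(i, s, a). length i)
      (Shift u) (\<lambda>(i, s, a). ?st s a) (\<lambda>(i, s, a). ?st s (Suc a))"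
      by (intro pruns_const[where t = 1]) auto
    show "?st (shift (axis c) j s) a = shift (axis c) j (?st s a)" for s a c j by (rule shift_commute)
    show "?st s a c = s c" if "d \<le> c" for s a c using u(2)[OF that] by (simp add: shift_def)
  qed (use b in auto)
  then show ?thesis by simp
qed

text \<open>Every action writes, so the head rewrites the 2 at cell 0 when it crosses it from cell 1
  to cell -1.\<close>

definition make_marks :: "nat set \<Rightarrow> prog" where
  "make_marks A = Seq (write_move A 2 MRight) (Seq (write_move A 3 MLeft)
     (Seq (write_move A 2 MLeft) (write_move A 1 MRight)))"

lemma runs_make_marks:
  assumes "\<And>i. i \<in> A \<Longrightarrow> s i = (word_tape [], 0)"
  shows "runs (make_marks A) s (\<lambda>i. if i \<in> A then (win, 0) else s i) 7"
proof -
  let ?w = "\<lambda>a m s i. if i \<in> A then act_tape (a, m) (s i) else s i"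
  have "runs (make_marks A) s (?w 1 MRight (?w 2 MLeft (?w 3 MLeft (?w 2 MRight s)))) (1 + (1 + (1 + 1 + 1) + 1) + 1)"
    (is "runs _ _ _ ?t")
    unfolding make_marks_def
    by (rule runs_Seq[OF runs_write_move runs_Seq[OF runs_write_move runs_Seq[OF runs_write_move runs_write_move]]])
  moreover have "?t = 7" by simp
  moreover have "?w 1 MRight (?w 2 MLeft (?w 3 MLeft (?w 2 MRight s))) = (\<lambda>i. if i \<in> A then (win, 0) else s i)"
    using assms by (auto simp: fun_eq_iff win_def word_tape_def)
  ultimately show ?thesis by (simp only:)
qed

definition dirs :: "nat set \<Rightarrow> nat set \<Rightarrow> nat \<Rightarrow> int" where
  "dirs A B = (\<lambda>i. if i \<in> A then 1 else if i \<in> B then -1 else 0)"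

lemma dir_vec_dirs [simp]: "dir_vec (dirs A B)"
  by (auto simp: dir_vec_def dirs_def)

text \<open>Tapes: 0 output; 1, 2, 3, 4 loop counters for row time, row column, column time, column column
  of the adjacency matrix (\<open>\<tau>, z, \<tau>', z'\<close>); 5 and 6 hold the marks for \<open>\<tau>' - \<tau>\<close> and \<open>z' - z\<close>;
  7 to 11 and 17 those for \<open>\<tau>, \<tau> - T, z, z - T, z - 2T\<close> and the input shifted by \<open>T\<close>, and 12 to 16
  and 18 the same for \<open>\<tau>', z'\<close>; 19 and 20 hold the numbers of vertices and groups in binary;
  the tapes from 21 on are copies of the input that drive the loops computing polynomials.\<close>

definition row_obs :: "(nat \<Rightarrow> nat) \<Rightarrow> obs" where
  "row_obs r = (r 7, r 8, r 9, r 10, r 11, r 17)"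

definition col_obs :: "(nat \<Rightarrow> nat) \<Rightarrow> obs" where
  "col_obs r = (r 12, r 13, r 14, r 15, r 16, r 18)"

text \<open>A head standing for an affine function moves, in each loop, by the coefficient of that
  loop's counter. So tape 5, which stands for \<open>\<tau>' - \<tau>\<close>, goes left with
  \<open>\<tau>\<close> and right with \<open>\<tau>'\<close>.\<close>

definition time_dirs :: "nat \<Rightarrow> int" where "time_dirs = dirs {1, 7, 8} {5}"
definition col_dirs :: "nat \<Rightarrow> int" where "col_dirs = dirs {2, 9, 10, 11, 17} {6}"
definition time_dirs' :: "nat \<Rightarrow> int" where "time_dirs' = dirs {3, 5, 12, 13} {}"
definition col_dirs' :: "nat \<Rightarrow> int" where "col_dirs' = dirs {4, 6, 14, 15, 16, 18} {}"
definition offset_dirs :: "nat \<Rightarrow> int" where "offset_dirs = dirs {} {8, 10, 11, 13, 15, 16, 17, 18}"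
text \<open>A head moves by at most one cell per action, so the offset \<open>2T\<close> of tapes 11
  and 16 takes a second pass of length \<open>T\<close>.\<close>

definition offset_dirs2 :: "nat \<Rightarrow> int" where "offset_dirs2 = dirs {} {11, 16}"

lemmas dirs_defs = time_dirs_def col_dirs_def time_dirs'_def col_dirs'_def offset_dirs_def offset_dirs2_def

lemma dir_vec_loops [simp]:
  "dir_vec time_dirs" "dir_vec col_dirs" "dir_vec time_dirs'" "dir_vec col_dirs'"
  "dir_vec offset_dirs" "dir_vec offset_dirs2"
  by (simp_all add: dirs_defs)

lemma dirs_ge_21 [simp]:
  "i \<ge> 21 \<Longrightarrow> time_dirs i = 0" "i \<ge> 21 \<Longrightarrow> col_dirs i = 0" "i \<ge> 21 \<Longrightarrow> time_dirs' i = 0"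
  "i \<ge> 21 \<Longrightarrow> col_dirs' i = 0" "i \<ge> 21 \<Longrightarrow> offset_dirs i = 0" "i \<ge> 21 \<Longrightarrow> offset_dirs2 i = 0"
  by (auto simp: dirs_defs dirs_def)

text \<open>Tapes 5 and 6 show differences as seen from the row vertex; when the clause or group is
  the column vertex they must be negated, which swaps the marks 1 and 3.\<close>

definition flip :: "nat \<Rightarrow> nat" where
  "flip w = (if w = 1 then 3 else if w = 3 then 1 else w)"

lemma flip_win: "flip (win j) = win (- j)"
  by (auto simp: flip_def win_def)

fun is_val_kind :: "kind \<Rightarrow> bool" where
  "is_val_kind (KVal g a) \<longleftrightarrow> True"
| "is_val_kind _ \<longleftrightarrow> False"

lemma is_val_eq: "is_val (\<tau>, z, \<kappa>) = is_val_kind \<kappa>"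
  by (cases \<kappa>) auto

definition double_loop :: "nat \<Rightarrow> (nat \<Rightarrow> int) \<Rightarrow> nat \<Rightarrow> (nat \<Rightarrow> int) \<Rightarrow> prog \<Rightarrow> prog" where
  "double_loop c u c' u' body = For c u (For c' u' body)"

text \<open>\<open>u c' = 0\<close> keeps the counter of the inner loop at home while the outer loop
  moves.\<close>

lemma emits_double_loop:
  assumes u: "dir_vec u" "u c = 1" "u 0 = 0" "u c' = 0" and u': "dir_vec u'" "u' c' = 1" "u' 0 = 0"
    and b: "\<And>i. i \<in> I \<Longrightarrow> is_block (S i c) (N i)" "\<And>i. i \<in> I \<Longrightarrow> is_block (S i c') (N' i)"
    and N: "\<And>i. i \<in> I \<Longrightarrow> N i \<le> poly qN (len i)" "\<And>i. i \<in> I \<Longrightarrow> N' i \<le> poly qN' (len i)"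
    and body: "emits {(i, j, j'). i \<in> I \<and> j < N i \<and> j' < N' i} (\<lambda>(i, j, j'). len i) body
      (\<lambda>(i, j, j'). shift u' (int j') (shift u (int j) (S i))) (\<lambda>(i, j, j'). w i j j')"
  shows "emits I len (double_loop c u c' u' body) S
    (\<lambda>i. concat (map (\<lambda>j. concat (map (w i j) [0..<N' i])) [0..<N i]))"
proof -
  let ?I = "{(i, j). i \<in> I \<and> j < N i}"
  obtain q where q: "\<And>i j j' y. i \<in> I \<Longrightarrow> j < N i \<Longrightarrow> j' < N' i \<Longrightarrow>
    runs body ((shift u' (int j') (shift u (int j) (S i)))(0 := out_tape y))
      ((shift u' (int j') (shift u (int j) (S i)))(0 := out_tape (y @ w i j j'))) (poly q (len i))"
  proof -
    obtain q where q0: "\<And>i y. i \<in> {(i, j, j'). i \<in> I \<and> j < N i \<and> j' < N' i} \<Longrightarrow>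
      runs body ((case i of (i, j, j') \<Rightarrow> shift u' (int j') (shift u (int j) (S i)))(0 := out_tape y))
        ((case i of (i, j, j') \<Rightarrow> shift u' (int j') (shift u (int j) (S i)))
          (0 := out_tape (y @ (case i of (i, j, j') \<Rightarrow> w i j j')))) (poly q (case i of (i, j, j') \<Rightarrow> len i))"
      using emitsE[OF body] by blast
    show ?thesis by (rule that[of q]) (use q0[of "(_, _, _)"] in simp)
  qed
  have "emits {(ij, j'). ij \<in> ?I \<and> j' < N' (fst ij)} (\<lambda>(ij, j'). case ij of (i, j) \<Rightarrow> len i) body
    (\<lambda>(ij, j'). shift u' (int j') (case ij of (i, j) \<Rightarrow> shift u (int j) (S i))) (\<lambda>(ij, j'). w (fst ij) (snd ij) j')"
    unfolding emits_def by (rule prunsI[where q = q]) (use q in auto)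
  then have "emits ?I (\<lambda>(i, j). len i) (For c' u' body) (\<lambda>(i, j). shift u (int j) (S i))
    (\<lambda>i. concat (map (\<lambda>j. case (i, j) of (ij, j') \<Rightarrow> w (fst ij) (snd ij) j') [0..<N' (fst i)]))"
    by (intro emits_For[where qN = qN']) (use u u' b N in \<open>auto simp: shift_def\<close>)
  from emits_For[where qN = qN, OF u(1-3) b(1) N(1) this] show ?thesis
    unfolding double_loop_def by simp
qed

lemma emits_Cond_words:
  assumes "\<And>r v. b (r(0 := v)) = b r"
  shows "emits I len (Cond b (emit_word v) (emit_word w)) S (\<lambda>i. if b (reads (S i)) then v else w)"
  by (rule emits_Cond[OF _ _ assms]) (rule emits_cong[OF emits_word]; simp)+

locale reduction = tableau M for M :: tm +
  fixes p :: "nat poly"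
begin

definition rows_poly :: "nat poly" where "rows_poly = p + 1"
definition cols_poly :: "nat poly" where "cols_poly = [:2:] * p + 1"
definition verts_poly :: "nat poly" where "verts_poly = rows_poly * (cols_poly * [:length ks:])"
definition groups_poly :: "nat poly" where "groups_poly = rows_poly * (cols_poly * [:Suc K:])"

text \<open>The tapes from 21 on are shared by all polynomial loops, since each leaves them as it
  found them; \<open>D\<close> is at least the nesting depth of each.\<close>

definition D :: nat where
  "D = length (coeffs p) + length (coeffs rows_poly) + length (coeffs cols_poly) +
     length (coeffs verts_poly) + length (coeffs groups_poly)"

definition T :: "bool list \<Rightarrow> nat" where "T x = poly p (length x)"

lemma poly_values:
  "poly rows_poly (length x) = Suc (T x)" "poly cols_poly (length x) = 2 * T x + 1"
  "poly verts_poly (length x) = length (vlist (T x))" "poly groups_poly (length x) = groups_number (T x)"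
  by (simp_all add: rows_poly_def cols_poly_def verts_poly_def groups_poly_def T_def vlist_def groups_number_def
      del: mult_Suc mult_Suc_right upt_Suc)

definition copies :: "nat set" where "copies = {17, 18} \<union> {21..<21 + D}"

definition prepare :: prog where
  "prepare = Seq (copy_input 17 copies) (Seq (make_marks {5..16})
     (Seq (make_block 21 1 rows_poly) (Seq (make_block 21 2 cols_poly)
     (Seq (make_block 21 3 rows_poly) (Seq (make_block 21 4 cols_poly)
     (Seq (make_number 21 19 verts_poly) (Seq (make_number 21 20 groups_poly)
     (Seq (poly_loop 21 (coeffs p) (Shift offset_dirs)) (poly_loop 21 (coeffs p) (Shift offset_dirs2))))))))))"

definition ready :: "bool list \<Rightarrow> state" where
  "ready x = shift offset_dirs2 (int (T x)) (shift offset_dirs (int (T x))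
     ((\<lambda>i. if i \<in> {5..16} then (win, 0) else copied_state copies x i)
       (1 := (word_tape (replicate (Suc (T x)) False), 0),
        2 := (word_tape (replicate (2 * T x + 1) False), 0),
        3 := (word_tape (replicate (Suc (T x)) False), 0),
        4 := (word_tape (replicate (2 * T x + 1) False), 0),
        19 := (word_tape (binary (length (vlist (T x)))), 0),
        20 := (word_tape (binary (groups_number (T x))), 0))))"

lemma pruns_prepare: "pruns UNIV length prepare init_state ready"
proof -
  let ?s1 = "\<lambda>x. copied_state copies x"
  let ?s2 = "\<lambda>x i. if i \<in> {5..16} then (win, 0) else ?s1 x i"
  let ?s3 = "\<lambda>x. (?s2 x)(1 := (word_tape (replicate (poly rows_poly (length x)) False), 0))"
  let ?s4 = "\<lambda>x. (?s3 x)(2 := (word_tape (replicate (poly cols_poly (length x)) False), 0))"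
  let ?s5 = "\<lambda>x. (?s4 x)(3 := (word_tape (replicate (poly rows_poly (length x)) False), 0))"
  let ?s6 = "\<lambda>x. (?s5 x)(4 := (word_tape (replicate (poly cols_poly (length x)) False), 0))"
  let ?s7 = "\<lambda>x. (?s6 x)(19 := (word_tape (binary (poly verts_poly (length x))), 0))"
  let ?s8 = "\<lambda>x. (?s7 x)(20 := (word_tape (binary (poly groups_poly (length x))), 0))"
  let ?s9 = "\<lambda>x. shift offset_dirs (int (poly p (length x))) (?s8 x)"
  let ?s10 = "\<lambda>x. shift offset_dirs2 (int (poly p (length x))) (?s9 x)"
  have D: "length (coeffs p) \<le> D" "length (coeffs rows_poly) \<le> D" "length (coeffs cols_poly) \<le> D"
    "length (coeffs verts_poly) \<le> D" "length (coeffs groups_poly) \<le> D"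
    by (auto simp: D_def)
  have "pruns UNIV length prepare init_state ?s10"
    unfolding prepare_def
  proof (intro pruns_Seq)
    show "pruns UNIV length (copy_input 17 copies) init_state ?s1"
      by (rule prunsI[where q = "[:10, 7:]"])
        (use runs_copy_input[of 17 copies] in \<open>simp add: copies_def mult.commute add.commute\<close>)
    show "pruns UNIV length (make_marks {5..16}) ?s1 ?s2"
      by (rule pruns_const[where t = 7], rule runs_make_marks) (auto simp: copied_state_def copies_def)
    show "pruns UNIV length (make_block 21 1 rows_poly) ?s2 ?s3"
      by (rule pruns_make_block) (use D in \<open>auto simp: copied_state_def copies_def\<close>)
    show "pruns UNIV length (make_block 21 2 cols_poly) ?s3 ?s4"
      by (rule pruns_make_block) (use D in \<open>auto simp: copied_state_def copies_def\<close>)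
    show "pruns UNIV length (make_block 21 3 rows_poly) ?s4 ?s5"
      by (rule pruns_make_block) (use D in \<open>auto simp: copied_state_def copies_def\<close>)
    show "pruns UNIV length (make_block 21 4 cols_poly) ?s5 ?s6"
      by (rule pruns_make_block) (use D in \<open>auto simp: copied_state_def copies_def\<close>)
    show "pruns UNIV length (make_number 21 19 verts_poly) ?s6 ?s7"
      by (rule pruns_make_number) (use D in \<open>auto simp: copied_state_def copies_def\<close>)
    show "pruns UNIV length (make_number 21 20 groups_poly) ?s7 ?s8"
      by (rule pruns_make_number) (use D in \<open>auto simp: copied_state_def copies_def\<close>)
    show "pruns UNIV length (poly_loop 21 (coeffs p) (Shift offset_dirs)) ?s8 ?s9"
      by (rule pruns_make_offset) (use D in \<open>auto simp: copied_state_def copies_def\<close>)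
    show "pruns UNIV length (poly_loop 21 (coeffs p) (Shift offset_dirs2)) ?s9 ?s10"
      by (rule pruns_make_offset)
        (use D in \<open>auto simp: shift_def copied_state_def copies_def\<close>)
  qed
  then show ?thesis
    by (rule pruns_cong) (simp_all only: ready_def poly_values T_def[symmetric])
qed

section \<open>Writing the adjacency matrix\<close>

definition at_entry :: "bool list \<Rightarrow> nat \<Rightarrow> nat \<Rightarrow> nat \<Rightarrow> nat \<Rightarrow> state" where
  "at_entry x \<tau> z \<tau>' z' = shift col_dirs' (int z') (shift time_dirs' (int \<tau>')
     (shift col_dirs (int z) (shift time_dirs (int \<tau>) (ready x))))"

lemma reads_at_entry:
  "row_obs (reads (at_entry x \<tau> z \<tau>' z')) = observe x (T x) \<tau> z"
  "col_obs (reads (at_entry x \<tau> z \<tau>' z')) = observe x (T x) \<tau>' z'"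
  "reads (at_entry x \<tau> z \<tau>' z') 5 = win (int \<tau>' - int \<tau>)"
  "reads (at_entry x \<tau> z \<tau>' z') 6 = win (int z' - int z)"
  "reads (at_entry x \<tau> z \<tau>' z') 10 = win (int z - int (T x))"
  "reads (at_entry x \<tau> z \<tau>' z') 15 = win (int z' - int (T x))"
  by (simp_all add: row_obs_def col_obs_def observe_def reads_def at_entry_def ready_def shift_def
      dirs_defs dirs_def copied_state_def copies_def)

text \<open>Equal kinds with both differences 0 mean the same vertex. The last disjunct looks from
  the side of the column vertex, so it uses \<open>col_obs\<close>, the negated differences and tape
  10, which places the value vertex of the row relative to the center.\<close>

definition adj_test :: "bool \<Rightarrow> kind \<Rightarrow> kind \<Rightarrow> (nat \<Rightarrow> nat) \<Rightarrow> bool" where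
  "adj_test cov \<kappa> \<kappa>' r \<longleftrightarrow> \<not> (\<kappa> = \<kappa>' \<and> r 5 = 2 \<and> r 6 = 2) \<and>
     (\<kappa> = KUniv \<or> \<kappa>' = KUniv \<or> is_val_kind \<kappa> \<and> is_val_kind \<kappa>' \<or>
      is_val_kind \<kappa>' \<and> \<not> is_val_kind \<kappa> \<and> incident cov (row_obs r) (r 5) (r 6) (r 15) \<kappa> \<kappa>' \<or>
      is_val_kind \<kappa> \<and> \<not> is_val_kind \<kappa>' \<and> incident cov (col_obs r) (flip (r 5)) (flip (r 6)) (r 10) \<kappa>' \<kappa>)"

lemma adj_test_at_entry:
  "adj_test cov \<kappa> \<kappa>' (reads (at_entry x \<tau> z \<tau>' z')) \<longleftrightarrow>
     split_adj is_univ is_val (inc cov x (T x)) (\<tau>, z, \<kappa>) (\<tau>', z', \<kappa>')"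
  unfolding adj_test_def split_adj_def reads_at_entry flip_win is_val_eq is_univ.simps inc.simps
  by auto

definition emit_entry :: "bool \<Rightarrow> kind \<Rightarrow> kind \<Rightarrow> prog" where
  "emit_entry cov \<kappa> \<kappa>' = Cond (adj_test cov \<kappa> \<kappa>') (emit_word (encode_nat 1)) (emit_word (encode_nat 0))"

lemma emits_entry:
  "emits I len (emit_entry cov \<kappa> \<kappa>') st
     (\<lambda>i. encode_nat (if adj_test cov \<kappa> \<kappa>' (reads (st i)) then 1 else 0))"
proof -
  have "adj_test cov \<kappa> \<kappa>' (r(0 := v)) = adj_test cov \<kappa> \<kappa>' r" for r v
    by (simp add: adj_test_def row_obs_def col_obs_def)
  note words = emits_Cond_words[of "adj_test cov \<kappa> \<kappa>'", OF this]
  have "(\<lambda>i. encode_nat (if adj_test cov \<kappa> \<kappa>' (reads (st i)) then 1 else 0)) =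
    (\<lambda>i. if adj_test cov \<kappa> \<kappa>' (reads (st i)) then encode_nat 1 else encode_nat 0)" by auto
  then show ?thesis unfolding emit_entry_def using words by (simp only:)
qed

text \<open>The kinds are unrolled inside the loops at both levels, so the entries appear row by row
  in the order of \<open>vlist\<close>.\<close>

definition emit_matrix :: "bool \<Rightarrow> prog" where
  "emit_matrix cov = double_loop 1 time_dirs 2 col_dirs (seqs (map (\<lambda>\<kappa>.
     double_loop 3 time_dirs' 4 col_dirs' (seqs (map (emit_entry cov \<kappa>) ks))) ks))"

lemma is_block_ready:
  "is_block (ready x 1) (Suc (T x))" "is_block (ready x 2) (2 * T x + 1)"
  "is_block (shift col_dirs (int z) (shift time_dirs (int \<tau>) (ready x)) 3) (Suc (T x))"
  "is_block (shift col_dirs (int z) (shift time_dirs (int \<tau>) (ready x)) 4) (2 * T x + 1)"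
  using is_block_word_tape[of "replicate (Suc (T x)) False"] is_block_word_tape[of "replicate (2 * T x + 1) False"]
  by (simp_all add: ready_def shift_def dirs_defs dirs_def del: replicate_Suc)

lemma dirs_values [simp]:
  "time_dirs (Suc 0) = 1" "time_dirs 0 = 0" "time_dirs 2 = 0" "col_dirs 2 = 1" "col_dirs 0 = 0"
  "time_dirs' 3 = 1" "time_dirs' 0 = 0" "time_dirs' 4 = 0" "col_dirs' 4 = 1" "col_dirs' 0 = 0"
  by (simp_all add: dirs_defs dirs_def)

lemma concat_vlist: "concat (map f (vlist t)) =
    concat (map (\<lambda>\<tau>. concat (map (\<lambda>z. concat (map (\<lambda>\<kappa>. f (\<tau>, z, \<kappa>)) ks)) [0..<2 * t + 1])) [0..<Suc t])"
proof -
  have cc: "concat (concat xss) = concat (map concat xss)" for xss :: "'b list list list"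
    by (induction xss) auto
  show ?thesis by (simp only: map_vlist cc map_concat map_map comp_def)
qed

lemma emits_rows:
  assumes "\<And>\<kappa>. \<kappa> \<in> set ks \<Longrightarrow> emits {(x, \<tau>, z). \<tau> < Suc (T x) \<and> z < 2 * T x + 1} (\<lambda>(x, \<tau>, z). length x) (P \<kappa>)
    (\<lambda>(x, \<tau>, z). shift col_dirs (int z) (shift time_dirs (int \<tau>) (ready x))) (\<lambda>(x, \<tau>, z). w x (\<tau>, z, \<kappa>))"
  shows "emits UNIV length (double_loop 1 time_dirs 2 col_dirs (seqs (map P ks))) ready
    (\<lambda>x. concat (map (w x) (vlist (T x))))"
  unfolding concat_vlist
proof (rule emits_double_loop[where qN = rows_poly and qN' = cols_poly])
  have "emits {(x, \<tau>, z). \<tau> < Suc (T x) \<and> z < 2 * T x + 1} (\<lambda>(x, \<tau>, z). length x) (seqs (map P ks))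
    (\<lambda>(x, \<tau>, z). shift col_dirs (int z) (shift time_dirs (int \<tau>) (ready x)))
    (\<lambda>i. concat (map (\<lambda>\<kappa>. case i of (x, \<tau>, z) \<Rightarrow> w x (\<tau>, z, \<kappa>)) ks))"
    by (rule emits_seqs) (rule assms)
  then show "emits {(x, \<tau>, z). x \<in> UNIV \<and> \<tau> < Suc (T x) \<and> z < 2 * T x + 1} (\<lambda>(x, \<tau>, z). length x) (seqs (map P ks))
    (\<lambda>(x, \<tau>, z). shift col_dirs (int z) (shift time_dirs (int \<tau>) (ready x)))
    (\<lambda>(x, \<tau>, z). concat (map (\<lambda>\<kappa>. w x (\<tau>, z, \<kappa>)) ks))"
    by (auto elim!: emits_cong)
qed (use is_block_ready poly_values in auto)

lemma emits_matrix:
  "emits UNIV length (emit_matrix cov) ready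
     (\<lambda>x. concat (map (\<lambda>v. concat (map (\<lambda>w.
        encode_nat (if split_adj is_univ is_val (inc cov x (T x)) v w then 1 else 0)) (vlist (T x)))) (vlist (T x))))"
  unfolding emit_matrix_def
proof (rule emits_rows)
  fix \<kappa>
  let ?e = "\<lambda>x v w. encode_nat (if split_adj is_univ is_val (inc cov x (T x)) v w then 1 else 0)"
  let ?I = "{(x, \<tau>, z). \<tau> < Suc (T x) \<and> z < 2 * T x + 1}"
  let ?S = "\<lambda>(x, \<tau>, z). shift col_dirs (int z) (shift time_dirs (int \<tau>) (ready x))"
  have "emits ?I (\<lambda>(x, \<tau>, z). length x) (double_loop 3 time_dirs' 4 col_dirs' (seqs (map (emit_entry cov \<kappa>) ks))) ?S
    (\<lambda>i. concat (map (\<lambda>\<tau>'. concat (map (\<lambda>z'. concat (map (\<lambda>\<kappa>'. ?e (fst i) (fst (snd i), snd (snd i), \<kappa>) (\<tau>', z', \<kappa>')) ks))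
       [0..<2 * T (fst i) + 1])) [0..<Suc (T (fst i))]))"
  proof (rule emits_double_loop[where qN = rows_poly and qN' = cols_poly])
    show "emits {(i, \<tau>', z'). i \<in> ?I \<and> \<tau>' < Suc (T (fst i)) \<and> z' < 2 * T (fst i) + 1}
      (\<lambda>(i, \<tau>', z'). case i of (x, \<tau>, z) \<Rightarrow> length x) (seqs (map (emit_entry cov \<kappa>) ks))
      (\<lambda>(i, \<tau>', z'). shift col_dirs' (int z') (shift time_dirs' (int \<tau>') (?S i)))
      (\<lambda>(i, \<tau>', z'). concat (map (\<lambda>\<kappa>'. ?e (fst i) (fst (snd i), snd (snd i), \<kappa>) (\<tau>', z', \<kappa>')) ks))"
      by (rule emits_cong[OF emits_seqs[OF emits_entry]])
        (auto simp: adj_test_at_entry[unfolded at_entry_def])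
  qed (use is_block_ready poly_values in auto)
  then show "emits ?I (\<lambda>(x, \<tau>, z). length x) (double_loop 3 time_dirs' 4 col_dirs' (seqs (map (emit_entry cov \<kappa>) ks))) ?S
    (\<lambda>(x, \<tau>, z). concat (map (?e x (\<tau>, z, \<kappa>)) (vlist (T x))))"
    by (rule emits_cong) (auto simp: concat_vlist)
qed

section \<open>Writing the vectors and the whole instance\<close>

definition emit_bound :: "bool \<Rightarrow> kind \<Rightarrow> prog" where
  "emit_bound cov \<kappa> = Cond (\<lambda>r. bound cov (row_obs r) \<kappa> = None) (emit_num 20)
     (Cond (\<lambda>r. bound cov (row_obs r) \<kappa> = Some 0) (emit_word (encode_nat 0))
       (Cond (\<lambda>r. bound cov (row_obs r) \<kappa> = Some 1) (emit_word (encode_nat 1)) (emit_word (encode_nat 2))))"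

text \<open>Clauses have at most three literals. So apart from the number of groups every right-hand
  side is one of three constant words.\<close>

lemma bound_le_2: "bound cov ob \<kappa> = Some m \<Longrightarrow> m \<le> 2"
proof (cases \<kappa>)
  case (KClause c)
  then show "bound cov ob \<kappa> = Some m \<Longrightarrow> m \<le> 2" by (cases c) (auto split: if_splits)
qed (auto split: if_splits)

lemma emits_bounds:
  "emits UNIV length (double_loop 1 time_dirs 2 col_dirs (seqs (map (emit_bound cov) ks))) ready
     (\<lambda>x. concat (map (\<lambda>v. encode_nat (rhs cov x (T x) v)) (vlist (T x))))"
proof (rule emits_rows)
  fix \<kappa>
  let ?I = "{(x, \<tau>, z). \<tau> < Suc (T x) \<and> z < 2 * T x + 1}"
  let ?S = "\<lambda>(x, \<tau>, z). shift col_dirs (int z) (shift time_dirs (int \<tau>) (ready x))"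
  \<comment> \<open>Bounds depend on the row position only; setting the column counters to 0 makes
    \<open>reads_at_entry\<close> applicable.\<close>
  have S: "?S = (\<lambda>(x, \<tau>, z). at_entry x \<tau> z 0 0)" by (simp add: at_entry_def)
  have num: "emits J (\<lambda>(x, \<tau>, z). length x) (emit_num 20) (\<lambda>(x, \<tau>, z). at_entry x \<tau> z 0 0)
      (\<lambda>i. encode_nat (groups_number (T (fst i))))" for J :: "(bool list \<times> nat \<times> nat) set"
    by (rule emits_num[where qv = groups_poly])
      (auto simp: at_entry_def ready_def shift_def dirs_defs dirs_def poly_values)
  show "emits ?I (\<lambda>(x, \<tau>, z). length x) (emit_bound cov \<kappa>) ?S (\<lambda>(x, \<tau>, z). encode_nat (rhs cov x (T x) (\<tau>, z, \<kappa>)))"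
    unfolding emit_bound_def S
  proof (intro emits_Cond, goal_cases)
    case 1
    show ?case by (rule emits_cong[OF num]) (auto simp: reads_at_entry)
  next
    case 2
    show ?case by (rule emits_cong[OF emits_word]) (auto simp: reads_at_entry)
  next
    case 3
    show ?case by (rule emits_cong[OF emits_word]) (auto simp: reads_at_entry)
  next
    case 4
    have two: "(case bound cov ob \<kappa> of None \<Rightarrow> b | Some m \<Rightarrow> m) = 2"
      if b: "bound cov ob \<kappa> \<noteq> None" "bound cov ob \<kappa> \<noteq> Some 0" "bound cov ob \<kappa> \<noteq> Some 1" for ob b
    proof -
      obtain m where m: "bound cov ob \<kappa> = Some m" using b(1) by blast
      then have "m \<noteq> 0" "m \<noteq> 1" using b by auto
      then show ?thesis using bound_le_2[OF m] m by simp
    qed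
    show ?case
    proof (rule emits_cong[OF emits_word refl], safe, goal_cases)
      case (1 x \<tau> z)
      then show ?case using two[of "observe x (T x) \<tau> z"] by (simp add: reads_at_entry)
    qed
  qed (simp_all add: row_obs_def)
qed

text \<open>\<open>mid\<close> stands where the code of \<open>LPF\<close> has \<open>l\<close> and
  is empty for the other problems. The last number is the threshold, the number of groups from tape
  20.\<close>

definition main :: "bool \<Rightarrow> nat list \<Rightarrow> prog" where
  "main cov mid = Seq (emit_num 19) (Seq (emit_matrix cov) (Seq (emit_word (encode_nats mid))
     (Seq (double_loop 1 time_dirs 2 col_dirs (seqs (map (emit_bound cov) ks)))
     (Seq (double_loop 1 time_dirs 2 col_dirs
        (seqs (map (\<lambda>\<kappa>. emit_word (encode_nat (if is_val_kind \<kappa> then 1 else 0))) ks)))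
     (emit_num 20)))))"

definition red :: "bool \<Rightarrow> nat list \<Rightarrow> bool list \<Rightarrow> bool list" where
  "red cov mid x = encode_nats (graph_code (hard_graph cov x (T x)) @ mid @
     map (rhs cov x (T x)) (vlist (T x)) @ map (\<lambda>v. if is_val v then 1 else 0) (vlist (T x)) @
     [groups_number (T x)])"

lemma emits_main: "emits UNIV length (main cov mid) ready (red cov mid)"
proof -
  have 1: "emits UNIV length (emit_num 19) ready (\<lambda>x. encode_nat (length (vlist (T x))))"
    by (rule emits_num[where qv = verts_poly]) (auto simp: ready_def shift_def dirs_defs dirs_def poly_values)
  have 2: "emits UNIV length (emit_num 20) ready (\<lambda>x. encode_nat (groups_number (T x)))"
    by (rule emits_num[where qv = groups_poly]) (auto simp: ready_def shift_def dirs_defs dirs_def poly_values)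
  have 3: "emits UNIV length (double_loop 1 time_dirs 2 col_dirs
        (seqs (map (\<lambda>\<kappa>. emit_word (encode_nat (if is_val_kind \<kappa> then 1 else 0))) ks))) ready
        (\<lambda>x. concat (map (\<lambda>v. encode_nat (if is_val v then 1 else 0)) (vlist (T x))))"
    by (rule emits_rows, rule emits_cong[OF emits_word]) (auto simp: is_val_eq)
  have "emits UNIV length (main cov mid) ready (\<lambda>x. encode_nat (length (vlist (T x))) @
     concat (map (\<lambda>v. concat (map (\<lambda>w.
        encode_nat (if split_adj is_univ is_val (inc cov x (T x)) v w then 1 else 0)) (vlist (T x)))) (vlist (T x))) @
     encode_nats mid @ concat (map (\<lambda>v. encode_nat (rhs cov x (T x) v)) (vlist (T x))) @
     concat (map (\<lambda>v. encode_nat (if is_val v then 1 else 0)) (vlist (T x))) @ encode_nat (groups_number (T x)))"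
    unfolding main_def by (intro emits_Seq 1 2 3 emits_matrix emits_bounds emits_word)
  moreover have enc: "encode_nats (concat (map f xs)) = concat (map (\<lambda>v. encode_nats (f v)) xs)" for f and xs :: "vertex list"
    by (induction xs) (auto simp: encode_nats_def)
  ultimately show ?thesis
    by (elim emits_cong) (simp_all add: red_def hard_graph_def graph_code_list_graph[OF split_adj_sym]
        enc encode_nats_def map_map comp_def)
qed

text \<open>Four symbols: the blank, the two bits, and 3, which occurs only as a mark.\<close>

lemma wf_program: "wf_prog (21 + D) 4 (Seq prepare (main cov mid))"
proof -
  have D: "length (coeffs p) \<le> D" "length (coeffs rows_poly) \<le> D" "length (coeffs cols_poly) \<le> D"
    "length (coeffs verts_poly) \<le> D" "length (coeffs groups_poly) \<le> D"
    by (auto simp: D_def)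
  have sub: "copies \<subseteq> {..<21 + D}" "{5..16} \<subseteq> {..<21 + D}" by (auto simp: copies_def)
  have dl: "wf_prog (21 + D) 4 (double_loop 1 time_dirs 2 col_dirs q) \<longleftrightarrow> wf_prog (21 + D) 4 q"
    "wf_prog (21 + D) 4 (double_loop 3 time_dirs' 4 col_dirs' q) \<longleftrightarrow> wf_prog (21 + D) 4 q" for q
    by (auto simp: double_loop_def For_def)
  have ax: "axis c i = 0" if "c < 21" "21 + D \<le> i" for c i using that by (auto simp: axis_def)
  have mb: "wf_prog (21 + D) 4 (make_block 21 c q)" if "c < 21" "length (coeffs q) \<le> D" for c q
    unfolding make_block_def using that ax[OF that(1)] by (simp add: wf_poly_loop)
  have mn: "wf_prog (21 + D) 4 (make_number 21 c q)" if "c < 21" "length (coeffs q) \<le> D" for c q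
    unfolding make_number_def using that by (intro wf_poly_loop) auto
  have "wf_prog (21 + D) 4 prepare"
    unfolding prepare_def make_marks_def using D sub mb mn by (auto intro!: wf_poly_loop)
  moreover have "wf_prog (21 + D) 4 (main cov mid)"
    unfolding main_def emit_matrix_def wf_prog.simps dl by (auto simp: dl emit_entry_def emit_bound_def)
  ultimately show ?thesis by simp
qed

theorem polytime_red: "polytime_computable (red cov mid)"
proof -
  obtain q1 where q1: "\<And>x. runs prepare (init_state x) (ready x) (poly q1 (length x))"
    using pruns_prepare unfolding pruns_def by auto
  obtain q2 where q2: "\<And>x y. runs (main cov mid) ((ready x)(0 := out_tape y))
      ((ready x)(0 := out_tape (y @ red cov mid x))) (poly q2 (length x))"
    using emitsE[OF emits_main] by (metis UNIV_I)
  show ?thesis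
  proof (rule polytime_computable_if_runs[OF wf_program, where q = "q1 + q2 + 1"])
    fix x
    \<comment> \<open>Copying the input has emptied tape 0, so emission starts from the empty
      word.\<close>
    have "(ready x)(0 := out_tape []) = ready x"
      by (auto simp: ready_def shift_def dirs_defs dirs_def out_tape_def copied_state_def copies_def)
    then have "runs (main cov mid) (ready x) ((ready x)(0 := out_tape (red cov mid x))) (poly q2 (length x))"
      using q2[of x "[]"] by simp
    from runs_Seq[OF q1 this] show "\<exists>s'. runs (Seq prepare (main cov mid)) (init_state x) s' (poly (q1 + q2 + 1) (length x)) \<and>
      fst (s' 0) = word_tape (red cov mid x)"
      by (intro exI[of _ "(ready x)(0 := out_tape (red cov mid x))"]) (simp add: out_tape_def)
  qed auto
qed

end

section \<open>Codes and hardness\<close>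

lemma binary_inject: "binary m = binary n \<Longrightarrow> m = n"
proof (induction m arbitrary: n rule: less_induct)
  case (less m)
  show ?case
  proof (cases "m = 0 \<or> n = 0")
    case True
    then show ?thesis using less.prems by (auto simp: binary.simps[of m] binary.simps[of n] binary.simps[of 0] split: if_splits)
  next
    case False
    then have "odd m = odd n" "binary (m div 2) = binary (n div 2)"
      using less.prems by (auto simp: binary.simps[of m] binary.simps[of n])
    then have "m div 2 = n div 2" "m mod 2 = n mod 2"
      using less.IH[of "m div 2" "n div 2"] False by (auto simp: odd_iff_mod_2_eq_one parity_cases)
    then show ?thesis by (metis div_mult_mod_eq)
  qed
qed

text \<open>The flag bits make the code prefix-free, so codes in a sequence can be split off one by
  one.\<close>

lemma encode_nat_append_inject:
  assumes "encode_nat m @ u = encode_nat n @ v"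
  shows "m = n \<and> u = v"
proof -
  have "concat (map (\<lambda>b. [True, b]) bs) @ [False] @ u = concat (map (\<lambda>b. [True, b]) cs) @ [False] @ v \<Longrightarrow>
    bs = cs \<and> u = v" for bs cs
  proof (induction bs arbitrary: cs)
    case Nil
    then show ?case by (cases cs) auto
  next
    case (Cons b bs)
    then show ?case by (cases cs) auto
  qed
  moreover have "concat (map (\<lambda>b. [True, b]) (binary m)) @ [False] @ u =
    concat (map (\<lambda>b. [True, b]) (binary n)) @ [False] @ v" using assms by (simp add: encode_nat_def)
  ultimately show ?thesis using binary_inject by blast
qed

lemma encode_nats_inject: "encode_nats xs = encode_nats ys \<Longrightarrow> xs = ys"
proof (induction xs arbitrary: ys)
  case Nil
  then show ?case by (cases ys) (auto simp: encode_nats_def encode_nat_def)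
next
  case (Cons x xs)
  then obtain y ys' where ys: "ys = y # ys'"
    by (cases ys) (auto simp: encode_nats_def encode_nat_def)
  have "encode_nat x @ encode_nats xs = encode_nat y @ encode_nats ys'"
    using Cons.prems by (simp add: ys encode_nats_def)
  then show ?case using encode_nat_append_inject Cons.IH ys by blast
qed

definition input_graph :: "nat graph \<Rightarrow> bool" where
  "input_graph G \<longleftrightarrow> simple_graph G \<and> verts G = {..<card (verts G)}"

text \<open>The leading order fixes the length of the matrix, so the rest can be split off; the
  entries determine the edges since every edge of an input graph joins two numbers below the
  order.\<close>

lemma graph_code_append_inject:
  assumes G: "input_graph G" "input_graph H" and eq: "graph_code G @ u = graph_code H @ v"
  shows "G = H \<and> u = v"
proof -
  let ?row = "\<lambda>G n i. map (\<lambda>j. if {i, j} \<in> edges G then 1 else 0 :: nat) [0..<n]"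
  define n where "n = card (verts G)"
  have n: "card (verts H) = n" using eq by (simp add: graph_code_def Let_def n_def)
  have len: "length (concat (map (?row G n) [0..<n])) = length (concat (map (?row H n) [0..<n]))"
    by (simp add: length_concat comp_def)
  have "concat (map (?row G n) [0..<n]) @ u = concat (map (?row H n) [0..<n]) @ v"
    using eq by (simp add: graph_code_def Let_def n n_def[symmetric])
  then have "concat (map (?row G n) [0..<n]) = concat (map (?row H n) [0..<n])" and uv: "u = v"
    using len by (auto simp: append_eq_append_conv)
  then have "map (?row G n) [0..<n] = map (?row H n) [0..<n]"
    by (subst (asm) concat_eq_concat_iff) (auto simp: in_set_zip)
  then have row: "?row G n i = ?row H n i" if "i < n" for i
    using that by (auto simp: map_eq_conv)
  have "(if {i, j} \<in> edges G then 1 else 0 :: nat) = (if {i, j} \<in> edges H then 1 else 0)"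
    if "i < n" "j < n" for i j
    using row[OF that(1)] that(2) by (auto simp: map_eq_conv dest: spec)
  then have e: "{i, j} \<in> edges G \<longleftrightarrow> {i, j} \<in> edges H" if "i < n" "j < n" for i j
    using that by (metis zero_neq_one)
  have verts: "verts G = {..<n}" "verts H = {..<n}"
    using G n by (auto simp: input_graph_def n_def)
  have "edges G = edges H"
  proof (intro set_eqI iffI)
    fix d assume d: "d \<in> edges G"
    then obtain i j where "i < n" "j < n" "d = {i, j}"
      using G(1) verts by (auto simp: input_graph_def simple_graph_def)
    then show "d \<in> edges H" using e d by simp
  next
    fix d assume d: "d \<in> edges H"
    then obtain i j where "i < n" "j < n" "d = {i, j}"
      using G(2) verts by (auto simp: input_graph_def simple_graph_def)
    then show "d \<in> edges G" using e d by simp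
  qed
  then show ?thesis using uv verts by (auto intro: graph.equality)
qed

text \<open>A code fixes the vectors on the vertices only, which is why the optima are shown below
  to depend on nothing else.\<close>

lemma vector_code_append_inject:
  assumes "input_graph G" "vector_code G k @ u = vector_code G k' @ v"
  shows "(\<forall>i\<in>verts G. k i = k' i) \<and> u = v"
proof -
  have "vector_code G k = vector_code G k'" "u = v"
    using assms(2) by (auto simp: append_eq_append_conv vector_code_def)
  moreover have "\<And>i. i \<in> verts G \<longleftrightarrow> i < card (verts G)" using assms(1) unfolding input_graph_def by blast
  ultimately show ?thesis by (auto simp: vector_code_def map_eq_conv)
qed

lemma gpf_max_cong:
  assumes "\<And>v. v \<in> verts G \<Longrightarrow> k v = k' v" "\<And>v. v \<in> verts G \<Longrightarrow> u v = u' v"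
  shows "gpf_max G k u = gpf_max G k' u'"
  using assms by (simp add: gpf_max_def gpf_feasible_def cong: ball_cong)

lemma gdf_min_cong:
  assumes "\<And>v. v \<in> verts G \<Longrightarrow> k v = k' v" "\<And>v. v \<in> verts G \<Longrightarrow> u v = u' v"
  shows "gdf_min G k u = gdf_min G k' u'"
  using assms by (simp add: gdf_min_def gdf_feasible_def cong: ball_cong)

text \<open>Needed because a yes-string only requires some instance with that code to be a yes-instance.\<close>

definition code_faithful :: "'i opt_problem \<Rightarrow> bool" where
  "code_faithful P \<longleftrightarrow> (\<forall>i j B B'. input_graph (graph_of P i) \<longrightarrow> input_graph (graph_of P j) \<longrightarrow>
     code_of P i @ [B] = code_of P j @ [B'] \<longrightarrow> meets P i B = meets P j B')"

lemma label_code_inject: "label_code a = label_code b \<longleftrightarrow> a = b"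
  by (cases a; cases b) auto

lemma code_faithful_fixed_LPF: "code_faithful (fixed_LPF l)"
  unfolding code_faithful_def
proof (intro allI impI)
  fix i j :: "nat graph \<times> (nat \<Rightarrow> nat) \<times> (nat \<Rightarrow> label)" and B B'
  obtain G k t where i: "i = (G, k, t)" by (cases i)
  obtain H k' t' where j: "j = (H, k', t')" by (cases j)
  assume g: "input_graph (graph_of (fixed_LPF l) i)" "input_graph (graph_of (fixed_LPF l) j)"
    and c: "code_of (fixed_LPF l) i @ [B] = code_of (fixed_LPF l) j @ [B']"
  have G: "input_graph G" "input_graph H" using g by (auto simp: fixed_LPF_def i j)
  have "G = H \<and> vector_code G k @ vector_code G (label_code \<circ> t) @ [B] =
      vector_code H k' @ vector_code H (label_code \<circ> t') @ [B']"
    by (rule graph_code_append_inject[OF G]) (use c in \<open>simp add: fixed_LPF_def i j\<close>)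
  then have H: "G = H" and 1: "vector_code G k @ vector_code G (label_code \<circ> t) @ [B] =
      vector_code G k' @ vector_code G (label_code \<circ> t') @ [B']" by auto
  note 2 = vector_code_append_inject[OF G(1) 1]
  note 3 = vector_code_append_inject[OF G(1) conjunct2[OF 2]]
  have "lpf_max l G k t = lpf_max l G k' t'"
    unfolding lpf_max_eq_gpf_max by (rule gpf_max_cong) (use 2 3 in \<open>auto simp: label_code_inject\<close>)
  then show "meets (fixed_LPF l) i B = meets (fixed_LPF l) j B'"
    using 3 H by (simp add: fixed_LPF_def i j)
qed

lemma code_faithful_LPF: "code_faithful LPF"
  unfolding code_faithful_def
proof (intro allI impI)
  fix i j :: "nat graph \<times> nat \<times> (nat \<Rightarrow> nat) \<times> (nat \<Rightarrow> label)" and B B'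
  obtain G l k t where i: "i = (G, l, k, t)" by (cases i)
  obtain H l' k' t' where j: "j = (H, l', k', t')" by (cases j)
  assume g: "input_graph (graph_of LPF i)" "input_graph (graph_of LPF j)"
    and c: "code_of LPF i @ [B] = code_of LPF j @ [B']"
  have G: "input_graph G" "input_graph H" using g by (auto simp: LPF_def i j)
  have "G = H \<and> l # vector_code G k @ vector_code G (label_code \<circ> t) @ [B] =
      l' # vector_code H k' @ vector_code H (label_code \<circ> t') @ [B']"
    by (rule graph_code_append_inject[OF G]) (use c in \<open>simp add: LPF_def i j\<close>)
  then have H: "G = H" and l: "l = l'" and 1: "vector_code G k @ vector_code G (label_code \<circ> t) @ [B] =
      vector_code G k' @ vector_code G (label_code \<circ> t') @ [B']" by auto
  note 2 = vector_code_append_inject[OF G(1) 1]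
  note 3 = vector_code_append_inject[OF G(1) conjunct2[OF 2]]
  have "lpf_max l G k t = lpf_max l G k' t'"
    unfolding lpf_max_eq_gpf_max by (rule gpf_max_cong) (use 2 3 in \<open>auto simp: label_code_inject\<close>)
  then show "meets LPF i B = meets LPF j B'"
    using 3 H l by (simp add: LPF_def i j)
qed

lemma code_faithful_GPF: "code_faithful GPF"
  unfolding code_faithful_def
proof (intro allI impI)
  fix i j :: "nat graph \<times> (nat \<Rightarrow> nat) \<times> (nat \<Rightarrow> nat)" and B B'
  obtain G k t where i: "i = (G, k, t)" by (cases i)
  obtain H k' t' where j: "j = (H, k', t')" by (cases j)
  assume g: "input_graph (graph_of GPF i)" "input_graph (graph_of GPF j)"
    and c: "code_of GPF i @ [B] = code_of GPF j @ [B']"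
  have G: "input_graph G" "input_graph H" using g by (auto simp: GPF_def i j)
  have "G = H \<and> vector_code G k @ vector_code G t @ [B] = vector_code H k' @ vector_code H t' @ [B']"
    by (rule graph_code_append_inject[OF G]) (use c in \<open>simp add: GPF_def i j\<close>)
  then have H: "G = H" and 1: "vector_code G k @ vector_code G t @ [B] = vector_code G k' @ vector_code G t' @ [B']"
    by auto
  note 2 = vector_code_append_inject[OF G(1) 1]
  note 3 = vector_code_append_inject[OF G(1) conjunct2[OF 2]]
  have "gpf_max G k t = gpf_max G k' t'" by (rule gpf_max_cong) (use 2 3 in auto)
  then show "meets GPF i B = meets GPF j B'" using 3 H by (simp add: GPF_def i j)
qed

lemma code_faithful_GDF: "code_faithful GDF"
  unfolding code_faithful_def
proof (intro allI impI)
  fix i j :: "nat graph \<times> (nat \<Rightarrow> nat) \<times> (nat \<Rightarrow> nat)" and B B'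
  obtain G k t where i: "i = (G, k, t)" by (cases i)
  obtain H k' t' where j: "j = (H, k', t')" by (cases j)
  assume g: "input_graph (graph_of GDF i)" "input_graph (graph_of GDF j)"
    and c: "code_of GDF i @ [B] = code_of GDF j @ [B']"
  have G: "input_graph G" "input_graph H" using g by (auto simp: GDF_def i j)
  have "G = H \<and> vector_code G k @ vector_code G t @ [B] = vector_code H k' @ vector_code H t' @ [B']"
    by (rule graph_code_append_inject[OF G]) (use c in \<open>simp add: GDF_def i j\<close>)
  then have H: "G = H" and 1: "vector_code G k @ vector_code G t @ [B] = vector_code G k' @ vector_code G t' @ [B']"
    by auto
  note 2 = vector_code_append_inject[OF G(1) 1]
  note 3 = vector_code_append_inject[OF G(1) conjunct2[OF 2]]
  have "gdf_min G k t = gdf_min G k' t'" by (rule gdf_min_cong) (use 2 3 in auto)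
  then show "meets GDF i B = meets GDF j B'" using 3 H by (simp add: GDF_def i j)
qed

text \<open>\<open>C\<close> ranges over all classes containing the doubly chordal graphs, so one
  reduction serves both classes of the theorem.\<close>

lemma NP_hard_onI:
  assumes faithful: "code_faithful P" and C: "\<And>G. doubly_chordal G \<Longrightarrow> C G"
    and red: "\<And>M p. turing_machine M \<Longrightarrow> \<exists>inst B.
      polytime_computable (\<lambda>x. encode_nats (code_of P (inst x) @ [B x])) \<and>
      (\<forall>x. input_graph (graph_of P (inst x)) \<and> doubly_chordal (graph_of P (inst x)) \<and>
         (meets P (inst x) (B x) \<longleftrightarrow> accepts_within M x (poly p (length x))))"
  shows "NP_hard_on P C"
  unfolding NP_hard_on_def
proof
  fix L assume "L \<in> NP"
  then obtain M and p :: "nat poly" where M: "turing_machine M"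
    and L: "\<And>x. x \<in> L \<longleftrightarrow> accepts_within M x (poly p (length x))" unfolding NP_def by blast
  obtain inst B where poly: "polytime_computable (\<lambda>x. encode_nats (code_of P (inst x) @ [B x]))"
    and ig: "\<And>x. input_graph (graph_of P (inst x))" and dc: "\<And>x. doubly_chordal (graph_of P (inst x))"
    and meets: "\<And>x. meets P (inst x) (B x) \<longleftrightarrow> x \<in> L"
    using red[OF M, of p] L by blast
  have inst: "inst x \<in> instances P C" for x
    using ig[of x] dc[of x] C by (simp add: instances_def input_graph_def)
  have "x \<in> L" if yes: "encode_nats (code_of P (inst x) @ [B x]) \<in> yes_strings P C" for x
  proof -
    obtain i b where i: "encode_nats (code_of P (inst x) @ [B x]) = encode_nats (code_of P i @ [b])"
      "i \<in> instances P C" "meets P i b" using yes unfolding yes_strings_def by blast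
    have "input_graph (graph_of P i)" using i(2) by (simp add: instances_def input_graph_def)
    then have "meets P (inst x) (B x)"
      using faithful ig[of x] encode_nats_inject[OF i(1)] i(3) unfolding code_faithful_def by blast
    then show ?thesis by (simp add: meets)
  qed
  moreover have "encode_nats (code_of P (inst x) @ [B x]) \<in> yes_strings P C" if "x \<in> L" for x
    unfolding yes_strings_def using inst meets that by blast
  moreover have "encode_nats (code_of P (inst x) @ [B x]) \<in> instance_strings P C" for x
    unfolding instance_strings_def using inst by blast
  ultimately show "\<exists>r. polytime_computable r \<and>
      (\<forall>x. r x \<in> instance_strings P C \<and> (x \<in> L \<longleftrightarrow> r x \<in> yes_strings P C))"
    using poly by (intro exI[of _ "\<lambda>x. encode_nats (code_of P (inst x) @ [B x])"]) blast
qed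

section \<open>The instances and their optima\<close>

context reduction
begin

definition inst_rhs :: "bool \<Rightarrow> bool list \<Rightarrow> nat \<Rightarrow> nat" where
  "inst_rhs cov x = (\<lambda>i. rhs cov x (T x) (vlist (T x) ! i))"

definition inst_label :: "bool list \<Rightarrow> nat \<Rightarrow> label" where
  "inst_label x = (\<lambda>i. if is_val (vlist (T x) ! i) then Free else Zero)"

definition inst_cap :: "bool list \<Rightarrow> nat \<Rightarrow> nat" where
  "inst_cap x = (\<lambda>i. if is_val (vlist (T x) ! i) then 1 else 0)"

lemma hard_graph_class:
  "input_graph (hard_graph cov x t)" "doubly_chordal (hard_graph cov x t)"
proof -
  interpret split_system "vlist t" is_univ is_val "inc cov x t" by (rule split_system_vlist)
  show "input_graph (hard_graph cov x t)" "doubly_chordal (hard_graph cov x t)"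
    using simple_G doubly_chordal_G by (auto simp: hard_graph_def input_graph_def verts_G)
qed

lemma vector_codes:
  "vector_code (hard_graph cov x (T x)) (inst_rhs cov x) = map (rhs cov x (T x)) (vlist (T x))"
  "vector_code (hard_graph cov x (T x)) (inst_cap x) = map (\<lambda>v. if is_val v then 1 else 0) (vlist (T x))"
  "vector_code (hard_graph cov x (T x)) (label_code \<circ> inst_label x) =
     map (\<lambda>v. if is_val v then 1 else 0) (vlist (T x))"
proof -
  \<comment> \<open>Labels and caps have the same code, so one program writes the instances of
    \<open>LPF\<close> as well as those of \<open>GPF\<close>.\<close>
  have "label_code \<circ> inst_label x = inst_cap x"
    by (auto simp: inst_label_def inst_cap_def)
  moreover show
    "vector_code (hard_graph cov x (T x)) (inst_rhs cov x) = map (rhs cov x (T x)) (vlist (T x))"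
    "vector_code (hard_graph cov x (T x)) (inst_cap x) = map (\<lambda>v. if is_val v then 1 else 0) (vlist (T x))"
    unfolding hard_graph_def inst_rhs_def inst_cap_def by (rule vector_code_list_graph)+
  ultimately show "vector_code (hard_graph cov x (T x)) (label_code \<circ> inst_label x) =
     map (\<lambda>v. if is_val v then 1 else 0) (vlist (T x))" by simp
qed

lemma lpf_max_iff:
  assumes "l \<ge> 1"
  shows "groups_number (T x) \<le> lpf_max l (hard_graph False x (T x)) (inst_rhs False x) (inst_label x) \<longleftrightarrow>
    accepts_within M x (poly p (length x))"
proof -
  have "(\<lambda>v. if inst_label x v = Zero then 0 else l) = (\<lambda>i. if is_val (vlist (T x) ! i) then l else 0)"
    by (auto simp: inst_label_def)
  then show ?thesis
    using packing_iff_solvable[OF assms, of "T x" x] accepts_iff_solvable[of x "T x"]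
    by (simp add: lpf_max_eq_gpf_max inst_rhs_def T_def)
qed

lemma gpf_max_iff:
  "groups_number (T x) \<le> gpf_max (hard_graph False x (T x)) (inst_rhs False x) (inst_cap x) \<longleftrightarrow>
    accepts_within M x (poly p (length x))"
  using packing_iff_solvable[of 1 "T x" x] accepts_iff_solvable[of x "T x"]
  by (simp add: inst_rhs_def inst_cap_def T_def)

lemma gdf_min_iff:
  "gdf_min (hard_graph True x (T x)) (inst_rhs True x) (inst_cap x) \<le> enat (groups_number (T x)) \<longleftrightarrow>
    accepts_within M x (poly p (length x))"
  using covering_iff_solvable[of x "T x"] accepts_iff_solvable[of x "T x"]
  by (simp add: inst_rhs_def inst_cap_def T_def)

end

section \<open>Hardness of the four problems\<close>

lemma NP_hard_fixed_LPF:
  assumes "l \<ge> 1" and C: "\<And>G. doubly_chordal G \<Longrightarrow> C G"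
  shows "NP_hard_on (fixed_LPF l) C"
proof (rule NP_hard_onI[OF code_faithful_fixed_LPF C])
  fix M and p :: "nat poly" assume "turing_machine M"
  then interpret reduction M p by unfold_locales
  let ?inst = "\<lambda>x. (hard_graph False x (T x), inst_rhs False x, inst_label x)"
  have "(\<lambda>x. encode_nats (code_of (fixed_LPF l) (?inst x) @ [groups_number (T x)])) = red False []"
    by (auto simp: fixed_LPF_def vector_codes red_def)
  then show "\<exists>inst B. polytime_computable (\<lambda>x. encode_nats (code_of (fixed_LPF l) (inst x) @ [B x])) \<and>
      (\<forall>x. input_graph (graph_of (fixed_LPF l) (inst x)) \<and> doubly_chordal (graph_of (fixed_LPF l) (inst x)) \<and>
         (meets (fixed_LPF l) (inst x) (B x) \<longleftrightarrow> accepts_within M x (poly p (length x))))"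
    using polytime_red[of False "[]"] hard_graph_class lpf_max_iff[OF assms(1)]
    by (intro exI[of _ ?inst] exI[of _ "\<lambda>x. groups_number (T x)"]) (simp add: fixed_LPF_def)
qed

text \<open>Instances with cap 1 are already hard, and \<open>mid = [1]\<close> writes this cap into
  the code.\<close>

lemma NP_hard_LPF:
  assumes C: "\<And>G. doubly_chordal G \<Longrightarrow> C G"
  shows "NP_hard_on LPF C"
proof (rule NP_hard_onI[OF code_faithful_LPF C])
  fix M and p :: "nat poly" assume "turing_machine M"
  then interpret reduction M p by unfold_locales
  let ?inst = "\<lambda>x. (hard_graph False x (T x), 1::nat, inst_rhs False x, inst_label x)"
  have "(\<lambda>x. encode_nats (code_of LPF (?inst x) @ [groups_number (T x)])) = red False [1]"
    by (auto simp: LPF_def vector_codes red_def)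
  then show "\<exists>inst B. polytime_computable (\<lambda>x. encode_nats (code_of LPF (inst x) @ [B x])) \<and>
      (\<forall>x. input_graph (graph_of LPF (inst x)) \<and> doubly_chordal (graph_of LPF (inst x)) \<and>
         (meets LPF (inst x) (B x) \<longleftrightarrow> accepts_within M x (poly p (length x))))"
    using polytime_red[of False "[1]"] hard_graph_class lpf_max_iff[of 1]
    by (intro exI[of _ ?inst] exI[of _ "\<lambda>x. groups_number (T x)"]) (simp add: LPF_def)
qed

lemma NP_hard_GPF:
  assumes C: "\<And>G. doubly_chordal G \<Longrightarrow> C G"
  shows "NP_hard_on GPF C"
proof (rule NP_hard_onI[OF code_faithful_GPF C])
  fix M and p :: "nat poly" assume "turing_machine M"
  then interpret reduction M p by unfold_locales
  let ?inst = "\<lambda>x. (hard_graph False x (T x), inst_rhs False x, inst_cap x)"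
  have "(\<lambda>x. encode_nats (code_of GPF (?inst x) @ [groups_number (T x)])) = red False []"
    by (auto simp: GPF_def vector_codes red_def)
  then show "\<exists>inst B. polytime_computable (\<lambda>x. encode_nats (code_of GPF (inst x) @ [B x])) \<and>
      (\<forall>x. input_graph (graph_of GPF (inst x)) \<and> doubly_chordal (graph_of GPF (inst x)) \<and>
         (meets GPF (inst x) (B x) \<longleftrightarrow> accepts_within M x (poly p (length x))))"
    using polytime_red[of False "[]"] hard_graph_class gpf_max_iff
    by (intro exI[of _ ?inst] exI[of _ "\<lambda>x. groups_number (T x)"]) (simp add: GPF_def)
qed

lemma NP_hard_GDF:
  assumes C: "\<And>G. doubly_chordal G \<Longrightarrow> C G"
  shows "NP_hard_on GDF C"
proof (rule NP_hard_onI[OF code_faithful_GDF C])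
  fix M and p :: "nat poly" assume "turing_machine M"
  then interpret reduction M p by unfold_locales
  let ?inst = "\<lambda>x. (hard_graph True x (T x), inst_rhs True x, inst_cap x)"
  have "(\<lambda>x. encode_nats (code_of GDF (?inst x) @ [groups_number (T x)])) = red True []"
    by (auto simp: GDF_def vector_codes red_def)
  then show "\<exists>inst B. polytime_computable (\<lambda>x. encode_nats (code_of GDF (inst x) @ [B x])) \<and>
      (\<forall>x. input_graph (graph_of GDF (inst x)) \<and> doubly_chordal (graph_of GDF (inst x)) \<and>
         (meets GDF (inst x) (B x) \<longleftrightarrow> accepts_within M x (poly p (length x))))"
    using polytime_red[of True "[]"] hard_graph_class gdf_min_iff
    by (intro exI[of _ ?inst] exI[of _ "\<lambda>x. groups_number (T x)"]) (simp add: GDF_def)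
qed

theorem theorem3:
  fixes l :: nat
  assumes "l \<ge> 1"
  shows "NP_hard_on (fixed_LPF l) dually_chordal \<and> NP_hard_on (fixed_LPF l) doubly_chordal \<and>
         NP_hard_on LPF dually_chordal \<and> NP_hard_on LPF doubly_chordal \<and>
         NP_hard_on GDF dually_chordal \<and> NP_hard_on GDF doubly_chordal \<and>
         NP_hard_on GPF dually_chordal \<and> NP_hard_on GPF doubly_chordal"
  using assms
  by (intro conjI NP_hard_fixed_LPF NP_hard_LPF NP_hard_GDF NP_hard_GPF) (simp_all add: doubly_chordal_def)

end
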